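(* The problem of deciding, given a test-free non-deterministic register transducer, whether it is functional is in $\mathrm{PTime}$.
   Context: Fix finite alphabets $\Sigma,\Gamma$, a countably infinite set $\mathcal{D}$ of data values and a distinguished $d_0\in\mathcal{D}$. A test over a finite register set $R$ is a Boolean combination of $\top,\bot,r^{=},r^{\neq}$ ($r\in R$); for $\tau:R\to\mathcal{D}$ and $d\in\mathcal{D}$, $\tau,d\models r^{=}$ iff $\tau(r)=d$, $\tau,d\models r^{\neq}$ iff $\tau(r)\neq d$. A non-deterministic register transducer (NRT) is $T=(Q,R,i_0,F,\Delta)$ with finite states $Q$, initial $i_0$, accepting $F\subseteq Q$, finite register set $R$, and finite $\Delta\subseteq Q\times\Sigma\times\mathrm{Tests}_R\times2^R\times(\Gamma\times R)^*\times Q$. From configuration $(q,\tau)$, reading $(\sigma,d)$, a transition $(q,\sigma,\phi,\mathrm{asgn},o,q')$ with $\tau,d\models\phi$ leads to $(q',\tau')$ with $\tau'(r)=d$ if $r\in\mathrm{asgn}$ and $\tau'(r)=\tau(r)$ otherwise, outputting $(\gamma_1,\tau'(r_1))\cdots(\gamma_m,\tau'(r_m))$ where $o=(\gamma_1,r_1)\cdots(\gamma_m,r_m)$. An accepting run starts in $i_0$ with all registers equal to $d_0$ and visits $F$ infinitely often; standing assumption: accepting runs produce infinite outputs. $T$ is functional if the set of (input, output) pairs of accepting runs is a partial function. $T$ is test-free if every transition has test $\phi=\top$. *)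

theory Defs
  imports "HOL-Library.Countable" "HOL-Library.Infinite_Set"
    "HOL-Computational_Algebra.Polynomial"
begin

subsection \<open>Polynomial time: deterministic multi-tape Turing machines\<close>

datatype head_move = MoveLeft | Stay | MoveRight

text \<open>
  States and tape symbols are initial segments of the natural numbers. Symbol 0 is the blank,
  symbols 1 and 2 represent the input bits.
\<close>

record tm =
  num_tapes :: nat
  num_symbols :: nat
  num_states :: nat
  start_state :: nat
  accept_state :: nat
  reject_state :: nat
  tm_delta :: "nat \<Rightarrow> nat list \<Rightarrow> nat \<times> (nat \<times> head_move) list"

definition turing_machine :: "tm \<Rightarrow> bool" where
  "turing_machine M \<longleftrightarrow>
     num_tapes M \<ge> 1 \<and> num_symbols M \<ge> 3 \<and>
     start_state M < num_states M \<and> accept_state M < num_states M \<and>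
     reject_state M < num_states M \<and> accept_state M \<noteq> reject_state M \<and>
     (\<forall>q xs. q < num_states M \<and> length xs = num_tapes M \<and> (\<forall>x\<in>set xs. x < num_symbols M) \<longrightarrow>
        fst (tm_delta M q xs) < num_states M \<and>
        length (snd (tm_delta M q xs)) = num_tapes M \<and>
        (\<forall>(y, mv)\<in>set (snd (tm_delta M q xs)). y < num_symbols M))"

text \<open>A tape is given by its head position and its content, infinite in both directions.\<close>

type_synonym tape = "int \<times> (int \<Rightarrow> nat)"
type_synonym tm_config = "nat \<times> tape list"

fun tape_act :: "nat \<times> head_move \<Rightarrow> tape \<Rightarrow> tape" where
  "tape_act (y, MoveLeft) (h, c) = (h - 1, c(h := y))"
| "tape_act (y, Stay) (h, c) = (h, c(h := y))"
| "tape_act (y, MoveRight) (h, c) = (h + 1, c(h := y))"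

text \<open>Configurations in the accepting or the rejecting state are halted: they do not change.\<close>

definition tm_step :: "tm \<Rightarrow> tm_config \<Rightarrow> tm_config" where
  "tm_step M = (\<lambda>(q, ts).
     if q = accept_state M \<or> q = reject_state M then (q, ts)
     else (let (q', acts) = tm_delta M q (map (\<lambda>(h, c). c h) ts)
           in (q', map2 tape_act acts ts)))"

definition input_tape :: "bool list \<Rightarrow> tape" where
  "input_tape w =
     (0, \<lambda>i. if 0 \<le> i \<and> i < int (length w) then (if w ! nat i then 2 else 1) else 0)"

definition tm_init :: "tm \<Rightarrow> bool list \<Rightarrow> tm_config" where
  "tm_init M w = (start_state M, input_tape w # replicate (num_tapes M - 1) (0, \<lambda>_. 0))"

definition tm_run :: "tm \<Rightarrow> bool list \<Rightarrow> nat \<Rightarrow> tm_config" where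
  "tm_run M w t = (tm_step M ^^ t) (tm_init M w)"

text \<open>
  Halted configurations being fixed points, the condition says that on every input the machine
  halts within the polynomial bound and gives the correct answer.
\<close>

definition PTIME :: "bool list set set" where
  "PTIME = {L. \<exists>M (p :: nat poly). turing_machine M \<and>
     (\<forall>w. fst (tm_run M w (poly p (length w))) =
            (if w \<in> L then accept_state M else reject_state M))}"


subsection \<open>Non-deterministic register transducers\<close>

datatype 'r test =
    TTop
  | TBot
  | TEq 'r
  | TNeq 'r
  | TNot "'r test"
  | TAnd "'r test" "'r test"
  | TOr "'r test" "'r test"

primrec sat_test :: "('r \<Rightarrow> 'd) \<Rightarrow> 'd \<Rightarrow> 'r test \<Rightarrow> bool" where
  "sat_test \<tau> d TTop \<longleftrightarrow> True"
| "sat_test \<tau> d TBot \<longleftrightarrow> False"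
| "sat_test \<tau> d (TEq r) \<longleftrightarrow> \<tau> r = d"
| "sat_test \<tau> d (TNeq r) \<longleftrightarrow> \<tau> r \<noteq> d"
| "sat_test \<tau> d (TNot \<phi>) \<longleftrightarrow> \<not> sat_test \<tau> d \<phi>"
| "sat_test \<tau> d (TAnd \<phi> \<psi>) \<longleftrightarrow> sat_test \<tau> d \<phi> \<and> sat_test \<tau> d \<psi>"
| "sat_test \<tau> d (TOr \<phi> \<psi>) \<longleftrightarrow> sat_test \<tau> d \<phi> \<or> sat_test \<tau> d \<psi>"

text \<open>Source state, input letter, test, assigned registers, output word, target state.\<close>

type_synonym ('a, 'b, 'q, 'r) transition =
  "'q \<times> 'a \<times> 'r test \<times> 'r set \<times> ('b \<times> 'r) list \<times> 'q"

record ('a, 'b, 'q, 'r) nrt =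
  states :: "'q set"
  registers :: "'r set"
  initial :: 'q
  accepting :: "'q set"
  transitions :: "('a, 'b, 'q, 'r) transition set"

definition is_nrt :: "('a, 'b, 'q, 'r) nrt \<Rightarrow> bool" where
  "is_nrt T \<longleftrightarrow>
     finite (states T) \<and> finite (registers T) \<and> initial T \<in> states T \<and>
     accepting T \<subseteq> states T \<and> finite (transitions T) \<and>
     (\<forall>(q, \<sigma>, \<phi>, asgn, out, q') \<in> transitions T.
        q \<in> states T \<and> q' \<in> states T \<and> set_test \<phi> \<subseteq> registers T \<and>
        asgn \<subseteq> registers T \<and> snd ` set out \<subseteq> registers T)"

text \<open>
  Register valuations are total functions; on names outside \<open>registers T\<close> they keep the
  initial data value forever and are never inspected.
\<close>

definition nrt_step ::
  "('a, 'b, 'q, 'r) nrt \<Rightarrow> 'q \<times> ('r \<Rightarrow> 'd) \<Rightarrow> 'a \<times> 'd \<Rightarrow> ('b \<times> 'd) list \<Rightarrow> 'q \<times> ('r \<Rightarrow> 'd) \<Rightarrow> bool"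
where
  "nrt_step T = (\<lambda>(q, \<tau>) (\<sigma>, d) v (q', \<tau>').
     \<exists>\<phi> asgn out. (q, \<sigma>, \<phi>, asgn, out, q') \<in> transitions T \<and> sat_test \<tau> d \<phi> \<and>
       \<tau>' = (\<lambda>r. if r \<in> asgn then d else \<tau> r) \<and>
       v = map (\<lambda>(\<gamma>, r). (\<gamma>, \<tau>' r)) out)"

text \<open>\<open>vs i\<close> is the output of the \<open>i\<close>-th step.\<close>

definition accepting_run ::
  "'d \<Rightarrow> ('a, 'b, 'q, 'r) nrt \<Rightarrow> (nat \<Rightarrow> 'a \<times> 'd) \<Rightarrow> (nat \<Rightarrow> 'q \<times> ('r \<Rightarrow> 'd)) \<Rightarrow>
    (nat \<Rightarrow> ('b \<times> 'd) list) \<Rightarrow> bool"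
where
  "accepting_run d0 T u \<rho> vs \<longleftrightarrow>
     \<rho> 0 = (initial T, \<lambda>_. d0) \<and>
     (\<forall>i. nrt_step T (\<rho> i) (u i) (vs i) (\<rho> (Suc i))) \<and>
     (\<exists>\<^sub>\<infinity>i. fst (\<rho> i) \<in> accepting T)"

text \<open>
  The concatenation of infinitely many finite words, as a finite or infinite word: the value at
  position \<open>n\<close> is \<open>None\<close> if the concatenation has at most \<open>n\<close> letters.
\<close>

definition concat_omega :: "(nat \<Rightarrow> 'c list) \<Rightarrow> nat \<Rightarrow> 'c option" where
  "concat_omega vs n =
     (if \<exists>m. n < length (concat (map vs [0..<m]))
      then Some (concat (map vs [0..<(LEAST m. n < length (concat (map vs [0..<m])))]) ! n)
      else None)"

definition transduction ::
  "'d \<Rightarrow> ('a, 'b, 'q, 'r) nrt \<Rightarrow> ((nat \<Rightarrow> 'a \<times> 'd) \<times> (nat \<Rightarrow> ('b \<times> 'd) option)) set"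
where
  "transduction d0 T = {(u, concat_omega vs) | u vs. \<exists>\<rho>. accepting_run d0 T u \<rho> vs}"

definition infinite_outputs :: "'d \<Rightarrow> ('a, 'b, 'q, 'r) nrt \<Rightarrow> bool" where
  "infinite_outputs d0 T \<longleftrightarrow> (\<forall>u \<rho> vs. accepting_run d0 T u \<rho> vs \<longrightarrow> (\<exists>\<^sub>\<infinity>i. vs i \<noteq> []))"

definition functional :: "'d \<Rightarrow> ('a, 'b, 'q, 'r) nrt \<Rightarrow> bool" where
  "functional d0 T \<longleftrightarrow> single_valued (transduction d0 T)"

definition test_free :: "('a, 'b, 'q, 'r) nrt \<Rightarrow> bool" where
  "test_free T \<longleftrightarrow> (\<forall>(q, \<sigma>, \<phi>, asgn, out, q') \<in> transitions T. \<phi> = TTop)"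


subsection \<open>Encoding transducers as binary words\<close>

text \<open>
  All codes are prefix-free, so components can simply be concatenated. Numbers are written in
  binary, least significant bit first, each bit preceded by a continuation flag.
\<close>

fun enc_nat :: "nat \<Rightarrow> bool list" where
  "enc_nat n = (if n = 0 then [False] else True # odd n # enc_nat (n div 2))"

declare enc_nat.simps [simp del]

definition enc_list :: "('c \<Rightarrow> bool list) \<Rightarrow> 'c list \<Rightarrow> bool list" where
  "enc_list f xs = concat (map (\<lambda>x. True # f x) xs) @ [False]"

definition enc_set :: "nat set \<Rightarrow> bool list" where
  "enc_set A = enc_list enc_nat (sorted_list_of_set A)"

primrec enc_test :: "nat test \<Rightarrow> bool list" where
  "enc_test TTop = enc_nat 0"
| "enc_test TBot = enc_nat 1"
| "enc_test (TEq r) = enc_nat 2 @ enc_nat r"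
| "enc_test (TNeq r) = enc_nat 3 @ enc_nat r"
| "enc_test (TNot \<phi>) = enc_nat 4 @ enc_test \<phi>"
| "enc_test (TAnd \<phi> \<psi>) = enc_nat 5 @ enc_test \<phi> @ enc_test \<psi>"
| "enc_test (TOr \<phi> \<psi>) = enc_nat 6 @ enc_test \<phi> @ enc_test \<psi>"

text \<open>Letters of the fixed finite alphabets are coded through an arbitrary fixed numbering.\<close>

fun enc_transition :: "('a::finite, 'b::finite, nat, nat) transition \<Rightarrow> bool list" where
  "enc_transition (q, \<sigma>, \<phi>, asgn, out, q') =
     enc_nat q @ enc_nat (to_nat \<sigma>) @ enc_test \<phi> @ enc_set asgn @
     enc_list (\<lambda>(\<gamma>, r). enc_nat (to_nat \<gamma>) @ enc_nat r) out @ enc_nat q'"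

text \<open>
  States and registers are named by natural numbers. A transducer has one code for every
  enumeration of its transition set.
\<close>

definition encodes :: "bool list \<Rightarrow> ('a::finite, 'b::finite, nat, nat) nrt \<Rightarrow> bool" where
  "encodes w T \<longleftrightarrow>
     (\<exists>ts. distinct ts \<and> set ts = transitions T \<and>
        w = enc_set (states T) @ enc_set (registers T) @ enc_nat (initial T) @
            enc_set (accepting T) @ enc_list enc_transition ts)"

end

theory Submission
  imports Defs
begin

text \<open>
  Without tests, the runs on an input depend only on its labels. On pairwise distinct data values, an
  output value identifies the time at which it was read. Hence the transducer is not functional iff two
  accepting runs with the same labels have, at some common output position, different letters or values read
  at different times. Such pairs of runs correspond to lassos in a graph of polynomial size with an
  integer counter, the difference of the numbers of output letters before that position, reached by a
  walk of total weight 0.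

  With weights -1, 0 and 1, the pairs of nodes joined by walks of weight 0 are the least relation that is
  reflexive, transitive, contains the edges of weight 0, and is closed under adding an edge of weight 1 on one
  side and one of weight -1 on the other. So the existence of a lasso, including the parsing of the
  code of the transducer, is expressed by a fixed Datalog program whose constants are the positions of
  the input word. A multi-tape machine evaluates such programs by nested loops over counters bounded by the
  length of the word, and therefore in polynomial time; it iterates as often as there are possible facts.
\<close>

subsection \<open>Structured programs for Turing machines\<close>


text \<open>Walks of weight 0 in the counter graph may need large counter values, and no bound on
  them is derived: the closure works on pairs of nodes and asks only for the existence of a walk.
  Datalog is the interface to the machine model because a positive program needs only loops, address
  arithmetic and one bit per fact, and can do the parsing as well. As there is no negation,
  inequality of numbers and non-membership in a set are relations with rules of their own, and the
  accepted words are those from which the goal is not derivable. Different origins are witnessed by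
  one time s, with one value read at s or later and the other before s. The initial value
  \<open>d0\<close> counts as read before all times, so the roles of the runs may have to be
  exchanged. A guessed s costs only a change of mode in the graph. Infinite outputs matter in one
  direction: two different outputs then differ at a position where both have a letter. The relation
  names are 1 to 22, and 0, 1, 2 also serve as modes and flags; hence 23 constants. The universe has
  \<open>length w + 23\<close> elements, which covers all constants and the positions 0 to
  \<open>length w\<close>.\<close>

datatype com =
    Mv nat head_move
  | Wr nat nat
  | Sq com com
  | Br nat nat com com
  | Wh nat nat com

type_synonym conf = "(nat \<Rightarrow> int) \<times> (nat \<Rightarrow> int \<Rightarrow> nat)"

fun shift :: "head_move \<Rightarrow> int \<Rightarrow> int" where
  "shift MoveLeft h = h - 1"
| "shift Stay h = h"
| "shift MoveRight h = h + 1"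

text \<open>A stack of pending commands instead of a big-step semantics: a step looks at no more
  than one scanned cell, and only finitely many stacks arise from a command, so that a stack can be
  a state of a machine.\<close>

fun cstep :: "com list \<times> conf \<Rightarrow> com list \<times> conf" where
  "cstep ([], s) = ([], s)"
| "cstep (Mv i d # k, (H, C)) = (k, (H(i := shift d (H i)), C))"
| "cstep (Wr i y # k, (H, C)) = (k, (H, C(i := (C i)(H i := y))))"
| "cstep (Sq a b # k, s) = (a # b # k, s)"
| "cstep (Br i y a b # k, (H, C)) = ((if C i (H i) = y then a else b) # k, (H, C))"
| "cstep (Wh i y a # k, (H, C)) = (if C i (H i) = y then k else a # Wh i y a # k, (H, C))"

text \<open>The continuations that can occur while the head command of \<open>c # k\<close> is being executed.\<close>

primrec conts :: "com \<Rightarrow> com list \<Rightarrow> com list set" where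
  "conts (Mv i d) k = {Mv i d # k}"
| "conts (Wr i y) k = {Wr i y # k}"
| "conts (Sq a b) k = insert (Sq a b # k) (conts a (b # k) \<union> conts b k)"
| "conts (Br i y a b) k = insert (Br i y a b # k) (conts a k \<union> conts b k)"
| "conts (Wh i y a) k = insert (Wh i y a # k) (conts a (Wh i y a # k))"

primrec wfc :: "nat \<Rightarrow> com \<Rightarrow> bool" where
  "wfc n (Mv i d) \<longleftrightarrow> i < n"
| "wfc n (Wr i y) \<longleftrightarrow> i < n \<and> y < 3"
| "wfc n (Sq a b) \<longleftrightarrow> wfc n a \<and> wfc n b"
| "wfc n (Br i y a b) \<longleftrightarrow> i < n \<and> wfc n a \<and> wfc n b"
| "wfc n (Wh i y a) \<longleftrightarrow> i < n \<and> wfc n a"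

lemma finite_conts: "finite (conts c k)"
  by (induction c arbitrary: k) auto

lemma conts_start: "c # k \<in> conts c k"
  by (cases c) auto

lemma conts_step: "ks \<in> conts c k \<Longrightarrow> fst (cstep (ks, s)) \<in> insert k (conts c k)"
proof (induction c arbitrary: k)
  case (Sq a b)
  from Sq.prems consider "ks = Sq a b # k" | "ks \<in> conts a (b # k)" | "ks \<in> conts b k" by auto
  then show ?case
    using Sq.IH(1)[of "b # k"] Sq.IH(2)[of k] conts_start[of a "b # k"] conts_start[of b k]
    by cases auto
next
  case (Br i y a b)
  from Br.prems consider "ks = Br i y a b # k" | "ks \<in> conts a k" | "ks \<in> conts b k" by auto
  then show ?case
    using Br.IH(1)[of k] Br.IH(2)[of k] conts_start[of a k] conts_start[of b k]
    by cases (cases s; auto)+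
next
  case (Wh i y a)
  from Wh.prems consider "ks = Wh i y a # k" | "ks \<in> conts a (Wh i y a # k)" by auto
  then show ?case
    using Wh.IH[of "Wh i y a # k"] conts_start[of a "Wh i y a # k"]
    by cases (cases s; auto)+
qed (cases s; simp)+

lemma conts_wfc:
  "wfc n c \<Longrightarrow> list_all (wfc n) k \<Longrightarrow> ks \<in> conts c k \<Longrightarrow> list_all (wfc n) ks"
proof (induction c arbitrary: k)
  case (Sq a b)
  from Sq.prems(3) consider "ks = Sq a b # k" | "ks \<in> conts a (b # k)" | "ks \<in> conts b k" by auto
  then show ?case
    using Sq.prems(1,2) Sq.IH(1)[of "b # k"] Sq.IH(2)[of k] by cases simp_all
next
  case (Br i y a b)
  from Br.prems(3) consider "ks = Br i y a b # k" | "ks \<in> conts a k" | "ks \<in> conts b k" by auto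
  then show ?case
    using Br.prems(1,2) Br.IH(1)[of k] Br.IH(2)[of k] by cases simp_all
next
  case (Wh i y a)
  from Wh.prems(3) consider "ks = Wh i y a # k" | "ks \<in> conts a (Wh i y a # k)" by auto
  then show ?case
    using Wh.prems(1,2) Wh.IH[of "Wh i y a # k"] by cases simp_all
qed simp_all

text \<open>A machine writes on all tapes in every step, so an untouched tape gets its scanned
  symbol back.\<close>

fun actions :: "nat \<Rightarrow> com list \<Rightarrow> nat list \<Rightarrow> (nat \<times> head_move) list" where
  "actions n (Mv i d # k) xs = map (\<lambda>j. (xs ! j, if j = i then d else Stay)) [0..<n]"
| "actions n (Wr i y # k) xs = map (\<lambda>j. (if j = i then y else xs ! j, Stay)) [0..<n]"
| "actions n ks xs = map (\<lambda>j. (xs ! j, Stay)) [0..<n]"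

definition tapes :: "nat \<Rightarrow> conf \<Rightarrow> tape list" where
  "tapes n s = map (\<lambda>j. (fst s j, snd s j)) [0..<n]"

text \<open>A stand-in configuration with the symbols \<open>xs\<close> under the heads. By
  \<open>fst_cstep_cong\<close> the next stack depends on nothing else, so the transition function
  can compute it from here.\<close>

definition scan :: "nat list \<Rightarrow> conf" where
  "scan xs = (\<lambda>_. 0, \<lambda>j _. xs ! j)"

lemma fst_cstep_cong:
  assumes "list_all (wfc n) ks" and "\<And>j. j < n \<Longrightarrow> snd s j (fst s j) = snd s' j (fst s' j)"
  shows "fst (cstep (ks, s)) = fst (cstep (ks, s'))"
  using assms by (cases "(ks, s)" rule: cstep.cases; cases s') auto

lemma tape_act_keep: "tape_act (c h, mv) (h, c) = (shift mv h, c)"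
  by (cases mv) auto

lemma tape_act_stay: "tape_act (y, Stay) (h, c) = (h, c(h := y))"
  by simp

lemma tapes_cstep:
  assumes "list_all (wfc n) ks"
  shows "map2 tape_act (actions n ks (map (\<lambda>(h, c). c h) (tapes n s))) (tapes n s)
           = tapes n (snd (cstep (ks, s)))"
  using assms
  by (cases "(ks, s)" rule: cstep.cases)
     (auto simp: tapes_def tape_act_keep zip_map1 zip_map2 zip_same_conv_map intro!: nth_equalityI simp del: tape_act.simps simp: tape_act_stay)

text \<open>Quantifying over the commands that remain to be done makes executions
  composable.\<close>

definition runs :: "com \<Rightarrow> conf \<Rightarrow> nat \<Rightarrow> conf \<Rightarrow> bool" where
  "runs c s t s' \<longleftrightarrow> (\<forall>k. (cstep ^^ t) (c # k, s) = (k, s'))"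

definition initial_conf :: "bool list \<Rightarrow> conf" where
  "initial_conf w = (\<lambda>_. 0, (\<lambda>_ _. 0)(0 := snd (input_tape w)))"

text \<open>States 0 and 1 of the machine are the accepting and the rejecting one; the other states
  number the continuations.\<close>

theorem com_PTIME:
  fixes p :: "nat poly"
  assumes wf: "wfc n c" and n: "0 < n" and i: "i < n"
    and run: "\<And>w. \<exists>t \<le> poly p (length w). runs c (initial_conf w) t (res w)"
  shows "{w. snd (res w) i (fst (res w) i) \<noteq> y} \<in> PTIME"
proof -
  define Q where "Q = insert [] (conts c [])"
  have finQ: "finite Q" by (simp add: Q_def finite_conts)
  obtain f where f: "bij_betw f Q {0..<card Q}"
    using ex_bij_betw_finite_nat[OF finQ] by blast
  define g where "g = inv_into Q f"
  have gf: "g (f ks) = ks" if "ks \<in> Q" for ks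
    using that f by (simp add: g_def bij_betw_inv_into_left)
  have fQ: "f ks < card Q" if "ks \<in> Q" for ks
    using bij_betwE[OF f] that by auto
  have gQ: "g j \<in> Q" if "j < card Q" for j
    using bij_betwE[OF bij_betw_inv_into[OF f]] that by (auto simp: g_def)
  have Qstep: "fst (cstep (ks, s)) \<in> Q" if "ks \<in> Q" for ks s
    using conts_step[of ks c "[]" s] that by (cases s) (auto simp: Q_def)
  have Qwf: "list_all (wfc n) ks" if "ks \<in> Q" for ks
    using conts_wfc[OF wf, of "[]" ks] that by (auto simp: Q_def)
  define num where "num ks = 2 + f ks" for ks
  define dl where "dl q xs =
     (if q < 2 then (0, map (\<lambda>j. (xs ! j, Stay)) [0..<n])
      else if g (q - 2) = [] then (if xs ! i = y then 1 else 0, map (\<lambda>j. (xs ! j, Stay)) [0..<n])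
      else (num (fst (cstep (g (q - 2), scan xs))), actions n (g (q - 2)) xs))"
    for q :: nat and xs :: "nat list"
  define M where "M = \<lparr>num_tapes = n, num_symbols = 3, num_states = 2 + card Q,
     start_state = num [c], accept_state = 0, reject_state = 1, tm_delta = dl\<rparr>"
  have act_ok: "length (actions n ks xs) = n \<and> (\<forall>(z, mv)\<in>set (actions n ks xs). z < 3)"
    if "length xs = n" "\<forall>x\<in>set xs. x < 3" "list_all (wfc n) ks" for ks xs
    using that by (cases "(n, ks, xs)" rule: actions.cases) auto
  have startQ: "[c] \<in> Q" by (simp add: Q_def conts_start)
  have cardQ: "card Q \<ge> 1" using fQ[OF startQ] by linarith
  have TM: "turing_machine M"
    unfolding turing_machine_def
  proof (intro conjI allI impI)
    fix q xs
    assume a: "q < num_states M \<and> length xs = num_tapes M \<and> (\<forall>x\<in>set xs. x < num_symbols M)"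
    have xs: "length xs = n" "\<forall>x\<in>set xs. x < 3" using a by (auto simp: M_def)
    have stay: "length (map (\<lambda>j. (xs ! j, Stay)) [0..<n]) = n"
      "\<forall>(z, mv)\<in>set (map (\<lambda>j. (xs ! j, Stay)) [0..<n]). z < 3"
      using xs by auto
    have g: "g (q - 2) \<in> Q" if "\<not> q < 2" using a that by (intro gQ) (auto simp: M_def)
    show "fst (tm_delta M q xs) < num_states M"
      using g fQ[OF Qstep, of "g (q - 2)"] cardQ by (auto simp: M_def dl_def num_def)
    show "length (snd (tm_delta M q xs)) = num_tapes M"
      using act_ok[OF xs Qwf[OF g]] by (auto simp: M_def dl_def)
    show "\<forall>(z, mv)\<in>set (snd (tm_delta M q xs)). z < num_symbols M"
    proof (cases "q < 2 \<or> g (q - 2) = []")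
      case True
      then show ?thesis using stay(2) by (auto simp: M_def dl_def)
    next
      case False
      then show ?thesis using act_ok[OF xs Qwf[OF g]] by (auto simp: M_def dl_def)
    qed
  qed (use n fQ[OF startQ] in \<open>auto simp: M_def num_def\<close>)
  have read: "map (\<lambda>(h, c). c h) (tapes n s) ! j = snd s j (fst s j)" if "j < n" for s j
    using that by (simp add: tapes_def)
  have sim1: "tm_step M (num ks, tapes n s)
      = (num (fst (cstep (ks, s))), tapes n (snd (cstep (ks, s))))"
    if "ks \<in> Q" "ks \<noteq> []" for ks s
  proof -
    have "fst (cstep (ks, scan (map (\<lambda>(h, c). c h) (tapes n s)))) = fst (cstep (ks, s))"
      using Qwf[OF that(1)] by (rule fst_cstep_cong) (simp add: scan_def read)
    then show ?thesis
      using that tapes_cstep[OF Qwf[OF that(1)], of s]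
      by (simp add: tm_step_def M_def dl_def num_def gf)
  qed
  have halt: "tm_step M (num [], tapes n s)
      = (if snd s i (fst s i) = y then 1 else 0, tapes n s)" for s
  proof -
    have "map2 tape_act (map (\<lambda>j. (map (\<lambda>(h, c). c h) (tapes n s) ! j, Stay)) [0..<n]) (tapes n s)
        = tapes n s"
      by (auto simp: tapes_def intro!: nth_equalityI)
    then show ?thesis
      using read[OF i, of s] by (simp add: tm_step_def M_def dl_def num_def gf Q_def)
  qed
  \<comment> \<open>Only t' \<le> t, because \<open>cstep\<close> idles on the empty stack while the
    machine goes on to its verdict; the first time with an empty stack counts.\<close>
  have simul: "\<exists>t' \<le> t. (tm_step M ^^ t') (num ks, tapes n s) = (num [], tapes n s')"
    if "(cstep ^^ t) (ks, s) = ([], s')" "ks \<in> Q" for t ks s s'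
    using that
  proof (induction t arbitrary: ks s)
    case 0
    then show ?case by auto
  next
    case (Suc t)
    show ?case
    proof (cases "ks = []")
      case True
      have "(cstep ^^ m) ([], s) = ([], s)" for m by (induction m) auto
      then have "s = s'" using True Suc.prems(1) by (metis prod.inject)
      then show ?thesis using True by (intro exI[of _ 0]) auto
    next
      case False
      obtain ks1 s1 where st: "cstep (ks, s) = (ks1, s1)" by (cases "cstep (ks, s)")
      have "ks1 \<in> Q" using Qstep[OF Suc.prems(2), of s] st by simp
      then obtain t' where "t' \<le> t" "(tm_step M ^^ t') (num ks1, tapes n s1) = (num [], tapes n s')"
        using Suc.IH[of ks1 s1] Suc.prems(1) st by (auto simp: funpow_Suc_right simp del: funpow.simps)
      then have "(tm_step M ^^ Suc t') (num ks, tapes n s) = (num [], tapes n s')"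
        using sim1[OF Suc.prems(2) False, of s] st by (simp add: funpow_Suc_right del: funpow.simps)
      then show ?thesis using \<open>t' \<le> t\<close> by (intro exI[of _ "Suc t'"]) auto
    qed
  qed
  have init: "tm_init M w = (num [c], tapes n (initial_conf w))" for w
  proof -
    have "input_tape w # replicate (n - 1) (0, \<lambda>_. 0) = tapes n (initial_conf w)"
    proof (rule nth_equalityI)
      show "length (input_tape w # replicate (n - 1) (0, \<lambda>_. 0)) = length (tapes n (initial_conf w))"
        using n by (simp add: tapes_def)
      fix j assume "j < length (input_tape w # replicate (n - 1) (0, \<lambda>_. 0))"
      then show "(input_tape w # replicate (n - 1) (0, \<lambda>_. 0)) ! j = tapes n (initial_conf w) ! j"
        using n by (cases j) (auto simp: tapes_def initial_conf_def input_tape_def)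
    qed
    then show ?thesis by (simp add: tm_init_def M_def)
  qed
  \<comment> \<open>The added 1 pays for the step from the empty stack to the verdict. Halted
    configurations then persist until the bound is reached.\<close>
  have "fst (tm_run M w (poly (p + 1) (length w))) =
      (if snd (res w) i (fst (res w) i) \<noteq> y then accept_state M else reject_state M)" for w
  proof -
    obtain t where t: "t \<le> poly p (length w)" "runs c (initial_conf w) t (res w)"
      using run by blast
    then have "(cstep ^^ t) ([c], initial_conf w) = ([], res w)" by (auto simp: runs_def)
    from simul[OF this startQ] obtain t' where t': "t' \<le> t"
      "(tm_step M ^^ t') (num [c], tapes n (initial_conf w)) = (num [], tapes n (res w))" by blast
    have halted: "(tm_step M ^^ m) (q, x) = (q, x)" if "q < 2" for m q x
      using that by (induction m) (auto simp: tm_step_def M_def)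
    define a :: nat where "a = (if snd (res w) i (fst (res w) i) = y then 1 else 0)"
    have "(tm_step M ^^ Suc t') (tm_init M w) = (a, tapes n (res w))"
      using t'(2) halt[of "res w"] by (simp add: init a_def)
    then have "(tm_step M ^^ (m + Suc t')) (tm_init M w) = (a, tapes n (res w))" for m
      using halted[of a m] unfolding funpow_add o_apply by (simp add: a_def del: funpow.simps)
    from this[of "poly (p + 1) (length w) - Suc t'"] t'(1) t(1) show ?thesis
      by (simp add: tm_run_def a_def M_def)
  qed
  then show ?thesis
    using TM unfolding PTIME_def by (auto simp: M_def intro!: exI[of _ M] exI[of _ "p + 1"])
qed

section \<open>Execution times of commands\<close>

lemma runs_Mv: "runs (Mv i d) (H, C) 1 (H(i := shift d (H i)), C)"
  by (simp add: runs_def)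

lemma runs_Wr: "runs (Wr i y) (H, C) 1 (H, C(i := (C i)(H i := y)))"
  by (simp add: runs_def)

lemma runs_Sq:
  assumes "runs a s t s'" "runs b s' t' s''"
  shows "runs (Sq a b) s (t' + t + 1) s''"
  using assms unfolding runs_def by (simp add: funpow_Suc_right funpow_add del: funpow.simps(2))

lemma runs_If:
  assumes "runs (if C i (H i) = y then a else b) (H, C) t s'"
  shows "runs (Br i y a b) (H, C) (t + 1) s'"
  using assms unfolding runs_def by (simp add: funpow_Suc_right funpow_add del: funpow.simps(2))

lemma runs_Wh_exit: "C i (H i) = y \<Longrightarrow> runs (Wh i y a) (H, C) 1 (H, C)"
  by (simp add: runs_def)

lemma runs_Wh_step:
  assumes "C i (H i) \<noteq> y" "runs a (H, C) t s'" "runs (Wh i y a) s' t' s''"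
  shows "runs (Wh i y a) (H, C) (t' + t + 1) s''"
  using assms unfolding runs_def by (simp add: funpow_Suc_right funpow_add del: funpow.simps(2))

text \<open>Upper bounds in place of exact times let a loop have one bound for all its
  rounds.\<close>

definition attains :: "com \<Rightarrow> conf \<Rightarrow> nat \<Rightarrow> conf \<Rightarrow> bool" where
  "attains c s B s' \<longleftrightarrow> (\<exists>t\<le>B. runs c s t s')"

lemma attains_mono: "attains c s B s' \<Longrightarrow> B \<le> B' \<Longrightarrow> attains c s B' s'"
  unfolding attains_def using le_trans by blast

lemma attains_Mv: "attains (Mv i d) (H, C) 1 (H(i := shift d (H i)), C)"
  unfolding attains_def using runs_Mv by blast

lemma attains_Wr: "attains (Wr i y) (H, C) 1 (H, C(i := (C i)(H i := y)))"
  unfolding attains_def using runs_Wr by blast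

lemma attains_Sq:
  assumes "attains a s B s'" "attains b s' B' s''"
  shows "attains (Sq a b) s (B + B' + 1) s''"
proof -
  obtain t t' where "t \<le> B" "t' \<le> B'" "runs a s t s'" "runs b s' t' s''"
    using assms unfolding attains_def by blast
  then show ?thesis
    unfolding attains_def by (intro exI[of _ "t' + t + 1"]) (simp add: runs_Sq del: One_nat_def)
qed

lemma attains_If:
  assumes "attains (if C i (H i) = y then a else b) (H, C) B s'"
  shows "attains (Br i y a b) (H, C) (B + 1) s'"
  using assms runs_If unfolding attains_def by (metis add_le_mono1)

lemma attains_Wh:
  assumes "\<And>k. k < n \<Longrightarrow> snd (s k) i (fst (s k) i) \<noteq> y"
    and "\<And>k. k < n \<Longrightarrow> attains a (s k) B (s (Suc k))"
    and "snd (s n) i (fst (s n) i) = y"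
  shows "attains (Wh i y a) (s 0) (n * (B + 1) + 1) (s n)"
  using assms
proof (induction n arbitrary: s)
  case 0
  then show ?case
    using runs_Wh_exit[of "snd (s 0)" i "fst (s 0)" y a] by (auto simp: attains_def)
next
  case (Suc n)
  have "attains (Wh i y a) (s (Suc 0)) (n * (B + 1) + 1) (s (Suc n))"
    using Suc.prems by (intro Suc.IH[of "\<lambda>k. s (Suc k)"]) auto
  then obtain t' where t': "t' \<le> n * (B + 1) + 1" "runs (Wh i y a) (s 1) t' (s (Suc n))"
    by (auto simp: attains_def)
  obtain t where t: "t \<le> B" "runs a (s 0) t (s 1)"
    using Suc.prems(2)[of 0] by (auto simp: attains_def)
  have "runs (Wh i y a) (s 0) (t' + t + 1) (s (Suc n))"
    using runs_Wh_step[of "snd (s 0)" i "fst (s 0)" y a t "s 1" t' "s (Suc n)"] Suc.prems(1)[of 0] t t'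
    by simp
  then show ?case
    unfolding attains_def using t(1) t'(1) by (intro exI[of _ "t' + t + 1"]) auto
qed

section \<open>Counters held by head positions on marked tapes\<close>

definition marks :: "nat \<Rightarrow> int \<Rightarrow> nat" where
  "marks N z = (if z = 0 then 1 else if z = int N then 2 else 0)"

lemma marks_1: "marks N z = 1 \<longleftrightarrow> z = 0" "marks N z = Suc 0 \<longleftrightarrow> z = 0"
  by (auto simp: marks_def)

lemma marks_2: "0 < N \<Longrightarrow> marks N z = 2 \<longleftrightarrow> z = int N"
  by (auto simp: marks_def)

text \<open>On a tape with contents \<open>marks N\<close> the symbol 2 ends the loop at cell N, so
  the body sees the values 0 to N - 1 of head L; the symbol 1 at cell 0 ends the rewinding.\<close>

definition For :: "nat \<Rightarrow> com \<Rightarrow> com" where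
  "For L c = Sq (Wh L 2 (Sq c (Mv L MoveRight))) (Wh L 1 (Mv L MoveLeft))"

lemma attains_For:
  assumes N: "0 < N" and Cm: "\<And>v. v \<le> N \<Longrightarrow> C v L = marks N" and H0: "\<And>v. v \<le> N \<Longrightarrow> H v L = 0"
    and body: "\<And>v. v < N \<Longrightarrow>
      attains c ((H v)(L := int v), C v) B ((H (Suc v))(L := int v), C (Suc v))"
  shows "attains (For L c) (H 0, C 0) (N * (B + 3) + N * 2 + 3) (H N, C N)"
proof -
  have 1: "attains (Wh L 2 (Sq c (Mv L MoveRight))) (H 0, C 0) (N * (B + 3) + 1) ((H N)(L := int N), C N)"
  proof -
    define s where "s v = ((H v)(L := int v), C v)" for v
    have "attains (Wh L 2 (Sq c (Mv L MoveRight))) (s 0) (N * (B + 2 + 1) + 1) (s N)"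
    proof (rule attains_Wh)
      fix k assume k: "k < N"
      show "snd (s k) L (fst (s k) L) \<noteq> 2" using k Cm[of k] by (simp add: s_def marks_2)
      show "attains (Sq c (Mv L MoveRight)) (s k) (B + 2) (s (Suc k))"
        using attains_Sq[OF body[OF k] attains_Mv[of L MoveRight]] by (simp add: s_def add.commute)
    qed (use Cm[of N] N in \<open>simp add: s_def marks_2\<close>)
    moreover have "s 0 = (H 0, C 0)" using H0[of 0] by (simp add: s_def fun_upd_idem)
    ultimately show ?thesis by (simp add: s_def add.assoc numeral_3_eq_3)
  qed
  have 2: "attains (Wh L 1 (Mv L MoveLeft)) ((H N)(L := int N), C N) (N * 2 + 1) (H N, C N)"
  proof -
    define s where "s v = ((H N)(L := int N - int v), C N)" for v
    have "attains (Wh L 1 (Mv L MoveLeft)) (s 0) (N * (1 + 1) + 1) (s N)"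
    proof (rule attains_Wh)
      fix k assume k: "k < N"
      show "snd (s k) L (fst (s k) L) \<noteq> 1" using k Cm[of N] by (simp add: s_def marks_1)
      show "attains (Mv L MoveLeft) (s k) 1 (s (Suc k))"
        using attains_Mv[of L MoveLeft "(H N)(L := int N - int k)" "C N"] by (simp add: s_def algebra_simps)
    qed (use Cm[of N] in \<open>simp add: s_def marks_1\<close>)
    moreover have "s N = (H N, C N)" using H0[of N] by (simp add: s_def fun_upd_idem)
    ultimately show ?thesis by (simp add: s_def mult_2_right)
  qed
  show ?thesis
    unfolding For_def using attains_mono[OF attains_Sq[OF 1 2]] by simp
qed

text \<open>Counting down destroys the value of counter i, so it is moved to L meanwhile and back
  afterwards. Both heads are displaced during the body, which is why \<open>moves_Rep\<close> wants
  the offset of the body to be independent of the counters.\<close>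

definition Rep :: "nat \<Rightarrow> nat \<Rightarrow> com \<Rightarrow> com" where
  "Rep i L c = Sq (Wh i 1 (Sq (Sq (Mv i MoveLeft) (Mv L MoveRight)) c))
     (Wh L 1 (Sq (Mv L MoveLeft) (Mv i MoveRight)))"

lemma attains_Rep:
  assumes iL: "i \<noteq> L" and C: "C i = marks N" "C L = marks N"
    and H0: "\<And>v. v \<le> a \<Longrightarrow> H v L = 0" "\<And>v. v \<le> a \<Longrightarrow> H v i = int a"
    and body: "\<And>v. v < a \<Longrightarrow>
      attains c ((H v)(i := int a - int (Suc v), L := int (Suc v)), C) B
        ((H (Suc v))(i := int a - int (Suc v), L := int (Suc v)), C)"
  shows "attains (Rep i L c) (H 0, C) (a * (B + 5) + a * 4 + 3) (H a, C)"
proof -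
  have 1: "attains (Wh i 1 (Sq (Sq (Mv i MoveLeft) (Mv L MoveRight)) c)) (H 0, C) (a * (B + 5) + 1)
    ((H a)(i := 0, L := int a), C)"
  proof -
    define s where "s v = ((H v)(i := int a - int v, L := int v), C)" for v
    have "attains (Wh i 1 (Sq (Sq (Mv i MoveLeft) (Mv L MoveRight)) c)) (s 0) (a * ((B + 4) + 1) + 1) (s a)"
    proof (rule attains_Wh)
      fix k assume k: "k < a"
      show "snd (s k) i (fst (s k) i) \<noteq> 1" using k C iL by (simp add: s_def marks_1)
      have e: "(H k)(i := int a - int k, L := int k, i := int a - int k - 1, L := int k + 1)
         = (H k)(i := int a - int (Suc k), L := int (Suc k))" using iL by (auto simp: fun_eq_iff)
      have "attains (Sq (Mv i MoveLeft) (Mv L MoveRight)) (s k) 3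
          ((H k)(i := int a - int (Suc k), L := int (Suc k)), C)"
        using attains_Sq[OF attains_Mv[of i MoveLeft] attains_Mv[of L MoveRight],
            of "(H k)(i := int a - int k, L := int k)" C] iL e by (simp add: s_def numeral_3_eq_3)
      from attains_Sq[OF this body[OF k]]
      show "attains (Sq (Sq (Mv i MoveLeft) (Mv L MoveRight)) c) (s k) (B + 4) (s (Suc k))"
        by (simp add: s_def add.commute)
    qed (use C iL in \<open>simp add: s_def marks_1\<close>)
    moreover have "s 0 = (H 0, C)" using H0[of 0] by (auto simp: s_def fun_eq_iff)
    ultimately show ?thesis by (simp add: s_def add.commute)
  qed
  have 2: "attains (Wh L 1 (Sq (Mv L MoveLeft) (Mv i MoveRight))) ((H a)(i := 0, L := int a), C)
    (a * 4 + 1) (H a, C)"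
  proof -
    define s where "s v = ((H a)(i := int v, L := int a - int v), C)" for v
    have "attains (Wh L 1 (Sq (Mv L MoveLeft) (Mv i MoveRight))) (s 0) (a * (3 + 1) + 1) (s a)"
    proof (rule attains_Wh)
      fix k assume k: "k < a"
      show "snd (s k) L (fst (s k) L) \<noteq> 1" using k C by (simp add: s_def marks_1)
      have e: "(H a)(i := int k, L := int a - int k, L := int a - int k - 1, i := int k + 1)
         = (H a)(i := int (Suc k), L := int a - int (Suc k))" using iL by (auto simp: fun_eq_iff)
      show "attains (Sq (Mv L MoveLeft) (Mv i MoveRight)) (s k) 3 (s (Suc k))"
        using attains_Sq[OF attains_Mv[of L MoveLeft] attains_Mv[of i MoveRight],
            of "(H a)(i := int k, L := int a - int k)" C] iL e by (simp add: s_def numeral_3_eq_3)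
    qed (use C in \<open>simp add: s_def marks_1\<close>)
    moreover have "s a = (H a, C)" using H0[of a] by (auto simp: s_def fun_eq_iff)
    ultimately show ?thesis by (simp add: s_def)
  qed
  show ?thesis
    unfolding Rep_def using attains_mono[OF attains_Sq[OF 1 2]] by simp
qed

text \<open>Tape 0 holds the input and tape 1 a bit array. The heads on the tapes from 3 on are
  counters with values up to \<open>N\<close>; those from \<open>L\<close> on are free for use.\<close>

definition good :: "nat \<Rightarrow> bool list \<Rightarrow> nat \<Rightarrow> nat \<Rightarrow> (nat \<Rightarrow> int) \<Rightarrow> (nat \<Rightarrow> int \<Rightarrow> nat) \<Rightarrow> bool" where
  "good K w N L H C \<longleftrightarrow> 0 < N \<and> 3 \<le> L \<and> C 0 = snd (input_tape w) \<and> (\<forall>j. 2 \<le> j \<and> j < K \<longrightarrow> C j = marks N) \<and>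
     (\<forall>j\<ge>3. 0 \<le> H j \<and> H j \<le> int N) \<and> (\<forall>j\<ge>L. H j = 0)"

lemma good_head: "good K w N L H C \<Longrightarrow> T < 3 \<Longrightarrow> good K w N L (H(T := z)) C"
  by (auto simp: good_def)

lemma good_array: "good K w N L H C \<Longrightarrow> good K w N L H (C(1 := S))"
  by (auto simp: good_def)

lemma good_counter: "good K w N L H C \<Longrightarrow> v \<le> N \<Longrightarrow> good K w N (Suc L) (H(L := int v)) C"
  by (auto simp: good_def)

lemma good_decr:
  "good K w N L H C \<Longrightarrow> 0 \<le> v \<Longrightarrow> v \<le> int N \<Longrightarrow> 3 \<le> i \<Longrightarrow> i < L \<Longrightarrow> good K w N L (H(i := v)) C"
  by (auto simp: good_def)

text \<open>The only effect is a displacement of one of the working heads 0, 1, 2, in time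
  polynomial in N uniformly in the configuration. As the offset does not depend on that head itself,
  a command with the opposite offset undoes the move.\<close>

definition moves :: "nat \<Rightarrow> nat \<Rightarrow> com \<Rightarrow> nat \<Rightarrow> (nat \<Rightarrow> (nat \<Rightarrow> int) \<Rightarrow> int) \<Rightarrow> bool" where
  "moves K L c T \<delta> \<longleftrightarrow> T < 3 \<and> (\<forall>N H z. \<delta> N (H(T := z)) = \<delta> N H) \<and>
     (\<exists>p::nat poly. \<forall>w N H C. good K w N L H C \<longrightarrow>
       attains c (H, C) (poly p N) (H(T := H T + \<delta> N H), C))"

lemma movesI:
  assumes "T < 3" "\<And>N H z. \<delta> N (H(T := z)) = \<delta> N H"
    "\<And>w N H C. good K w N L H C \<Longrightarrow> attains c (H, C) (poly p N) (H(T := H T + \<delta> N H), C)"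
  shows "moves K L c T \<delta>"
  using assms unfolding moves_def by blast

lemma movesE:
  assumes "moves K L c T \<delta>"
  obtains p :: "nat poly" where "T < 3" "\<And>N H z. \<delta> N (H(T := z)) = \<delta> N H"
    "\<And>w N H C. good K w N L H C \<Longrightarrow> attains c (H, C) (poly p N) (H(T := H T + \<delta> N H), C)"
  using assms unfolding moves_def by blast

lemma moves_Sq:
  assumes "moves K L c T \<delta>" "moves K L c' T \<delta>'"
  shows "moves K L (Sq c c') T (\<lambda>N H. \<delta> N H + \<delta>' N H)"
proof -
  obtain p where p: "T < 3" "\<And>N H z. \<delta> N (H(T := z)) = \<delta> N H"
    "\<And>w N H C. good K w N L H C \<Longrightarrow> attains c (H, C) (poly p N) (H(T := H T + \<delta> N H), C)"
    using movesE[OF assms(1)] by metis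
  obtain p' where p': "\<And>N H z. \<delta>' N (H(T := z)) = \<delta>' N H"
    "\<And>w N H C. good K w N L H C \<Longrightarrow> attains c' (H, C) (poly p' N) (H(T := H T + \<delta>' N H), C)"
    using movesE[OF assms(2)] by metis
  show ?thesis
  proof (rule movesI[where p = "p + p' + 1"])
    fix w N H C assume g: "good K w N L H C"
    from attains_Sq[OF p(3)[OF g] p'(2)[OF good_head[OF g p(1)]]]
    show "attains (Sq c c') (H, C) (poly (p + p' + 1) N) (H(T := H T + (\<delta> N H + \<delta>' N H)), C)"
      by (simp add: p'(1) add.assoc)
  qed (use p p' in auto)
qed

fun sg :: "head_move \<Rightarrow> int" where
  "sg MoveLeft = - 1" | "sg Stay = 0" | "sg MoveRight = 1"

lemma shift_sg: "shift d h = h + sg d"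
  by (cases d) auto

lemma moves_Mv: "T < 3 \<Longrightarrow> moves K L (Mv T d) T (\<lambda>N H. sg d)"
  using attains_Mv[of T d] by (intro movesI[where p = 1]) (auto simp: shift_sg)

lemma moves_For:
  assumes "moves K (Suc L) c T (\<lambda>N H. \<delta> N)" "L < K"
  shows "moves K L (For L c) T (\<lambda>N H. int N * \<delta> N)"
proof -
  obtain p where p: "T < 3"
    "\<And>w N H C. good K w N (Suc L) H C \<Longrightarrow> attains c (H, C) (poly p N) (H(T := H T + \<delta> N), C)"
    using movesE[OF assms(1)] by metis
  show ?thesis
  proof (rule movesI[where p = "[:0, 1:] * (p + 3) + [:0, 1:] * 2 + 3"])
    fix w N H C assume g: "good K w N L H C"
    define H' where "H' v = H(T := H T + int v * \<delta> N)" for v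
    have L: "T \<noteq> L" "3 \<le> L" using p(1) g by (auto simp: good_def)
    have "attains (For L c) (H' 0, C) (N * (poly p N + 3) + N * 2 + 3) (H' N, C)"
    proof (rule attains_For)
      fix v assume v: "v < N"
      have "good K w N (Suc L) ((H' v)(L := int v)) C"
        using good_counter[OF good_head[OF g p(1)], of v] v by (simp add: H'_def)
      from p(2)[OF this]
      show "attains c ((H' v)(L := int v), C) (poly p N) ((H' (Suc v))(L := int v), C)"
        using L by (simp add: H'_def fun_upd_twist algebra_simps)
    qed (use g L assms(2) in \<open>auto simp: good_def H'_def\<close>)
    then show "attains (For L c) (H, C) (poly ([:0, 1:] * (p + 3) + [:0, 1:] * 2 + 3) N)
      (H(T := H T + int N * \<delta> N), C)"
      by (simp add: H'_def algebra_simps)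
  qed (use p in auto)
qed

lemma moves_Rep:
  assumes "moves K (Suc L) c T (\<lambda>N H. \<delta> N)" "L < K" "3 \<le> i" "i < L"
  shows "moves K L (Rep i L c) T (\<lambda>N H. H i * \<delta> N)"
proof -
  obtain p where p: "T < 3"
    "\<And>w N H C. good K w N (Suc L) H C \<Longrightarrow> attains c (H, C) (poly p N) (H(T := H T + \<delta> N), C)"
    using movesE[OF assms(1)] by metis
  show ?thesis
  proof (rule movesI[where p = "[:0, 1:] * (p + 5) + [:0, 1:] * 4 + 3"])
    fix w N H C assume g: "good K w N L H C"
    define H' where "H' v = H(T := H T + int v * \<delta> N)" for v
    have L: "T \<noteq> L" "T \<noteq> i" "3 \<le> L" using p(1) g assms by (auto simp: good_def)
    define a where "a = nat (H i)"
    have a: "H i = int a" "a \<le> N" using g assms(3) by (auto simp: good_def a_def)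
    have "attains (Rep i L c) (H' 0, C) (a * (poly p N + 5) + a * 4 + 3) (H' a, C)"
    proof (rule attains_Rep[where N = N])
      fix v assume v: "v < a"
      have "good K w N (Suc L) ((H' v)(L := int (Suc v), i := int a - int (Suc v))) C"
        using good_decr[OF good_counter[OF good_head[OF g p(1)], of "Suc v"], of "int a - int (Suc v)" i] v a assms
        by (simp add: H'_def)
      from p(2)[OF this]
      show "attains c ((H' v)(i := int a - int (Suc v), L := int (Suc v)), C) (poly p N)
        ((H' (Suc v))(i := int a - int (Suc v), L := int (Suc v)), C)"
        using L assms by (simp add: H'_def fun_upd_twist algebra_simps)
    qed (use g L a assms in \<open>auto simp: good_def H'_def\<close>)
    moreover have "a * (poly p N + 5) + a * 4 + 3 \<le> N * (poly p N + 5) + N * 4 + 3"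
      using a(2) by (intro add_mono mult_mono) auto
    ultimately show "attains (Rep i L c) (H, C) (poly ([:0, 1:] * (p + 5) + [:0, 1:] * 4 + 3) N)
      (H(T := H T + H i * \<delta> N), C)"
      using attains_mono by (fastforce simp: H'_def a algebra_simps)
  qed (use p assms in auto)
qed

text \<open>Nested loops realise the place value N ^ n of a digit in base N.\<close>

primrec powmv :: "nat \<Rightarrow> nat \<Rightarrow> nat \<Rightarrow> head_move \<Rightarrow> com" where
  "powmv L 0 T d = Mv T d"
| "powmv L (Suc n) T d = For L (powmv (Suc L) n T d)"

lemma moves_powmv:
  "T < 3 \<Longrightarrow> L + n \<le> K \<Longrightarrow> moves K L (powmv L n T d) T (\<lambda>N H. int N ^ n * sg d)"
proof (induction n arbitrary: L)
  case 0
  then show ?case using moves_Mv by simp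
next
  case (Suc n)
  then show ?case using moves_For[OF Suc.IH[of "Suc L"]] by (simp add: mult.assoc)
qed

definition skip :: com where "skip = Mv 0 Stay"

lemma moves_skip: "T < 3 \<Longrightarrow> moves K L skip T (\<lambda>N H. 0)"
  unfolding skip_def using attains_Mv[of 0 Stay] by (intro movesI[where p = 1]) (auto simp: fun_upd_idem)

primrec iter :: "nat \<Rightarrow> com \<Rightarrow> com" where
  "iter 0 c = skip"
| "iter (Suc n) c = Sq c (iter n c)"

lemma moves_iter: "T < 3 \<Longrightarrow> moves K L c T \<delta> \<Longrightarrow> moves K L (iter n c) T (\<lambda>N H. int n * \<delta> N H)"
proof (induction n)
  case 0
  then show ?case using moves_skip by simp
next
  case (Suc n)
  from moves_Sq[OF Suc.prems(2) Suc.IH[OF Suc.prems]] show ?case by (simp add: algebra_simps)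
qed

subsection \<open>Datalog over words\<close>

datatype dterm = TV nat | TC nat

text \<open>A fact is a plain list of numbers whose first entry is the name of its relation. The
  input is accessible through \<open>Bit\<close> alone, and \<open>Sc\<close> is the only arithmetic
  on positions.\<close>

datatype datom =
    Rel "dterm list"
  | Bit bool dterm
  | Sc dterm dterm

type_synonym rule = "dterm list \<times> datom list"

primrec tval :: "(nat \<Rightarrow> nat) \<Rightarrow> dterm \<Rightarrow> nat" where
  "tval e (TV j) = e j"
| "tval e (TC k) = k"

primrec holds :: "bool list \<Rightarrow> (nat list \<Rightarrow> bool) \<Rightarrow> (nat \<Rightarrow> nat) \<Rightarrow> datom \<Rightarrow> bool" where
  "holds w S e (Rel ts) \<longleftrightarrow> S (map (tval e) ts)"
| "holds w S e (Bit b x) \<longleftrightarrow> tval e x < length w \<and> w ! tval e x = b"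
| "holds w S e (Sc x y) \<longleftrightarrow> tval e y = Suc (tval e x)"

lemma holds_mono [mono]: "(\<And>f. S f \<longrightarrow> S' f) \<Longrightarrow> holds w S e a \<longrightarrow> holds w S' e a"
  by (cases a) auto

text \<open>Valuations stay below N, which makes the universe finite. Constants are not bounded
  here; this is taken care of later by assuming \<open>c \<le> N\<close>.\<close>

inductive derives :: "rule list \<Rightarrow> bool list \<Rightarrow> nat \<Rightarrow> nat list \<Rightarrow> bool" for P w N where
  derives: "(h, bd) \<in> set P \<Longrightarrow> (\<And>j. e j < N) \<Longrightarrow> (\<And>a. a \<in> set bd \<Longrightarrow> holds w (derives P w N) e a)
    \<Longrightarrow> derives P w N (map (tval e) h)"

text \<open>Facts are addressed by their value as a numeral in base \<open>N\<close>; a nonzero leading digit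
  makes this injective.\<close>

primrec num :: "nat \<Rightarrow> nat list \<Rightarrow> nat" where
  "num N [] = 0"
| "num N (x # xs) = x * N ^ length xs + num N xs"

definition proper :: "nat list \<Rightarrow> bool" where
  "proper xs \<longleftrightarrow> xs = [] \<or> hd xs \<noteq> 0"

lemma num_snoc: "num N (xs @ [x]) = num N xs * N + x"
  by (induction xs) (auto simp: algebra_simps)

lemma num_less: "\<forall>x\<in>set xs. x < N \<Longrightarrow> num N xs < N ^ length xs"
proof (induction xs rule: rev_induct)
  case (snoc x xs)
  then have "num N xs + 1 \<le> N ^ length xs" "x < N" by auto
  then have "(num N xs + 1) * N \<le> N ^ length xs * N" by (intro mult_right_mono) auto
  then show ?case using \<open>x < N\<close> by (simp add: num_snoc algebra_simps)
qed simp

lemma num_pos: "proper xs \<Longrightarrow> xs \<noteq> [] \<Longrightarrow> 0 < N \<Longrightarrow> 0 < num N xs"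
  by (cases xs) (auto simp: proper_def)

lemma num_inj:
  assumes "0 < N" "proper xs" "proper ys" "\<forall>x\<in>set xs. x < N" "\<forall>y\<in>set ys. y < N" "num N xs = num N ys"
  shows "xs = ys"
  using assms
proof (induction xs arbitrary: ys rule: rev_induct)
  case Nil
  then show ?case using num_pos[of ys N] by auto
next
  case (snoc x xs)
  have "ys \<noteq> []" using num_pos[of "xs @ [x]" N] snoc.prems by auto
  then obtain zs z where ys: "ys = zs @ [z]" by (metis rev_exhaust)
  have eq: "num N xs * N + x = num N zs * N + z" and lt: "x < N" "z < N"
    using snoc.prems ys by (auto simp: num_snoc)
  have "x = z" using arg_cong[OF eq, of "\<lambda>n. n mod N"] lt by simp
  moreover have "num N xs = num N zs" using arg_cong[OF eq, of "\<lambda>n. n div N"] lt by simp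
  moreover have "proper xs" "proper zs"
    using snoc.prems(2,3) ys by (auto simp: proper_def hd_append split: if_splits)
  ultimately show ?case using snoc.IH[of zs] snoc.prems ys by auto
qed

text \<open>Here n is the number of entries to the right of the term in the fact. A variable is
  multiplied by the place value at run time, a constant by repeating the command in the
  program.\<close>

primrec termmv :: "nat \<Rightarrow> nat \<Rightarrow> nat \<Rightarrow> head_move \<Rightarrow> nat \<Rightarrow> dterm \<Rightarrow> com" where
  "termmv b L T d n (TV j) = Rep (b + j) L (powmv (Suc L) n T d)"
| "termmv b L T d n (TC k) = iter k (powmv L n T d)"

primrec addrmv :: "nat \<Rightarrow> nat \<Rightarrow> nat \<Rightarrow> head_move \<Rightarrow> dterm list \<Rightarrow> com" where
  "addrmv b L T d [] = skip"
| "addrmv b L T d (t # ts) = Sq (termmv b L T d (length ts) t) (addrmv b L T d ts)"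

definition env :: "nat \<Rightarrow> (nat \<Rightarrow> int) \<Rightarrow> nat \<Rightarrow> nat" where
  "env b H j = nat (H (b + j))"

primrec wft :: "nat \<Rightarrow> nat \<Rightarrow> dterm \<Rightarrow> bool" where
  "wft m c (TV j) \<longleftrightarrow> j < m"
| "wft m c (TC k) \<longleftrightarrow> k < c"

text \<open>Heads are integers and the values of terms are natural numbers; the two views agree
  where the counters are nonnegative, as \<open>good\<close> guarantees.\<close>

lemma moves_cong:
  assumes "moves K L c T \<delta>" "3 \<le> b" "\<And>N H z. \<delta>' N (H(T := z)) = \<delta>' N H"
    and "\<And>N H. (\<And>j. 3 \<le> j \<Longrightarrow> 0 \<le> H j) \<Longrightarrow> \<delta> N H = \<delta>' N H"
  shows "moves K L c T \<delta>'"
proof -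
  obtain p where p: "T < 3"
    "\<And>w N H C. good K w N L H C \<Longrightarrow> attains c (H, C) (poly p N) (H(T := H T + \<delta> N H), C)"
    using movesE[OF assms(1)] by metis
  show ?thesis
  proof (rule movesI[where p = p])
    fix w N H C assume g: "good K w N L H C"
    then have "\<delta> N H = \<delta>' N H" by (intro assms(4)) (auto simp: good_def)
    then show "attains c (H, C) (poly p N) (H(T := H T + \<delta>' N H), C)" using p(2)[OF g] by simp
  qed (use p assms in auto)
qed

lemma moves_termmv:
  assumes "T < 3" "3 \<le> b" "b + m \<le> L" "L + n < K" "wft m c t"
  shows "moves K L (termmv b L T d n t) T (\<lambda>N H. sg d * int (tval (env b H) t * N ^ n))"
proof (cases t)
  case (TV j)
  have "moves K L (Rep (b + j) L (powmv (Suc L) n T d)) T (\<lambda>N H. H (b + j) * (int N ^ n * sg d))"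
    using assms TV by (intro moves_Rep moves_powmv) auto
  then show ?thesis
    unfolding TV termmv.simps
    by (rule moves_cong[OF _ assms(2)]) (use assms in \<open>auto simp: env_def\<close>)
next
  case (TC k)
  have "moves K L (iter k (powmv L n T d)) T (\<lambda>N H. int k * (int N ^ n * sg d))"
    using assms by (intro moves_iter moves_powmv) auto
  then show ?thesis unfolding TC by (simp add: mult_ac)
qed

lemma moves_addrmv:
  assumes "T < 3" "3 \<le> b" "b + m \<le> L" "L + length ts \<le> K" "list_all (wft m c) ts"
  shows "moves K L (addrmv b L T d ts) T (\<lambda>N H. sg d * int (num N (map (tval (env b H)) ts)))"
  using assms
proof (induction ts)
  case Nil
  then show ?case using moves_skip by simp
next
  case (Cons t ts)
  then show ?case
    using moves_Sq[OF moves_termmv[of T b m L "length ts" K c t d] Cons.IH]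
    by (simp add: algebra_simps)
qed

section \<open>Commands that update the bit array\<close>

definition ind :: "int set \<Rightarrow> int \<Rightarrow> nat" where
  "ind X z = (if z \<in> X then 1 else 0)"

text \<open>Starting with the working heads at cell 0, the command changes the set of marked cells
  of tape 1 and returns all heads, so it can be put under loops and tests.\<close>

definition updates ::
  "nat \<Rightarrow> nat \<Rightarrow> com \<Rightarrow> (bool list \<Rightarrow> nat \<Rightarrow> (nat \<Rightarrow> int) \<Rightarrow> int set \<Rightarrow> int set) \<Rightarrow> bool" where
  "updates K L c g \<longleftrightarrow> (\<exists>p::nat poly. \<forall>w N H C X. good K w N L H C \<and> C 1 = ind X \<and>
     (\<forall>j<3. H j = 0) \<longrightarrow> attains c (H, C) (poly p N) (H, C(1 := ind (g w N H X))))"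

lemma updatesI:
  assumes "\<And>w N H C X. good K w N L H C \<Longrightarrow> C 1 = ind X \<Longrightarrow> (\<And>j. j < 3 \<Longrightarrow> H j = 0) \<Longrightarrow>
     attains c (H, C) (poly p N) (H, C(1 := ind (g w N H X)))"
  shows "updates K L c g"
  using assms unfolding updates_def by blast

lemma updatesE:
  assumes "updates K L c g"
  obtains p :: "nat poly" where "\<And>w N H C X. good K w N L H C \<Longrightarrow> C 1 = ind X \<Longrightarrow> (\<And>j. j < 3 \<Longrightarrow> H j = 0) \<Longrightarrow>
     attains c (H, C) (poly p N) (H, C(1 := ind (g w N H X)))"
  using assms unfolding updates_def by blast

lemma updates_skip: "updates K L skip (\<lambda>w N H X. X)"
  unfolding skip_def using attains_Mv[of 0 Stay]
  by (intro updatesI[where p = 1]) (auto simp: fun_upd_idem)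

lemma updates_Sq:
  assumes "updates K L c g" "updates K L c' g'"
  shows "updates K L (Sq c c') (\<lambda>w N H X. g' w N H (g w N H X))"
proof -
  obtain p where p: "\<And>w N H C X. good K w N L H C \<Longrightarrow> C 1 = ind X \<Longrightarrow> (\<And>j. j < 3 \<Longrightarrow> H j = 0) \<Longrightarrow>
     attains c (H, C) (poly p N) (H, C(1 := ind (g w N H X)))"
    using updatesE[OF assms(1)] by metis
  obtain p' where p': "\<And>w N H C X. good K w N L H C \<Longrightarrow> C 1 = ind X \<Longrightarrow> (\<And>j. j < 3 \<Longrightarrow> H j = 0) \<Longrightarrow>
     attains c' (H, C) (poly p' N) (H, C(1 := ind (g' w N H X)))"
    using updatesE[OF assms(2)] by metis
  show ?thesis
  proof (rule updatesI[where p = "p + p' + 1"])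
    fix w N H C X assume h: "good K w N L H C" "C 1 = ind X" "\<And>j. j < 3 \<Longrightarrow> H j = 0"
    from attains_Sq[OF p[OF h] p'[OF good_array[OF h(1)] _ h(3)]]
    show "attains (Sq c c') (H, C) (poly (p + p' + 1) N) (H, C(1 := ind (g' w N H (g w N H X))))"
      by simp
  qed
qed

lemma updates_For:
  assumes "updates K (Suc L) c g" "L < K"
  shows "updates K L (For L c) (\<lambda>w N H X. fold (\<lambda>v. g w N (H(L := int v))) [0..<N] X)"
proof -
  obtain p where p: "\<And>w N H C X. good K w N (Suc L) H C \<Longrightarrow> C 1 = ind X \<Longrightarrow> (\<And>j. j < 3 \<Longrightarrow> H j = 0) \<Longrightarrow>
     attains c (H, C) (poly p N) (H, C(1 := ind (g w N H X)))"
    using updatesE[OF assms(1)] by metis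
  show ?thesis
  proof (rule updatesI[where p = "[:0, 1:] * (p + 3) + [:0, 1:] * 2 + 3"])
    fix w N H C X assume h: "good K w N L H C" "C 1 = ind X" "\<And>j. j < 3 \<Longrightarrow> H j = 0"
    define X' where "X' n = fold (\<lambda>v. g w N (H(L := int v))) [0..<n] X" for n
    define C' where "C' n = C(1 := ind (X' n))" for n
    have L: "3 \<le> L" using h by (auto simp: good_def)
    have "attains (For L c) (H, C' 0) (N * (poly p N + 3) + N * 2 + 3) (H, C' N)"
    proof (rule attains_For)
      fix v assume v: "v < N"
      have "good K w N (Suc L) (H(L := int v)) (C' v)"
        using good_counter[OF good_array[OF h(1)], of v] v by (simp add: C'_def)
      from p[OF this, of "X' v"]
      show "attains c (H(L := int v), C' v) (poly p N) (H(L := int v), C' (Suc v))"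
        using L h(3) by (simp add: X'_def C'_def)
    qed (use h L assms(2) in \<open>auto simp: good_def C'_def\<close>)
    then show "attains (For L c) (H, C) (poly ([:0, 1:] * (p + 3) + [:0, 1:] * 2 + 3) N)
      (H, C(1 := ind (fold (\<lambda>v. g w N (H(L := int v))) [0..<N] X)))"
      using h(2) by (simp add: C'_def X'_def algebra_simps fun_upd_idem)
  qed
qed

lemma updates_write:
  assumes "moves K L go 1 \<delta>" "moves K L back 1 (\<lambda>N H. - \<delta> N H)"
  shows "updates K L (Sq go (Sq (Wr 1 1) back)) (\<lambda>w N H X. insert (\<delta> N H) X)"
proof -
  obtain p where p: "\<And>N H z. \<delta> N (H(1 := z)) = \<delta> N H"
    "\<And>w N H C. good K w N L H C \<Longrightarrow> attains go (H, C) (poly p N) (H(1 := H 1 + \<delta> N H), C)"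
    using movesE[OF assms(1)] by metis
  obtain p' where p': "\<And>w N H C. good K w N L H C \<Longrightarrow>
      attains back (H, C) (poly p' N) (H(1 := H 1 + - \<delta> N H), C)"
    using movesE[OF assms(2)] by metis
  show ?thesis
  proof (rule updatesI[where p = "p + (1 + p' + 1) + 1"])
    fix w N H C X assume h: "good K w N L H C" "C 1 = ind X" "\<And>j. j < 3 \<Longrightarrow> H j = 0"
    define H' where "H' = H(1 := \<delta> N H)"
    define C' where "C' = C(1 := ind (insert (\<delta> N H) X))"
    have H1: "H 1 = 0" "H(1 := 0) = H" using h(3)[of 1] by (auto simp: fun_upd_idem)
    have 1: "attains go (H, C) (poly p N) (H', C)" using p(2)[OF h(1)] H1 by (simp add: H'_def)
    have "(ind X)(\<delta> N H := 1) = ind (insert (\<delta> N H) X)" by (auto simp: ind_def fun_eq_iff)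
    then have 2: "attains (Wr 1 1) (H', C) 1 (H', C')"
      using attains_Wr[of 1 1 H' C] h(2) by (simp add: H'_def C'_def)
    have "good K w N L H' C'" unfolding H'_def C'_def by (intro good_head good_array h) auto
    from p'[OF this] have 3: "attains back (H', C') (poly p' N) (H, C')"
      using p(1) H1 by (simp add: H'_def)
    show "attains (Sq go (Sq (Wr 1 1) back)) (H, C) (poly (p + (1 + p' + 1) + 1) N)
        (H, C(1 := ind (insert (\<delta> N H) X)))"
      using attains_Sq[OF 1 attains_Sq[OF 2 3]] by (simp add: C'_def algebra_simps)
  qed
qed

definition content :: "nat \<Rightarrow> bool list \<Rightarrow> nat \<Rightarrow> int set \<Rightarrow> int \<Rightarrow> nat" where
  "content T w N X = (if T = 0 then snd (input_tape w) else if T = 1 then ind X else marks N)"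

text \<open>The test takes place away from cell 0, so both branches must begin or consist of the way
  back.\<close>

lemma updates_guard:
  assumes "moves K L go T \<delta>" "moves K L back T (\<lambda>N H. - \<delta> N H)" "updates K L c g" "2 < K"
  shows "updates K L (Sq go (Br T y (Sq back c) back))
    (\<lambda>w N H X. if content T w N X (\<delta> N H) = y then g w N H X else X)"
proof -
  obtain p where p: "T < 3" "\<And>N H z. \<delta> N (H(T := z)) = \<delta> N H"
    "\<And>w N H C. good K w N L H C \<Longrightarrow> attains go (H, C) (poly p N) (H(T := H T + \<delta> N H), C)"
    using movesE[OF assms(1)] by metis
  obtain p' where p': "\<And>w N H C. good K w N L H C \<Longrightarrow>
      attains back (H, C) (poly p' N) (H(T := H T + - \<delta> N H), C)"
    using movesE[OF assms(2)] by metis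
  obtain p'' where p'': "\<And>w N H C X. good K w N L H C \<Longrightarrow> C 1 = ind X \<Longrightarrow> (\<And>j. j < 3 \<Longrightarrow> H j = 0) \<Longrightarrow>
     attains c (H, C) (poly p'' N) (H, C(1 := ind (g w N H X)))"
    using updatesE[OF assms(3)] by metis
  show ?thesis
  proof (rule updatesI[where p = "p + (p' + p'' + 1 + 1) + 1"])
    fix w N H C X assume h: "good K w N L H C" "C 1 = ind X" "\<And>j. j < 3 \<Longrightarrow> H j = 0"
    define H' where "H' = H(T := \<delta> N H)"
    have HT: "H T = 0" "H(T := 0) = H" using h(3)[of T] p(1) by (auto simp: fun_upd_idem)
    have 1: "attains go (H, C) (poly p N) (H', C)" using p(3)[OF h(1)] HT by (simp add: H'_def)
    have "good K w N L H' C" unfolding H'_def by (intro good_head h p)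
    from p'[OF this] have 2: "attains back (H', C) (poly p' N) (H, C)"
      using p(2) HT by (simp add: H'_def)
    have CT: "C T (H' T) = content T w N X (\<delta> N H)"
      using h(1,2) p(1) assms(4) by (auto simp: content_def H'_def good_def less_Suc_eq numeral_3_eq_3)
    define C' where "C' = C(1 := ind (if content T w N X (\<delta> N H) = y then g w N H X else X))"
    have "attains (if C T (H' T) = y then Sq back c else back) (H', C) (poly p' N + poly p'' N + 1) (H, C')"
    proof (cases "C T (H' T) = y")
      case True
      then show ?thesis using attains_Sq[OF 2 p''[OF h]] CT by (simp add: C'_def)
    next
      case False
      have "C(1 := ind X) = C" using h(2) by auto
      then show ?thesis using attains_mono[OF 2] CT False by (simp add: C'_def)
    qed
    from attains_Sq[OF 1 attains_If[where i = T, OF this]]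
    show "attains (Sq go (Br T y (Sq back c) back)) (H, C) (poly (p + (p' + p'' + 1 + 1) + 1) N)
      (H, C(1 := ind (if content T w N X (\<delta> N H) = y then g w N H X else X)))"
      by (simp add: C'_def)
  qed
qed

text \<open>For \<open>Sc x y\<close> head 2 is displaced by x + 1 - y; since 1 occurs only at cell
  0 of its tape, reading 1 means y = x + 1. For \<open>Bit\<close>, positions outside the word are
  blank and fail both tests.\<close>

fun guard :: "nat \<Rightarrow> nat \<Rightarrow> datom \<Rightarrow> com \<Rightarrow> com" where
  "guard b L (Rel ts) c = Sq (addrmv b L 1 MoveRight ts)
     (Br 1 1 (Sq (addrmv b L 1 MoveLeft ts) c) (addrmv b L 1 MoveLeft ts))"
| "guard b L (Bit v x) c = Sq (termmv b L 0 MoveRight 0 x)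
     (Br 0 (if v then 2 else 1) (Sq (termmv b L 0 MoveLeft 0 x) c) (termmv b L 0 MoveLeft 0 x))"
| "guard b L (Sc x y) c =
     (let back = Sq (termmv b L 2 MoveLeft 0 x) (Sq (Mv 2 MoveLeft) (termmv b L 2 MoveRight 0 y))
      in Sq (Sq (termmv b L 2 MoveRight 0 x) (Sq (Mv 2 MoveRight) (termmv b L 2 MoveLeft 0 y)))
        (Br 2 1 (Sq back c) back))"

definition member :: "nat \<Rightarrow> int set \<Rightarrow> nat list \<Rightarrow> bool" where
  "member N X f \<longleftrightarrow> int (num N f) \<in> X"

text \<open>The nonzero constant in front is the relation name; it makes the address of every fact
  \<open>proper\<close>.\<close>

primrec wfa :: "nat \<Rightarrow> nat \<Rightarrow> nat \<Rightarrow> datom \<Rightarrow> bool" where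
  "wfa m c r (Rel ts) \<longleftrightarrow> ts \<noteq> [] \<and> length ts \<le> r \<and> (\<exists>k>0. hd ts = TC k) \<and> list_all (wft m c) ts"
| "wfa m c r (Bit b x) \<longleftrightarrow> wft m c x"
| "wfa m c r (Sc x y) \<longleftrightarrow> wft m c x \<and> wft m c y"

lemma updates_iff:
  assumes "updates K L c g" "\<And>w N H X. g w N H X = g' w N H X"
  shows "updates K L c g'"
proof -
  have "g = g'" using assms(2) by (simp add: fun_eq_iff)
  then show ?thesis using assms(1) by simp
qed

lemma updates_guard_datom:
  assumes "3 \<le> b" "b + m \<le> L" "L + r + 1 < K" "wfa m c r a" "updates K L cm g"
  shows "updates K L (guard b L a cm)
    (\<lambda>w N H X. if holds w (member N X) (env b H) a then g w N H X else X)"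
proof (cases a)
  case (Rel ts)
  have mv: "moves K L (addrmv b L 1 d ts) 1 (\<lambda>N H. sg d * int (num N (map (tval (env b H)) ts)))" for d
    using assms Rel by (intro moves_addrmv) auto
  show ?thesis
    unfolding Rel guard.simps
    by (rule updates_iff[OF updates_guard[OF _ _ assms(5),
          where \<delta> = "\<lambda>N H. int (num N (map (tval (env b H)) ts))" and T = 1]])
       (use mv[of MoveRight] mv[of MoveLeft] assms(1-3) in \<open>auto simp: content_def ind_def member_def\<close>)
next
  case (Bit v x)
  have mv: "moves K L (termmv b L 0 d 0 x) 0 (\<lambda>N H. sg d * int (tval (env b H) x * N ^ 0))" for d
    using assms Bit by (intro moves_termmv) auto
  show ?thesis
    unfolding Bit guard.simps
    by (rule updates_iff[OF updates_guard[OF _ _ assms(5),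
          where \<delta> = "\<lambda>N H. int (tval (env b H) x)" and T = 0]])
       (use mv[of MoveRight] mv[of MoveLeft] assms(1-3) in \<open>auto simp: content_def input_tape_def\<close>)
next
  case (Sc x y)
  have mv: "moves K L (termmv b L 2 d 0 t) 2 (\<lambda>N H. sg d * int (tval (env b H) t * N ^ 0))"
    if "t = x \<or> t = y" for d t
    using assms Sc that by (intro moves_termmv) auto
  have mvs: "moves K L (Sq (termmv b L 2 d 0 x) (Sq (Mv 2 d) (termmv b L 2 d' 0 y))) 2
      (\<lambda>N H. sg d * int (tval (env b H) x * N ^ 0) + (sg d + sg d' * int (tval (env b H) y * N ^ 0)))" for d d'
    by (intro moves_Sq mv moves_Mv) auto
  show ?thesis
    unfolding Sc guard.simps Let_def
    by (rule updates_iff[OF updates_guard[OF _ _ assms(5),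
          where \<delta> = "\<lambda>N H. int (tval (env b H) x) + (1 - int (tval (env b H) y))" and T = 2]])
       (use mvs[of MoveRight MoveLeft] mvs[of MoveLeft MoveRight] assms(1-3)
        in \<open>auto simp: content_def marks_1 algebra_simps\<close>)
qed

primrec rule_com :: "nat \<Rightarrow> nat \<Rightarrow> dterm list \<Rightarrow> datom list \<Rightarrow> com" where
  "rule_com b L h [] = Sq (addrmv b L 1 MoveRight h) (Sq (Wr 1 1) (addrmv b L 1 MoveLeft h))"
| "rule_com b L h (a # bd) = guard b L a (rule_com b L h bd)"

definition fire :: "nat \<Rightarrow> rule \<Rightarrow> bool list \<Rightarrow> nat \<Rightarrow> (nat \<Rightarrow> int) \<Rightarrow> int set \<Rightarrow> int set" where
  "fire b r w N H X = (if \<forall>a\<in>set (snd r). holds w (member N X) (env b H) a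
     then insert (int (num N (map (tval (env b H)) (fst r)))) X else X)"

lemma updates_rule_com:
  assumes "3 \<le> b" "b + m \<le> L" "L + r + 1 < K" "wfa m c r (Rel h)" "list_all (wfa m c r) bd"
  shows "updates K L (rule_com b L h bd) (fire b (h, bd))"
  using assms
proof (induction bd)
  case Nil
  have mv: "moves K L (addrmv b L 1 d h) 1 (\<lambda>N H. sg d * int (num N (map (tval (env b H)) h)))" for d
    using Nil by (intro moves_addrmv) auto
  show ?case
    unfolding rule_com.simps
    by (rule updates_iff[OF updates_write[where \<delta> = "\<lambda>N H. int (num N (map (tval (env b H)) h))"]])
       (use mv[of MoveRight] mv[of MoveLeft] in \<open>auto simp: fire_def\<close>)
next
  case (Cons a bd)
  have "wfa m c r a" "updates K L (rule_com b L h bd) (fire b (h, bd))" using Cons by auto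
  from updates_guard_datom[OF Cons.prems(1-3) this] show ?case
    unfolding rule_com.simps by (rule updates_iff) (auto simp: fire_def)
qed

primrec rules_com :: "nat \<Rightarrow> nat \<Rightarrow> rule list \<Rightarrow> com" where
  "rules_com b L [] = skip"
| "rules_com b L (r # P) = Sq (rule_com b L (fst r) (snd r)) (rules_com b L P)"

definition wfr :: "nat \<Rightarrow> nat \<Rightarrow> nat \<Rightarrow> rule \<Rightarrow> bool" where
  "wfr m c r rl \<longleftrightarrow> wfa m c r (Rel (fst rl)) \<and> list_all (wfa m c r) (snd rl)"

definition fire_all :: "nat \<Rightarrow> rule list \<Rightarrow> bool list \<Rightarrow> nat \<Rightarrow> (nat \<Rightarrow> int) \<Rightarrow> int set \<Rightarrow> int set" where
  "fire_all b P w N H = fold (\<lambda>r. fire b r w N H) P"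

lemma updates_rules_com:
  assumes "3 \<le> b" "b + m \<le> L" "L + r + 1 < K" "list_all (wfr m c r) P"
  shows "updates K L (rules_com b L P) (fire_all b P)"
  using assms(4)
proof (induction P)
  case Nil
  show ?case unfolding rules_com.simps by (rule updates_iff[OF updates_skip]) (simp add: fire_all_def)
next
  case (Cons rl P)
  have "updates K L (rule_com b L (fst rl) (snd rl)) (fire b rl)"
    using updates_rule_com[OF assms(1-3), of c "fst rl" "snd rl"] Cons.prems by (simp add: wfr_def)
  moreover have "updates K L (rules_com b L P) (fire_all b P)" using Cons by simp
  ultimately show ?case
    unfolding rules_com.simps by (rule updates_iff[OF updates_Sq]) (simp add: fire_all_def)
qed

primrec fors :: "nat \<Rightarrow> nat \<Rightarrow> com \<Rightarrow> com" where
  "fors L 0 c = c"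
| "fors L (Suc n) c = For L (fors (Suc L) n c)"

text \<open>Used at two levels: the inner sweep runs through the valuations of the variables, the
  outer one merely repeats this often enough.\<close>

primrec sweep :: "nat \<Rightarrow> nat \<Rightarrow> (bool list \<Rightarrow> nat \<Rightarrow> (nat \<Rightarrow> int) \<Rightarrow> int set \<Rightarrow> int set) \<Rightarrow>
    bool list \<Rightarrow> nat \<Rightarrow> (nat \<Rightarrow> int) \<Rightarrow> int set \<Rightarrow> int set" where
  "sweep L 0 g = g"
| "sweep L (Suc n) g = (\<lambda>w N H X. fold (\<lambda>v. sweep (Suc L) n g w N (H(L := int v))) [0..<N] X)"

lemma updates_fors:
  "updates K (L + n) c g \<Longrightarrow> L + n \<le> K \<Longrightarrow> updates K L (fors L n c) (sweep L n g)"
proof (induction n arbitrary: L)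
  case (Suc n)
  have "updates K (Suc L) (fors (Suc L) n c) (sweep (Suc L) n g)" "L < K"
    using Suc by auto
  then show ?case unfolding fors.simps sweep.simps by (rule updates_For)
qed simp

subsection \<open>The fixed point\<close>

lemma fold_infl: "(\<And>v X. X \<subseteq> f v X) \<Longrightarrow> X \<subseteq> fold f vs X"
  by (induction vs arbitrary: X) (auto, blast)

text \<open>Since sets only grow, a pass that changes nothing in the end has changed nothing at any
  step.\<close>

lemma fold_fixed:
  assumes "\<And>v X. X \<subseteq> f v X" "fold f vs X = X" "v \<in> set vs"
  shows "f v X = X"
  using assms(2,3)
proof (induction vs)
  case (Cons u vs)
  have "f u X \<subseteq> fold f vs (f u X)" using fold_infl[of f "f u X" vs] assms(1) by blast
  then have "f u X = X" using Cons.prems assms(1)[of X u] by auto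
  then show ?case using Cons by auto
qed simp

lemma fold_closed: "(\<And>v X. v \<in> set vs \<Longrightarrow> X \<subseteq> D \<Longrightarrow> f v X \<subseteq> D) \<Longrightarrow> X \<subseteq> D \<Longrightarrow> fold f vs X \<subseteq> D"
  by (induction vs arbitrary: X) auto

lemma fold_id: "(\<And>v. v \<in> set vs \<Longrightarrow> f v X = X) \<Longrightarrow> fold f vs X = X"
  by (induction vs) auto

lemma sweep_infl:
  assumes "\<And>H X. X \<subseteq> g w N H X"
  shows "X \<subseteq> sweep L n g w N H X"
proof (induction n arbitrary: L H X)
  case (Suc n)
  show ?case by (simp, rule fold_infl) (rule Suc)
qed (use assms in simp)

definition upd :: "nat \<Rightarrow> nat \<Rightarrow> (nat \<Rightarrow> nat) \<Rightarrow> (nat \<Rightarrow> int) \<Rightarrow> nat \<Rightarrow> int" where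
  "upd L n e H j = (if L \<le> j \<and> j < L + n then int (e (j - L)) else H j)"

lemma sweep_fixed:
  assumes infl: "\<And>H X. X \<subseteq> g w N H X" and "sweep L n g w N H X = X" and e: "\<And>j. j < n \<Longrightarrow> e j < N"
  shows "g w N (upd L n e H) X = X"
  using assms(2,3)
proof (induction n arbitrary: L H e)
  case 0
  have "upd L 0 e H = H" by (auto simp: upd_def)
  then show ?case using 0 by simp
next
  case (Suc n)
  have "sweep (Suc L) n g w N (H(L := int (e 0))) X = X"
    by (rule fold_fixed[where f = "\<lambda>v. sweep (Suc L) n g w N (H(L := int v))" and vs = "[0..<N]"])
      (use Suc.prems sweep_infl[of g w N, OF infl] in auto)
  from Suc.IH[OF this, of "\<lambda>j. e (Suc j)"]
  have "g w N (upd (Suc L) n (\<lambda>j. e (Suc j)) (H(L := int (e 0)))) X = X"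
    using Suc.prems(2) by (simp del: fun_upd_apply)
  moreover have "upd (Suc L) n (\<lambda>j. e (Suc j)) (H(L := int (e 0))) = upd L (Suc n) e H"
    by (auto simp: upd_def fun_eq_iff Suc_diff_Suc intro!: arg_cong[of _ _ e])
  ultimately show ?case by (simp only:)
qed

lemma sweep_closed:
  assumes "\<And>H X. (\<And>j. 0 \<le> H j \<and> H j < int N) \<Longrightarrow> X \<subseteq> D \<Longrightarrow> g w N H X \<subseteq> D"
    and "\<And>j. 0 \<le> H j \<and> H j < int N" "X \<subseteq> D"
  shows "sweep L n g w N H X \<subseteq> D"
  using assms(2,3)
proof (induction n arbitrary: L H X)
  case (Suc n)
  show ?case using Suc.prems
    by (simp, intro fold_closed Suc.IH) auto
qed (use assms(1) in simp)

lemma sweep_id: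
  assumes "\<And>H. (\<And>j. 0 \<le> H j \<and> H j < int N) \<Longrightarrow> g w N H X = X" and "\<And>j. 0 \<le> H j \<and> H j < int N"
  shows "sweep L n g w N H X = X"
  using assms(2)
proof (induction n arbitrary: L H)
  case (Suc n)
  show ?case using Suc.prems by (simp, intro fold_id Suc.IH) auto
qed (use assms(1) in auto)

text \<open>Each of the N ^ n rounds either finds the property Q, which then persists because Q
  fixes the set, or adds at least one element.\<close>

lemma sweep_grows:
  assumes infl: "\<And>H X. X \<subseteq> g w N H X" and fin: "finite D"
    and D: "\<And>H X. (\<And>j. 0 \<le> H j \<and> H j < int N) \<Longrightarrow> X \<subseteq> D \<Longrightarrow> g w N H X \<subseteq> D"
    and fixed: "\<And>H X. (\<And>j. 0 \<le> H j \<and> H j < int N) \<Longrightarrow> g w N H X = X \<Longrightarrow> Q X"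
    and Q: "\<And>H X. (\<And>j. 0 \<le> H j \<and> H j < int N) \<Longrightarrow> Q X \<Longrightarrow> g w N H X = X"
    and H: "\<And>j. 0 \<le> H j \<and> H j < int N" and X: "X \<subseteq> D"
  shows "Q (sweep L n g w N H X) \<or> card X + N ^ n \<le> card (sweep L n g w N H X)"
  using H X
proof (induction n arbitrary: L H X)
  case 0
  show ?case
  proof (cases "g w N H X = X")
    case False
    then have "X \<subset> g w N H X" using infl by blast
    then have "card X < card (g w N H X)"
      using finite_subset[OF D[OF 0] fin] by (intro psubset_card_mono) auto
    then show ?thesis by simp
  qed (use fixed 0 in auto)
next
  case (Suc n)
  note IH = Suc.IH and H = Suc.prems(1)
  let ?f = "\<lambda>v. sweep (Suc L) n g w N (H(L := int v))"
  have "fold ?f [0..<k] X \<subseteq> D \<and> (Q (fold ?f [0..<k] X) \<or> card X + k * N ^ n \<le> card (fold ?f [0..<k] X))"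
    if "k \<le> N" for k
    using that
  proof (induction k)
    case 0
    then show ?case using Suc.prems by simp
  next
    case (Suc k)
    define Y where "Y = fold ?f [0..<k] X"
    have H': "\<And>j. 0 \<le> (H(L := int k)) j \<and> (H(L := int k)) j < int N" using Suc.prems H by auto
    have "k \<le> N" using Suc.prems by simp
    from Suc.IH[OF this] have Y: "Y \<subseteq> D" "Q Y \<or> card X + k * N ^ n \<le> card Y"
      unfolding Y_def by blast+
    have eq: "fold ?f [0..<Suc k] X = ?f k Y" by (simp add: Y_def)
    have "?f k Y \<subseteq> D" using sweep_closed[of N D g w, OF D] H' Y(1) by blast
    moreover have "Q (?f k Y) \<or> card X + Suc k * N ^ n \<le> card (?f k Y)"
    proof (cases "Q Y")
      case True
      have "?f k Y = Y" by (rule sweep_id[where g = g]) (use Q True H' in auto)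
      then show ?thesis using True by metis
    next
      case False
      have "Q (?f k Y) \<or> card Y + N ^ n \<le> card (?f k Y)"
        by (rule IH) (use H' Y(1) in auto)
      then show ?thesis using Y(2) False by (auto simp del: fun_upd_apply)
    qed
    ultimately show ?case unfolding eq by blast
  qed
  from this[of N] show ?case unfolding sweep.simps power_Suc by blast
qed

subsection \<open>Setting up the counters\<close>

primrec each :: "nat list \<Rightarrow> (nat \<Rightarrow> com) \<Rightarrow> com" where
  "each [] f = skip"
| "each (j # js) f = Sq (f j) (each js f)"

lemma attains_each_Mv:
  "distinct js \<Longrightarrow> attains (each js (\<lambda>j. Mv j d)) (H, C) (2 * length js + 1)
     (\<lambda>j. if j \<in> set js then shift d (H j) else H j, C)"
proof (induction js arbitrary: H)
  case Nil
  then show ?case using attains_Mv[of 0 Stay H C] by (simp add: skip_def)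
next
  case (Cons i js)
  have eq: "(\<lambda>j. if j \<in> set js then shift d ((H(i := shift d (H i))) j) else (H(i := shift d (H i))) j)
    = (\<lambda>j. if j \<in> set (i # js) then shift d (H j) else H j)"
    using Cons.prems by (auto simp: fun_eq_iff)
  show ?case
    using attains_Sq[OF attains_Mv[of i d H C] Cons.IH[of "H(i := shift d (H i))", unfolded eq]]
      Cons.prems by (simp del: fun_upd_apply)
qed

lemma attains_each_Wr:
  "distinct js \<Longrightarrow> attains (each js (\<lambda>j. Wr j y)) (H, C) (2 * length js + 1)
     (H, \<lambda>j. if j \<in> set js then (C j)(H j := y) else C j)"
proof (induction js arbitrary: C)
  case Nil
  then show ?case using attains_Mv[of 0 Stay H C] by (simp add: skip_def)
next
  case (Cons i js)
  let ?C = "C(i := (C i)(H i := y))"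
  have eq: "(\<lambda>j. if j \<in> set js then (?C j)(H j := y) else ?C j)
    = (\<lambda>j. if j \<in> set (i # js) then (C j)(H j := y) else C j)"
    using Cons.prems by (auto simp: fun_eq_iff)
  show ?case
    using attains_Sq[OF attains_Wr[of i y H C] Cons.IH[of ?C, unfolded eq]]
      Cons.prems by (simp del: fun_upd_apply)
qed

lemma attains_iter:
  "(\<And>k. k < n \<Longrightarrow> attains c (s k) B (s (Suc k))) \<Longrightarrow> attains (iter n c) (s 0) (n * (B + 1) + 1) (s n)"
proof (induction n arbitrary: s)
  case 0
  then show ?case
    using attains_Mv[of 0 Stay "fst (s 0)" "snd (s 0)"] by (simp add: skip_def)
next
  case (Suc n)
  have "attains (iter n c) (s (Suc 0)) (n * (B + 1) + 1) (s (Suc n))"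
    using Suc.IH[of "\<lambda>k. s (Suc k)"] Suc.prems by auto
  from attains_Sq[OF Suc.prems[of 0] this] show ?case by (simp add: add_ac)
qed

text \<open>The counter heads accompany the input head to the blank behind the word and then go c
  cells further, which puts the right mark at \<open>length w + c\<close>. On the way back the mark
  1 of tape 2 shows when cell 0 is reached, also for the input head.\<close>

definition setup_tapes :: "nat \<Rightarrow> nat \<Rightarrow> com" where
  "setup_tapes K c =
     (let J = [2..<K]; R = each J (\<lambda>j. Mv j MoveRight); L = each J (\<lambda>j. Mv j MoveLeft)
      in Sq (each J (\<lambda>j. Wr j 1)) (Sq (Wh 0 0 (Sq (Mv 0 MoveRight) R)) (Sq (iter c R)
        (Sq (each J (\<lambda>j. Wr j 2)) (Sq (iter c L) (Wh 2 1 (Sq (Mv 0 MoveLeft) L)))))))"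

text \<open>K and c are fixed, so the bound is linear in the length of the word; the coefficients
  are generous.\<close>

lemma attains_setup_tapes:
  assumes K: "2 < K" and c: "0 < c"
  shows "\<exists>C. attains (setup_tapes K c) (initial_conf w)
    (poly [:16 * K * (c + 1) + 100, 16 * K + 100:] (length w)) (\<lambda>_. 0, C)
    \<and> good K w (length w + c) 3 (\<lambda>_. 0) C \<and> C 1 = ind {}"
proof -
  define n where "n = length w"
  define J where "J = [2..<K]"
  define B where "B = 2 * length J + 1"
  have J: "distinct J" "\<And>j. j \<in> set J \<longleftrightarrow> 2 \<le> j \<and> j < K" by (auto simp: J_def)
  define R where "R = each J (\<lambda>j. Mv j MoveRight)"
  define L where "L = each J (\<lambda>j. Mv j MoveLeft)"
  define P :: "int \<Rightarrow> int \<Rightarrow> nat \<Rightarrow> int" where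
    "P a b = (\<lambda>j. if j = 0 then a else if 2 \<le> j \<and> j < K then b else 0)" for a b
  define C0 where "C0 = snd (initial_conf w)"
  define C1 where "C1 = (\<lambda>j. if j \<in> set J then (C0 j)(0 := 1) else C0 j)"
  define C2 where "C2 = (\<lambda>j. if j \<in> set J then (C1 j)(int (n + c) := 2) else C1 j)"
  have sR: "attains R (P a b, C) B (P a (b + 1), C)" for a b C
  proof -
    have "(\<lambda>j. if j \<in> set J then shift MoveRight (P a b j) else P a b j) = P a (b + 1)"
      by (auto simp: P_def J(2) fun_eq_iff)
    then show ?thesis using attains_each_Mv[OF J(1), of MoveRight "P a b" C] by (simp add: R_def B_def)
  qed
  have sL: "attains L (P a b, C) B (P a (b - 1), C)" for a b C
  proof -
    have "(\<lambda>j. if j \<in> set J then shift MoveLeft (P a b j) else P a b j) = P a (b - 1)"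
      by (auto simp: P_def J(2) fun_eq_iff)
    then show ?thesis using attains_each_Mv[OF J(1), of MoveLeft "P a b" C] by (simp add: L_def B_def)
  qed
  have P0: "(P a b)(0 := a') = P a' b" for a b a' by (auto simp: P_def)
  have mR: "attains (Sq (Mv 0 MoveRight) R) (P a b, C) (B + 2) (P (a + 1) (b + 1), C)" for a b C
  proof -
    have "shift MoveRight (P a b 0) = a + 1" by (simp add: P_def)
    then show ?thesis
      using attains_Sq[OF attains_Mv[of 0 MoveRight "P a b" C], of R B] sR[of "a + 1" b C] by (simp add: P0)
  qed
  have mL: "attains (Sq (Mv 0 MoveLeft) L) (P a b, C) (B + 2) (P (a - 1) (b - 1), C)" for a b C
  proof -
    have "shift MoveLeft (P a b 0) = a - 1" by (simp add: P_def)
    then show ?thesis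
      using attains_Sq[OF attains_Mv[of 0 MoveLeft "P a b" C], of L B] sL[of "a - 1" b C] by (simp add: P0)
  qed
  have C00: "C0 0 = snd (input_tape w)" "\<And>j. j > 0 \<Longrightarrow> C0 j = (\<lambda>_. 0)"
    by (auto simp: C0_def initial_conf_def)
  have C10: "C1 0 = snd (input_tape w)" by (auto simp: C1_def J(2) C00)
  have C2m: "C2 j = marks (n + c)" if "2 \<le> j" "j < K" for j
    using that c by (auto simp: C2_def C1_def J(2) C00 marks_def fun_eq_iff)
  have C20: "C2 0 = snd (input_tape w)" "C2 1 = ind {}"
    by (auto simp: C2_def J(2) C10) (auto simp: C1_def J(2) C00 ind_def fun_eq_iff)
  have init: "initial_conf w = (P 0 0, C0)"
    by (auto simp: initial_conf_def P_def C0_def)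
  have 1: "attains (each J (\<lambda>j. Wr j 1)) (P 0 0, C0) B (P 0 0, C1)"
  proof -
    have "(\<lambda>j. if j \<in> set J then (C0 j)(P 0 0 j := 1) else C0 j) = C1"
      by (auto simp: P_def C1_def fun_eq_iff)
    then show ?thesis using attains_each_Wr[OF J(1), of 1 "P 0 0" C0] by (simp add: B_def)
  qed
  have 2: "attains (Wh 0 0 (Sq (Mv 0 MoveRight) R)) (P 0 0, C1) (n * (B + 2 + 1) + 1) (P n n, C1)"
  proof -
    have "attains (Wh 0 0 (Sq (Mv 0 MoveRight) R)) ((\<lambda>k. (P (int k) (int k), C1)) 0)
       (n * (B + 2 + 1) + 1) ((\<lambda>k. (P (int k) (int k), C1)) n)"
    proof (rule attains_Wh)
      fix k show "attains (Sq (Mv 0 MoveRight) R) (P (int k) (int k), C1) (B + 2) (P (int (Suc k)) (int (Suc k)), C1)"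
        using mR[of "int k" "int k" C1] by (simp add: add.commute)
    qed (auto simp: C10 P_def input_tape_def n_def)
    then show ?thesis by simp
  qed
  have 3: "attains (iter c R) (P n n, C1) (c * (B + 1) + 1) (P n (n + c), C1)"
  proof -
    have "attains R (P (int n) (int n + int k), C1) B (P (int n) (int n + int (Suc k)), C1)" for k
      using sR[of "int n" "int n + int k" C1] by (simp add: add_ac)
    from attains_iter[of c R "\<lambda>k. (P (int n) (int n + int k), C1)", OF this] show ?thesis by simp
  qed
  have 4: "attains (each J (\<lambda>j. Wr j 2)) (P n (n + c), C1) B (P n (n + c), C2)"
  proof -
    have "(\<lambda>j. if j \<in> set J then (C1 j)(P n (n + c) j := 2) else C1 j) = C2"
      by (auto simp: P_def C2_def J(2) fun_eq_iff)
    then show ?thesis using attains_each_Wr[OF J(1), of 2 "P n (n + c)" C1] by (simp add: B_def)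
  qed
  have 5: "attains (iter c L) (P n (n + c), C2) (c * (B + 1) + 1) (P n n, C2)"
  proof -
    have "attains L (P (int n) (int n + int c - int k), C2) B (P (int n) (int n + int c - int (Suc k)), C2)" for k
      using sL[of "int n" "int n + int c - int k" C2] by (simp add: algebra_simps)
    from attains_iter[of c L "\<lambda>k. (P (int n) (int n + int c - int k), C2)", OF this] show ?thesis by simp
  qed
  have 6: "attains (Wh 2 1 (Sq (Mv 0 MoveLeft) L)) (P n n, C2) (n * (B + 2 + 1) + 1) (P 0 0, C2)"
  proof -
    have "attains (Wh 2 1 (Sq (Mv 0 MoveLeft) L)) ((\<lambda>k. (P (int n - int k) (int n - int k), C2)) 0)
       (n * (B + 2 + 1) + 1) ((\<lambda>k. (P (int n - int k) (int n - int k), C2)) n)"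
    proof (rule attains_Wh)
      fix k show "attains (Sq (Mv 0 MoveLeft) L) (P (int n - int k) (int n - int k), C2) (B + 2)
          (P (int n - int (Suc k)) (int n - int (Suc k)), C2)"
        using mL[of "int n - int k" "int n - int k" C2] by (simp add: algebra_simps)
    qed (use K in \<open>auto simp: C2m P_def marks_1\<close>)
    then show ?thesis by simp
  qed
  have "attains (setup_tapes K c) (initial_conf w)
      (B + ((n * (B + 2 + 1) + 1) + ((c * (B + 1) + 1) + (B + ((c * (B + 1) + 1) + (n * (B + 2 + 1) + 1) + 1) + 1) + 1) + 1) + 1)
      (P 0 0, C2)"
    unfolding setup_tapes_def Let_def J_def[symmetric] R_def[symmetric] L_def[symmetric] init
    by (intro attains_Sq 1 2 3 4 5 6) (use 1 2 3 4 5 6 in auto)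
  moreover have "P 0 0 = (\<lambda>_. 0)" by (auto simp: P_def)
  moreover have "B \<le> 2 * K" using K by (simp add: B_def J_def)
  then have nB: "n * B \<le> n * (2 * K)" and cB: "c * B \<le> c * (2 * K)" by (auto intro: mult_left_mono)
  have "c * 2 \<le> c * K" using K by (intro mult_left_mono) auto
  with nB cB have "B + ((n * (B + 2 + 1) + 1) + ((c * (B + 1) + 1) + (B + ((c * (B + 1) + 1) + (n * (B + 2 + 1) + 1) + 1) + 1) + 1) + 1) + 1
     \<le> poly [:16 * K * (c + 1) + 100, 16 * K + 100:] n"
    using \<open>B \<le> 2 * K\<close> K unfolding poly_pCons poly_0 ring_distribs add_mult_distrib add_mult_distrib2 mult_1_right
    by (simp only: mult_ac)
  moreover have "good K w (length w + c) 3 (\<lambda>_. 0) C2"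
    using c C20 C2m by (auto simp: good_def n_def)
  ultimately show ?thesis
    using C20(2) by (intro exI[of _ C2] conjI) (auto intro: attains_mono simp only: n_def)
qed

subsection \<open>Datalog queries are in polynomial time\<close>

lemma good_level: "good K w N L H C \<Longrightarrow> L \<le> L' \<Longrightarrow> good K w N L' H C"
  by (auto simp: good_def)

lemma tval_cong: "wft m c t \<Longrightarrow> (\<And>j. j < m \<Longrightarrow> e j = e' j) \<Longrightarrow> tval e t = tval e' t"
  by (cases t) auto

lemma tvals_cong:
  "list_all (wft m c) ts \<Longrightarrow> (\<And>j. j < m \<Longrightarrow> e j = e' j) \<Longrightarrow> map (tval e) ts = map (tval e') ts"
  by (induction ts) (auto intro: tval_cong)

lemma holds_cong:
  assumes "wfa m c r a" "\<And>j. j < m \<Longrightarrow> e j = e' j"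
  shows "holds w S e a = holds w S e' a"
proof (cases a)
  case (Rel ts)
  then have "map (tval e) ts = map (tval e') ts" using assms by (intro tvals_cong[of m c]) auto
  then show ?thesis unfolding Rel holds.simps by (rule arg_cong)
next
  case (Bit b x)
  then show ?thesis using tval_cong[of m c x e e'] assms by simp
next
  case (Sc x y)
  then show ?thesis using tval_cong[of m c x e e'] tval_cong[of m c y e e'] assms by simp
qed

lemma holds_subset: "holds w S e a \<Longrightarrow> (\<And>ts. a = Rel ts \<Longrightarrow> S (map (tval e) ts) \<Longrightarrow> S' (map (tval e) ts))
    \<Longrightarrow> holds w S' e a"
  by (cases a) auto

definition ok_fact :: "nat \<Rightarrow> nat \<Rightarrow> nat list \<Rightarrow> bool" where
  "ok_fact N r f \<longleftrightarrow> proper f \<and> length f \<le> r \<and> (\<forall>x\<in>set f. x < N)"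

lemma ok_fact_tval:
  assumes "wfa m c r (Rel ts)" "\<And>j. e j < N" "c \<le> N"
  shows "ok_fact N r (map (tval e) ts)"
proof -
  have "tval e t < N" if "t \<in> set ts" for t
    using assms that by (cases t) (fastforce simp: list_all_iff)+
  then show ?thesis using assms by (auto simp: ok_fact_def proper_def hd_map)
qed

lemma ok_fact_num_inj: "0 < N \<Longrightarrow> ok_fact N r f \<Longrightarrow> ok_fact N r f' \<Longrightarrow> num N f = num N f' \<Longrightarrow> f = f'"
  using num_inj by (simp add: ok_fact_def)

context
  fixes P :: "rule list" and m c r b N :: nat and w :: "bool list"
  assumes P: "list_all (wfr m c r) P" and N: "0 < N" "c \<le> N"
begin

lemma derives_ok_fact: "derives P w N f \<Longrightarrow> ok_fact N r f"
proof (induction rule: derives.induct)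
  case (derives h bd e)
  then have "wfa m c r (Rel h)" using P by (auto simp: list_all_iff wfr_def)
  then show ?case using ok_fact_tval derives N by blast
qed

definition derived :: "int set" where
  "derived = {int (num N f) | f. derives P w N f}"

lemma member_derived: "ok_fact N r f \<Longrightarrow> member N derived f \<longleftrightarrow> derives P w N f"
  using ok_fact_num_inj[OF N(1)] derives_ok_fact by (auto simp: member_def derived_def)

lemma derived_bounded: "derived \<subseteq> {0..<int (N ^ r)}"
proof -
  have "num N f < N ^ r" if "derives P w N f" for f
  proof -
    have f: "length f \<le> r" "\<forall>x\<in>set f. x < N" using derives_ok_fact[OF that] by (auto simp: ok_fact_def)
    have "num N f < N ^ length f" using num_less f by blast
    also have "\<dots> \<le> N ^ r" using f N by (intro power_increasing) auto
    finally show ?thesis .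
  qed
  then show ?thesis by (force simp: derived_def simp flip: of_nat_power)
qed

lemma env_less: "(\<And>j. 0 \<le> H j \<and> H j < int N) \<Longrightarrow> env b H j < N"
  using N by (simp add: env_def nat_less_iff)

lemma fire_derived:
  assumes H: "\<And>j. 0 \<le> H j \<and> H j < int N" and X: "X \<subseteq> derived" and rl: "rl \<in> set P"
  shows "fire b rl w N H X \<subseteq> derived"
proof (cases "\<forall>a\<in>set (snd rl). holds w (member N X) (env b H) a")
  case True
  have wf: "wfa m c r (Rel (fst rl))" "list_all (wfa m c r) (snd rl)"
    using P rl by (auto simp: list_all_iff wfr_def)
  have "derives P w N (map (tval (env b H)) (fst rl))"
  proof (rule derives.intros)
    show "(fst rl, snd rl) \<in> set P" using rl by simp
    show "env b H j < N" for j using env_less[OF H] .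
    fix a assume a: "a \<in> set (snd rl)"
    show "holds w (derives P w N) (env b H) a"
    proof (rule holds_subset)
      show "holds w (member N X) (env b H) a" using True a by blast
      fix ts assume ts: "a = Rel ts" "member N X (map (tval (env b H)) ts)"
      have "ok_fact N r (map (tval (env b H)) ts)"
        using a ts(1) wf(2) N env_less[OF H] by (intro ok_fact_tval[of m c]) (auto simp: list_all_iff)
      then show "derives P w N (map (tval (env b H)) ts)"
        using ts(2) X member_derived by (auto simp: member_def)
    qed
  qed
  then show ?thesis using X by (auto simp: fire_def derived_def)
qed (use X in \<open>auto simp: fire_def\<close>)

lemma fire_all_derived:
  assumes "\<And>j. 0 \<le> H j \<and> H j < int N" "X \<subseteq> derived"
  shows "fire_all b P w N H X \<subseteq> derived"
  unfolding fire_all_def by (rule fold_closed) (use assms fire_derived in auto)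

lemma fire_infl: "X \<subseteq> fire b rl w N H X"
  by (auto simp: fire_def)

lemma fire_all_infl: "X \<subseteq> fire_all b P w N H X"
  unfolding fire_all_def by (rule fold_infl) (rule fire_infl)

definition closed_under_rules :: "int set \<Rightarrow> bool" where
  "closed_under_rules X \<longleftrightarrow> (\<forall>rl\<in>set P. \<forall>e. (\<forall>j. e j < N) \<longrightarrow>
     (\<forall>a\<in>set (snd rl). holds w (member N X) e a) \<longrightarrow> member N X (map (tval e) (fst rl)))"

lemma closed_derived: "closed_under_rules X \<Longrightarrow> derived \<subseteq> X"
proof -
  assume X: "closed_under_rules X"
  have "derives P w N f \<Longrightarrow> member N X f" for f
  proof (induction rule: derives.induct)
    case (derives h bd e)
    have "\<forall>a\<in>set bd. holds w (member N X) e a"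
      using derives(3) by (auto intro: holds_subset)
    then show ?case using X derives(1,2) unfolding closed_under_rules_def by force
  qed
  then show ?thesis by (auto simp: derived_def member_def)
qed

lemma closed_fire_all:
  assumes "closed_under_rules X" "\<And>j. 0 \<le> H j \<and> H j < int N"
  shows "fire_all b P w N H X = X"
proof -
  have "fire b rl w N H X = X" if "rl \<in> set P" for rl
    using assms that env_less[OF assms(2)]
    by (auto simp: closed_under_rules_def fire_def member_def)
  then show ?thesis unfolding fire_all_def by (intro fold_id) auto
qed

text \<open>A sweep varies m counters only, whereas closure speaks of all valuations. Rules are
  well-formed and mention only variables below m, so the two match.\<close>

lemma fixed_closed:
  assumes "sweep b m (fire_all b P) w N H X = X"
  shows "closed_under_rules X"
  unfolding closed_under_rules_def
proof (intro ballI allI impI)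
  fix rl e assume rl: "rl \<in> set P" and e: "\<forall>j. e j < N"
    and bd: "\<forall>a\<in>set (snd rl). holds w (member N X) e a"
  let ?H = "upd b m e H"
  have wf: "wfa m c r (Rel (fst rl))" "list_all (wfa m c r) (snd rl)"
    using P rl by (auto simp: list_all_iff wfr_def)
  have "fire_all b P w N ?H X = X"
    by (rule sweep_fixed[where g = "fire_all b P"]) (use fire_all_infl assms e in auto)
  then have "fire b rl w N ?H X = X"
    unfolding fire_all_def
    by (intro fold_fixed[where f = "\<lambda>rl. fire b rl w N ?H" and vs = P]) (use fire_infl rl in auto)
  moreover have env: "env b ?H j = e j" if "j < m" for j
    using that by (simp add: env_def upd_def)
  moreover have "\<forall>a\<in>set (snd rl). holds w (member N X) (env b ?H) a"
    using bd wf(2) holds_cong[of m c r _ "env b ?H" e] env by (auto simp: list_all_iff)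
  moreover have "map (tval (env b ?H)) (fst rl) = map (tval e) (fst rl)"
    using wf(1) env by (intro tvals_cong) auto
  ultimately show "member N X (map (tval e) (fst rl))"
    by (auto simp: fire_def member_def split: if_splits)
qed

text \<open>As long as the set is not closed, every outer round adds a fact. If this happened in all
  N ^ r rounds, the set would contain all N ^ r addresses available to derived facts, and so again
  equal \<open>derived\<close>.\<close>

lemma sweeps_derived: "sweep L r (sweep b m (fire_all b P)) w N (\<lambda>_. 0) {} = derived"
proof -
  let ?G = "sweep b m (fire_all b P)" and ?Y = "sweep L r (sweep b m (fire_all b P)) w N (\<lambda>_. 0) {}"
  have H0: "\<And>j. 0 \<le> (\<lambda>_. 0 :: int) j \<and> (\<lambda>_. 0) j < int N" using N by simp
  have finD: "finite derived" using derived_bounded finite_subset by blast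
  have GD: "?G w N H X \<subseteq> derived" if "\<And>j. 0 \<le> H j \<and> H j < int N" "X \<subseteq> derived" for H X
    by (rule sweep_closed[where g = "fire_all b P"]) (use fire_all_derived that in auto)
  have YD: "?Y \<subseteq> derived"
    by (rule sweep_closed[where g = ?G]) (use GD N in auto)
  have "closed_under_rules ?Y \<or> card ({} :: int set) + N ^ r \<le> card ?Y"
  proof (rule sweep_grows[where g = ?G and D = derived and Q = closed_under_rules])
    show "X \<subseteq> ?G w N H X" for H X
      by (rule sweep_infl) (rule fire_all_infl)
    show "?G w N H X = X" if "\<And>j. 0 \<le> H j \<and> H j < int N" "closed_under_rules X" for H X
      by (rule sweep_id[where g = "fire_all b P"]) (use closed_fire_all that in auto)
  qed (use GD finD fixed_closed N in auto)
  moreover have "?Y = derived" if "N ^ r \<le> card ?Y"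
  proof -
    have "?Y = {0..<int (N ^ r)}"
      using YD derived_bounded that by (intro card_seteq) (auto simp: nat_power_eq)
    then show ?thesis using YD derived_bounded by blast
  qed
  ultimately show ?thesis using YD closed_derived by auto
qed

end

section \<open>Well-formedness of the compiled commands\<close>

lemma wfc_skip [simp]: "0 < K \<Longrightarrow> wfc K skip"
  by (simp add: skip_def)

lemma wfc_iter: "0 < K \<Longrightarrow> wfc K c \<Longrightarrow> wfc K (iter n c)"
  by (induction n) auto

lemma wfc_each: "0 < K \<Longrightarrow> (\<And>j. j \<in> set js \<Longrightarrow> wfc K (f j)) \<Longrightarrow> wfc K (each js f)"
  by (induction js) auto

lemma wfc_setup_tapes: "2 < K \<Longrightarrow> wfc K (setup_tapes K c)"
  by (auto simp: setup_tapes_def Let_def intro!: wfc_each wfc_iter)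

lemma wfc_For: "L < K \<Longrightarrow> wfc K c \<Longrightarrow> wfc K (For L c)"
  by (simp add: For_def)

lemma wfc_fors: "L + n \<le> K \<Longrightarrow> wfc K c \<Longrightarrow> wfc K (fors L n c)"
  by (induction n arbitrary: L) (auto intro: wfc_For)

lemma wfc_powmv: "T < K \<Longrightarrow> L + n \<le> K \<Longrightarrow> wfc K (powmv L n T d)"
  by (induction n arbitrary: L) (auto intro: wfc_For)

lemma wfc_termmv:
  "T < K \<Longrightarrow> b + m \<le> L \<Longrightarrow> L + n < K \<Longrightarrow> wft m c t \<Longrightarrow> wfc K (termmv b L T d n t)"
  by (cases t) (auto simp: Rep_def intro!: wfc_powmv wfc_iter)

lemma wfc_addrmv:
  "T < K \<Longrightarrow> b + m \<le> L \<Longrightarrow> L + length ts < K \<Longrightarrow> list_all (wft m c) ts \<Longrightarrow> wfc K (addrmv b L T d ts)"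
  by (induction ts) (auto intro!: wfc_termmv)

lemma wfc_rule_com:
  assumes "2 < K" "b + m \<le> L" "L + r < K" "wfa m c r (Rel h)" "list_all (wfa m c r) bd"
  shows "wfc K (rule_com b L h bd)"
  using assms(5)
proof (induction bd)
  case Nil
  then show ?case using assms by (auto intro!: wfc_addrmv)
next
  case (Cons a bd)
  then show ?case using assms
    by (cases a) (auto simp: Let_def intro!: wfc_addrmv wfc_termmv)
qed

lemma wfc_rules_com:
  "2 < K \<Longrightarrow> b + m \<le> L \<Longrightarrow> L + r < K \<Longrightarrow> list_all (wfr m c r) P \<Longrightarrow> wfc K (rules_com b L P)"
  by (induction P) (auto simp: wfr_def intro!: wfc_rule_com)

theorem datalog_PTIME:
  assumes P: "list_all (wfr m c r) P" and g: "wfa m c r (Rel g)" "list_all (wft 0 c) g" and c: "0 < c"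
  shows "{w. \<not> derives P w (length w + c) (map (tval (\<lambda>_. 0)) g)} \<in> PTIME"
proof -
  \<comment> \<open>Layout of the counters: 3 to r + 2 count the rounds, the m from b on hold the
    variables, and those from L on are for address arithmetic.\<close>
  define b where "b = 3 + r"
  define L where "L = b + m"
  define K where "K = L + r + 2"
  define G where "G = sweep 3 r (sweep b m (fire_all b P))"
  define prog where "prog = fors 3 r (fors b m (rules_com b L P))"
  have "updates K L (rules_com b L P) (fire_all b P)"
    by (rule updates_rules_com[where m = m and c = c and r = r]) (use P in \<open>auto simp: K_def L_def b_def\<close>)
  then have "updates K b (fors b m (rules_com b L P)) (sweep b m (fire_all b P))"
    by (intro updates_fors) (auto simp: L_def K_def)
  then have "updates K 3 prog G" unfolding prog_def G_def
    by (intro updates_fors) (auto simp: b_def L_def K_def)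
  then obtain p where p: "\<And>w N H C X. good K w N 3 H C \<Longrightarrow> C 1 = ind X \<Longrightarrow> (\<And>j. j < 3 \<Longrightarrow> H j = 0) \<Longrightarrow>
     attains prog (H, C) (poly p N) (H, C(1 := ind (G w N H X)))"
    using updatesE by metis
  have "moves K L (addrmv b L 1 MoveRight g) 1 (\<lambda>N H. sg MoveRight * int (num N (map (tval (env b H)) g)))"
    by (rule moves_addrmv[where m = m and c = c]) (use g in \<open>auto simp: K_def L_def b_def\<close>)
  then obtain q where q: "\<And>w N H C. good K w N L H C \<Longrightarrow> attains (addrmv b L 1 MoveRight g) (H, C) (poly q N)
     (H(1 := H 1 + sg MoveRight * int (num N (map (tval (env b H)) g))), C)"
    by (rule movesE) blast
  define p0 where "p0 = [:16 * K * (c + 1) + 100, 16 * K + 100:]"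
  define gf where "gf = map (tval (\<lambda>_. 0)) g"
  \<comment> \<open>Head 1 is left on the address of the goal, where \<open>com_PTIME\<close> reads
    the verdict: acceptance means that this cell is not marked.\<close>
  define cm where "cm = Sq (setup_tapes K c) (Sq prog (addrmv b L 1 MoveRight g))"
  \<comment> \<open>The time of the program is polynomial in N = \<open>length w + c\<close>;
    composition with [:c, 1:] turns this into a polynomial in the length.\<close>
  define pt where "pt = p0 + (pcompose p [:c, 1:] + pcompose q [:c, 1:] + 1) + 1"
  have ex: "\<exists>s. (\<exists>t\<le>poly pt (length w). runs cm (initial_conf w) t s) \<and>
      snd s 1 (fst s 1) = (if derives P w (length w + c) gf then 1 else 0)" for w
  proof -
    let ?N = "length w + c"
    have N: "0 < ?N" "c \<le> ?N" using c by auto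
    obtain C where C: "attains (setup_tapes K c) (initial_conf w) (poly p0 (length w)) (\<lambda>_. 0, C)"
      "good K w ?N 3 (\<lambda>_. 0) C" "C 1 = ind {}"
      using attains_setup_tapes[OF _ c, of K w, folded p0_def] by (auto simp: K_def L_def b_def)
    define C' where "C' = C(1 := ind (G w ?N (\<lambda>_. 0) {}))"
    have 2: "attains prog (\<lambda>_. 0, C) (poly p ?N) (\<lambda>_. 0, C')"
      unfolding C'_def by (rule p[OF C(2,3)]) simp
    have "good K w ?N L (\<lambda>_. 0) C'"
      unfolding C'_def by (rule good_level[OF good_array[OF C(2)]]) (simp add: L_def b_def)
    from q[OF this] have 3: "attains (addrmv b L 1 MoveRight g) (\<lambda>_. 0, C') (poly q ?N)
        ((\<lambda>_. 0)(1 := int (num ?N (map (tval (env b (\<lambda>_. 0))) g))), C')" by simp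
    have "env b (\<lambda>_. 0) = (\<lambda>_. 0)" by (auto simp: env_def)
    with 3 have 3: "attains (addrmv b L 1 MoveRight g) (\<lambda>_. 0, C') (poly q ?N)
        ((\<lambda>_. 0)(1 := int (num ?N gf)), C')" by (simp add: gf_def)
    have "attains cm (initial_conf w) (poly pt (length w)) ((\<lambda>_. 0)(1 := int (num ?N gf)), C')"
      using attains_Sq[OF C(1) attains_Sq[OF 2 3]]
      by (simp add: cm_def pt_def poly_pcompose add_ac)
    moreover have "C' 1 (int (num ?N gf)) = (if derives P w ?N gf then 1 else 0)"
    proof -
      have "ok_fact ?N r gf"
        unfolding gf_def by (rule ok_fact_tval[OF g(1)]) (use N in auto)
      then have "member ?N (derived P ?N w) gf \<longleftrightarrow> derives P w ?N gf"
        using member_derived[OF P N] by blast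
      moreover have "G w ?N (\<lambda>_. 0) {} = derived P ?N w"
        unfolding G_def by (rule sweeps_derived[OF P N])
      ultimately show ?thesis by (simp add: C'_def ind_def member_def)
    qed
    ultimately show ?thesis unfolding attains_def by fastforce
  qed
  then obtain res where res: "\<And>w. \<exists>t\<le>poly pt (length w). runs cm (initial_conf w) t (res w)"
    "\<And>w. snd (res w) 1 (fst (res w) 1) = (if derives P w (length w + c) gf then 1 else 0)"
    by metis
  have "wfc K (rules_com b L P)"
    using P by (intro wfc_rules_com[where m = m and c = c and r = r]) (auto simp: K_def L_def b_def)
  then have "wfc K prog"
    unfolding prog_def by (intro wfc_fors) (auto simp: K_def L_def b_def)
  moreover have "wfc K (addrmv b L 1 MoveRight g)"
    using g by (intro wfc_addrmv[where m = m and c = c]) (auto simp: K_def L_def)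
  ultimately have "wfc K cm"
    unfolding cm_def by (auto simp: K_def L_def b_def intro!: wfc_setup_tapes)
  then have "{w. snd (res w) 1 (fst (res w) 1) \<noteq> 1} \<in> PTIME"
    by (rule com_PTIME) (use res in \<open>auto simp: K_def\<close>)
  moreover have "{w. snd (res w) 1 (fst (res w) 1) \<noteq> 1} = {w. \<not> derives P w (length w + c) gf}"
    unfolding res(2) by simp
  ultimately show ?thesis by (simp add: gf_def)
qed

subsection \<open>Walks of weight zero\<close>

inductive walk :: "(int \<Rightarrow> 'n \<Rightarrow> 'n \<Rightarrow> bool) \<Rightarrow> nat \<Rightarrow> 'n \<Rightarrow> int \<Rightarrow> 'n \<Rightarrow> bool" for E where
  walk_refl: "walk E 0 x 0 x"
| walk_step: "E z x a \<Longrightarrow> walk E n a w y \<Longrightarrow> walk E (Suc n) x (z + w) y"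

text \<open>Closure properties that suffice to generate the pairs joined by a walk of weight 0, without reference to
  the value of the counter: cut a walk at the first return to its initial weight.\<close>

inductive balanced :: "(int \<Rightarrow> 'n \<Rightarrow> 'n \<Rightarrow> bool) \<Rightarrow> 'n \<Rightarrow> 'n \<Rightarrow> bool" for E where
  bal_refl: "balanced E x x"
| bal_edge: "E 0 x y \<Longrightarrow> balanced E x y"
| bal_up: "E 1 x a \<Longrightarrow> balanced E a b \<Longrightarrow> E (- 1) b y \<Longrightarrow> balanced E x y"
| bal_down: "E (- 1) x a \<Longrightarrow> balanced E a b \<Longrightarrow> E 1 b y \<Longrightarrow> balanced E x y"
| bal_trans: "balanced E x y \<Longrightarrow> balanced E y z \<Longrightarrow> balanced E x z"

lemma walk_append: "walk E n x w y \<Longrightarrow> walk E n' y w' z \<Longrightarrow> walk E (n + n') x (w + w') z"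
proof (induction rule: walk.induct)
  case (walk_step u x a n w y)
  then show ?case using walk.walk_step[of E u x a "n + n'" "w + w'" z] by (simp add: add.assoc)
qed simp

lemma walk_edge: "E w x y \<Longrightarrow> walk E 1 x w y"
  using walk_step[of E w x y 0 0 y] by (simp add: walk_refl)

lemma balanced_walk: "balanced E x y \<Longrightarrow> \<exists>n. walk E n x 0 y"
proof (induction rule: balanced.induct)
  case (bal_refl x)
  show ?case by (rule exI, rule walk_refl)
next
  case (bal_edge x y)
  from walk_edge[of E, OF bal_edge] show ?case by (rule exI)
next
  case (bal_up x a b y)
  then obtain n where "walk E n a 0 b" by blast
  from walk_append[OF walk_edge[of E, OF bal_up(1)] walk_append[OF this walk_edge[of E, OF bal_up(3)]]]
  show ?case by auto
next
  case (bal_down x a b y)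
  then obtain n where "walk E n a 0 b" by blast
  from walk_append[OF walk_edge[of E, OF bal_down(1)] walk_append[OF this walk_edge[of E, OF bal_down(3)]]]
  show ?case by auto
next
  case (bal_trans x y z)
  then obtain n m where "walk E n x 0 y" "walk E m y 0 z" by blast
  from walk_append[OF this] show ?case by auto
qed

text \<open>Steps change the level by at most 1, so a walk to a negative level crosses from 0 to -1
  on a single edge; cut it there. The lengths are recorded for the induction in
  \<open>walk_balanced\<close>.\<close>

lemma walk_descent:
  assumes "\<forall>z x y. E z x y \<longrightarrow> z \<in> {-1, 0, 1}" "walk E n x w y" "w < 0"
  shows "\<exists>b c k l. walk E k x 0 b \<and> E (- 1) b c \<and> walk E l c (w + 1) y \<and> k + l < n"
  using assms(2,3)
proof (induction n arbitrary: x w rule: less_induct)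
  case (less n)
  from less.prems obtain z a m v where s: "n = Suc m" "E z x a" "walk E m a v y" "w = z + v"
    by (cases rule: walk.cases) auto
  consider "z = -1" | "z = 0" | "z = 1" using assms(1) s(2) by blast
  then show ?case
  proof cases
    case 1
    then show ?thesis using s walk_refl[of E x] by (intro exI[of _ x] exI[of _ a] exI[of _ 0] exI[of _ m]) auto
  next
    case 2
    obtain b c k l where bc: "walk E k a 0 b" "E (- 1) b c" "walk E l c (v + 1) y" "k + l < m"
      using less.IH[of m a v] s 2 less.prems by auto
    then show ?thesis using walk_step[OF s(2) bc(1)] s 2
      by (intro exI[of _ b] exI[of _ c] exI[of _ "Suc k"] exI[of _ l]) auto
  next
    case 3
    obtain b c k l where bc: "walk E k a 0 b" "E (- 1) b c" "walk E l c (v + 1) y" "k + l < m"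
      using less.IH[of m a v] s 3 less.prems by auto
    \<comment> \<open>After a first edge of weight 1 the walk has to descend twice: back to the
      initial level, and then below it.\<close>
    obtain b' c' k' l' where bc': "walk E k' c 0 b'" "E (- 1) b' c'" "walk E l' c' (v + 1 + 1) y" "k' + l' < l"
      using less.IH[of l c "v + 1"] bc s 3 less.prems by auto
    have "walk E (Suc (k + Suc k')) x (1 + (0 + (-1 + 0))) b'"
      using s(2) 3 by (intro walk_step[of E 1 x a] walk_append[OF bc(1) walk_step[of E, OF bc(2) bc'(1)]]) auto
    then show ?thesis using bc bc' s 3
      by (intro exI[of _ b'] exI[of _ c'] exI[of _ "Suc (k + Suc k')"] exI[of _ l']) (auto simp: algebra_simps)
  qed
qed

lemma walk_uminus: "walk E n x w y \<Longrightarrow> walk (\<lambda>z. E (- z)) n x (- w) y"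
proof (induction rule: walk.induct)
  case (walk_refl x)
  then show ?case using walk.walk_refl by fastforce
next
  case (walk_step z x a n w y)
  then show ?case using walk.walk_step[of "\<lambda>z. E (- z)" "- z" x a n "- w" y] by simp
qed

lemma walk_ascent:
  assumes "\<forall>z x y. E z x y \<longrightarrow> z \<in> {-1, 0, 1}" "walk E n x w y" "w > 0"
  shows "\<exists>b c k l. walk E k x 0 b \<and> E 1 b c \<and> walk E l c (w - 1) y \<and> k + l < n"
proof -
  have "\<exists>b c k l. walk (\<lambda>z. E (- z)) k x 0 b \<and> E (- (- 1)) b c \<and> walk (\<lambda>z. E (- z)) l c (- w + 1) y \<and> k + l < n"
    using assms by (intro walk_descent walk_uminus) force+
  then obtain b c k l where "walk (\<lambda>z. E (- z)) k x 0 b" "E 1 b c" "walk (\<lambda>z. E (- z)) l c (- w + 1) y" "k + l < n"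
    by auto
  then show ?thesis
    using walk_uminus[of "\<lambda>z. E (- z)" k x 0 b] walk_uminus[of "\<lambda>z. E (- z)" l c "- w + 1" y] by auto
qed

text \<open>Induction on the length. A first edge of weight 1 or -1 is matched with a later edge
  back to the initial level; this yields a bracket around a shorter walk of weight 0, followed by
  another one.\<close>

lemma walk_balanced:
  assumes "\<forall>z x y. E z x y \<longrightarrow> z \<in> {-1, 0, 1}" "walk E n x 0 y"
  shows "balanced E x y"
  using assms(2)
proof (induction n arbitrary: x y rule: less_induct)
  case (less n)
  from less.prems show ?case
  proof (cases rule: walk.cases)
    case walk_refl
    then show ?thesis by (simp add: bal_refl)
  next
    case (walk_step z a m v)
    consider "z = 0" "v = 0" | "z = 1" "v = -1" | "z = -1" "v = 1" using assms(1) walk_step(1-3) by force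
    then show ?thesis
    proof cases
      case 1
      then show ?thesis using walk_step less.IH[of m a y] bal_edge[of E x a] bal_trans[of E x a y] by auto
    next
      case 2
      obtain b c k l where "walk E k a 0 b" "E (- 1) b c" "walk E l c 0 y" "k + l < m"
        using walk_descent[OF assms(1), of m a "-1" y] walk_step(4) 2 by auto
      then show ?thesis
        using walk_step 2 less.IH[of k a b] less.IH[of l c y] bal_up[of E x a b c] bal_trans[of E x c y] by auto
    next
      case 3
      obtain b c k l where "walk E k a 0 b" "E 1 b c" "walk E l c 0 y" "k + l < m"
        using walk_ascent[OF assms(1), of m a 1 y] walk_step(4) 3 by auto
      then show ?thesis
        using walk_step 3 less.IH[of k a b] less.IH[of l c y] bal_down[of E x a b c] bal_trans[of E x c y] by auto
    qed
  qed
qed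

text \<open>Go round forever on the closed walk from a through b back to a.\<close>

lemma lasso:
  assumes "R\<^sup>+\<^sup>+ a b" "R\<^sup>+\<^sup>+ b a"
  shows "\<exists>f. f 0 = a \<and> (\<forall>i. R (f i) (f (Suc i))) \<and> (\<exists>\<^sub>\<infinity>i. f i = a) \<and> (\<exists>\<^sub>\<infinity>i. f i = b)"
proof -
  obtain n g where g: "0 < n" "g 0 = a" "g n = b" "\<And>i. i < n \<Longrightarrow> R (g i) (g (Suc i))"
    using assms(1) unfolding tranclp_power relpowp_fun_conv by blast
  obtain m h where h: "0 < m" "h 0 = b" "h m = a" "\<And>i. i < m \<Longrightarrow> R (h i) (h (Suc i))"
    using assms(2) unfolding tranclp_power relpowp_fun_conv by blast
  define k where "k i = (if i < n then g i else h (i - n))" for i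
  have k: "k 0 = a" "k n = b" "k (n + m) = a" using g h by (auto simp: k_def)
  have kR: "R (k i) (k (Suc i))" if "i < n + m" for i
  proof -
    consider "Suc i < n" | "Suc i = n" | "n \<le> i" by linarith
    then show ?thesis
      by cases (use that g h g(4)[of i] h(4)[of "i - n"] in \<open>auto simp: k_def Suc_diff_le\<close>)
  qed
  define f where "f i = k (i mod (n + m))" for i
  have "R (f i) (f (Suc i))" for i
    using kR[of "i mod (n + m)"] g(1) k by (auto simp: f_def mod_Suc)
  moreover have lt: "i < Suc i * (n + m)" for i
  proof -
    have "Suc i * 1 \<le> Suc i * (n + m)" using g(1) by (intro mult_le_mono2) simp
    show ?thesis by (rule less_le_trans[OF _ \<open>Suc i * 1 \<le> Suc i * (n + m)\<close>]) simp
  qed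
  have "\<exists>j>i. f j = a" for i
    using lt k by (intro exI[of _ "Suc i * (n + m)"]) (auto simp: f_def simp del: mult_Suc)
  moreover have "\<exists>j>i. f j = b" for i
    using trans_less_add1[OF lt] h(1) k
    by (intro exI[of _ "Suc i * (n + m) + n"]) (auto simp: f_def simp del: mult_Suc)
  ultimately show ?thesis
    using k by (intro exI[of _ f]) (auto simp: f_def INFM_nat)
qed

subsection \<open>Runs of test-free transducers\<close>

fun src :: "('a, 'b, 'q, 'r) transition \<Rightarrow> 'q" where "src (q, \<sigma>, \<phi>, A, os, q') = q"
fun lab :: "('a, 'b, 'q, 'r) transition \<Rightarrow> 'a" where "lab (q, \<sigma>, \<phi>, A, os, q') = \<sigma>"
fun asg :: "('a, 'b, 'q, 'r) transition \<Rightarrow> 'r set" where "asg (q, \<sigma>, \<phi>, A, os, q') = A"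
fun out :: "('a, 'b, 'q, 'r) transition \<Rightarrow> ('b \<times> 'r) list" where "out (q, \<sigma>, \<phi>, A, os, q') = os"
fun tgt :: "('a, 'b, 'q, 'r) transition \<Rightarrow> 'q" where "tgt (q, \<sigma>, \<phi>, A, os, q') = q'"

text \<open>The output before time k with registers in place of data values, hence the same for all
  data read by the run.\<close>

definition outs :: "(nat \<Rightarrow> ('a, 'b, 'q, 'r) transition) \<Rightarrow> nat \<Rightarrow> ('b \<times> 'r) list" where
  "outs A k = concat (map (out \<circ> A) [0..<k])"

lemma outs_0 [simp]: "outs A 0 = []"
  by (simp add: outs_def)

lemma outs_Suc [simp]: "outs A (Suc k) = outs A k @ out (A k)"
  by (simp add: outs_def)

lemma outs_mono: "i \<le> j \<Longrightarrow> \<exists>xs. outs A j = outs A i @ xs"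
  by (induction rule: dec_induct) auto

lemma length_outs_mono: "i \<le> j \<Longrightarrow> length (outs A i) \<le> length (outs A j)"
  using outs_mono[of i j A] by auto

lemma length_outs_less: "length (outs A i) \<le> n \<Longrightarrow> n < length (outs A j) \<Longrightarrow> i < j"
  using length_outs_mono[of j i A] by (meson leD le_trans not_le)

lemma nth_outs: "n < length (outs A i) \<Longrightarrow> n < length (outs A j) \<Longrightarrow> outs A i ! n = outs A j ! n"
  using outs_mono[of i j A] outs_mono[of j i A] by (metis nat_le_linear nth_append)

lemma outs_cong: "(\<And>i. i < k \<Longrightarrow> A i = A' i) \<Longrightarrow> outs A k = outs A' k"
  by (induction k) auto

lemma time_of_output:
  "n < length (outs A k) \<Longrightarrow> \<exists>t<k. length (outs A t) \<le> n \<and> n < length (outs A (Suc t))"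
  by (induction k) (auto, metis less_SucI linorder_not_le less_Suc_eq)

text \<open>The time at which the content of the register was read, \<open>None\<close> for the
  initial value. Time \<open>Suc k\<close> includes the assignments of transition k, since a
  transition outputs from the updated registers.\<close>

primrec origin :: "(nat \<Rightarrow> ('a, 'b, 'q, 'r) transition) \<Rightarrow> nat \<Rightarrow> 'r \<Rightarrow> nat option" where
  "origin A 0 = (\<lambda>_. None)"
| "origin A (Suc k) = (\<lambda>r. if r \<in> asg (A k) then Some k else origin A k r)"

definition val :: "'d \<Rightarrow> (nat \<Rightarrow> ('a, 'b, 'q, 'r) transition) \<Rightarrow> (nat \<Rightarrow> 'd) \<Rightarrow> nat \<Rightarrow> 'r \<Rightarrow> 'd" where
  "val d0 A d k r = (case origin A k r of None \<Rightarrow> d0 | Some i \<Rightarrow> d i)"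

lemma origin_Some: "origin A k r = Some s \<Longrightarrow> s < k \<and> r \<in> asg (A s) \<and> (\<forall>j. s < j \<and> j < k \<longrightarrow> r \<notin> asg (A j))"
  by (induction k) (auto split: if_splits simp: less_Suc_eq)

lemma origin_None: "origin A k r = None \<Longrightarrow> j < k \<Longrightarrow> r \<notin> asg (A j)"
  by (induction k) (auto split: if_splits simp: less_Suc_eq)

lemma origin_ge: "r \<in> asg (A s) \<Longrightarrow> s < k \<Longrightarrow> \<exists>i\<ge>s. origin A k r = Some i"
  by (induction k) (auto simp: less_Suc_eq)

definition outputs :: "'d \<Rightarrow> (nat \<Rightarrow> ('a, 'b, 'q, 'r) transition) \<Rightarrow> (nat \<Rightarrow> 'd) \<Rightarrow> nat \<Rightarrow> ('b \<times> 'd) list" where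
  "outputs d0 A d i = map (\<lambda>(\<gamma>, r). (\<gamma>, val d0 A d (Suc i) r)) (out (A i))"

lemma concat_omega_eq:
  assumes "n < length (concat (map vs [0..<k]))"
  shows "concat_omega vs n = Some (concat (map vs [0..<k]) ! n)"
proof -
  define m where "m = (LEAST m. n < length (concat (map vs [0..<m])))"
  have m: "n < length (concat (map vs [0..<m]))" "m \<le> k"
    unfolding m_def using assms by (auto intro: LeastI Least_le)
  have "[0..<k] = [0..<m] @ [m..<k]" using m(2) by (metis le_add_diff_inverse upt_add_eq_append zero_le)
  then have "concat (map vs [0..<k]) ! n = concat (map vs [0..<m]) ! n"
    using m(1) by (simp add: nth_append)
  then show ?thesis using assms unfolding concat_omega_def m_def[symmetric] by auto
qed

lemma concat_omega_outputs:
  assumes "n < length (outs A k)"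
  obtains t where "t < k" "length (outs A t) \<le> n" "n < length (outs A (Suc t))"
    "concat_omega (outputs d0 A d) n =
       Some (fst (outs A k ! n), val d0 A d (Suc t) (snd (outs A k ! n)))"
proof -
  obtain t where t: "t < k" "length (outs A t) \<le> n" "n < length (outs A (Suc t))"
    using time_of_output[OF assms] by blast
  have len: "length (concat (map (outputs d0 A d) [0..<j])) = length (outs A j)" for j
    by (induction j) (auto simp: outputs_def)
  have "concat_omega (outputs d0 A d) n = Some (concat (map (outputs d0 A d) [0..<Suc t]) ! n)"
    by (rule concat_omega_eq) (use t len[of "Suc t"] in simp)
  also have "concat (map (outputs d0 A d) [0..<Suc t]) ! n = outputs d0 A d t ! (n - length (outs A t))"
    using t len[of t] by (simp add: nth_append)
  also have "\<dots> = (fst (outs A (Suc t) ! n), val d0 A d (Suc t) (snd (outs A (Suc t) ! n)))"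
    using t by (auto simp: outputs_def nth_append split: prod.split)
  also have "outs A (Suc t) ! n = outs A k ! n"
    using t assms nth_outs by blast
  finally show ?thesis using that t by blast
qed

section \<open>Runs as sequences of transitions\<close>

primrec cur :: "('a, 'b, 'q, 'r) nrt \<Rightarrow> (nat \<Rightarrow> ('a, 'b, 'q, 'r) transition) \<Rightarrow> nat \<Rightarrow> 'q" where
  "cur T A 0 = initial T"
| "cur T A (Suc i) = tgt (A i)"

definition path :: "('a, 'b, 'q, 'r) nrt \<Rightarrow> (nat \<Rightarrow> ('a, 'b, 'q, 'r) transition) \<Rightarrow> nat \<Rightarrow> bool" where
  "path T A k \<longleftrightarrow> (\<forall>i<k. A i \<in> transitions T \<and> src (A i) = cur T A i)"

definition accepting_path :: "('a, 'b, 'q, 'r) nrt \<Rightarrow> (nat \<Rightarrow> ('a, 'b, 'q, 'r) transition) \<Rightarrow> bool" where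
  "accepting_path T A \<longleftrightarrow> (\<forall>k. path T A k) \<and> (\<exists>\<^sub>\<infinity>i. cur T A i \<in> accepting T)"

lemma accepting_run_path:
  assumes "accepting_path T A" "test_free T"
  shows "accepting_run d0 T (\<lambda>i. (lab (A i), d i)) (\<lambda>i. (cur T A i, val d0 A d i)) (outputs d0 A d)"
proof -
  have "nrt_step T (cur T A i, val d0 A d i) (lab (A i), d i) (outputs d0 A d i) (cur T A (Suc i), val d0 A d (Suc i))" for i
  proof -
    obtain q \<sigma> \<phi> B os q' where A: "A i = (q, \<sigma>, \<phi>, B, os, q')" by (cases "A i") auto
    have t: "A i \<in> transitions T" "src (A i) = cur T A i"
      using assms(1) by (auto simp: accepting_path_def path_def)
    then have "\<phi> = TTop" using assms(2) A by (auto simp: test_free_def)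
    then show ?thesis
      using t A unfolding nrt_step_def
      by (auto simp: val_def outputs_def fun_eq_iff intro!: exI[of _ \<phi>] exI[of _ B] exI[of _ os])
  qed
  then show ?thesis using assms(1) by (auto simp: accepting_run_def accepting_path_def val_def)
qed

lemma accepting_run_obtain_path:
  assumes "accepting_run d0 T u \<rho> vs"
  obtains A where "accepting_path T A" "\<And>i. fst (u i) = lab (A i)" "vs = outputs d0 A (snd \<circ> u)"
proof -
  have st: "nrt_step T (\<rho> i) (u i) (vs i) (\<rho> (Suc i))" for i using assms by (auto simp: accepting_run_def)
  define G where "G i t \<longleftrightarrow> t \<in> transitions T \<and> src t = fst (\<rho> i) \<and> tgt t = fst (\<rho> (Suc i)) \<and> lab t = fst (u i) \<and>
      snd (\<rho> (Suc i)) = (\<lambda>r. if r \<in> asg t then snd (u i) else snd (\<rho> i) r) \<and>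
      vs i = map (\<lambda>(\<gamma>, r). (\<gamma>, snd (\<rho> (Suc i)) r)) (out t)" for i t
  have "\<exists>t. G i t" for i
    using st[of i] unfolding nrt_step_def G_def
    by (cases "\<rho> i"; cases "\<rho> (Suc i)"; cases "u i") fastforce
  then obtain A where "\<And>i. G i (A i)" by metis
  then have A: "\<And>i. A i \<in> transitions T" "\<And>i. src (A i) = fst (\<rho> i)" "\<And>i. tgt (A i) = fst (\<rho> (Suc i))"
    "\<And>i. lab (A i) = fst (u i)"
    "\<And>i. snd (\<rho> (Suc i)) = (\<lambda>r. if r \<in> asg (A i) then snd (u i) else snd (\<rho> i) r)"
    "\<And>i. vs i = map (\<lambda>(\<gamma>, r). (\<gamma>, snd (\<rho> (Suc i)) r)) (out (A i))"
    unfolding G_def by blast+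
  have \<rho>0: "\<rho> 0 = (initial T, \<lambda>_. d0)" using assms by (auto simp: accepting_run_def)
  have cur: "cur T A i = fst (\<rho> i)" for i using \<rho>0 A by (cases i) auto
  have val: "val d0 A (snd \<circ> u) i = snd (\<rho> i)" for i
    by (induction i) (auto simp: \<rho>0 A(5) val_def fun_eq_iff)
  show ?thesis
  proof (rule that)
    show "accepting_path T A"
      using assms A by (auto simp: accepting_path_def path_def cur accepting_run_def)
    show "vs = outputs d0 A (snd \<circ> u)" using A(6) by (auto simp: outputs_def val fun_eq_iff)
  qed (simp add: A)
qed

text \<open>The second alternative says that the data value of the cell of \<open>B\<close> was read at time \<open>s\<close> or later, and
  that of the cell of \<open>A\<close> before. Only the times \<open>j\<close> up to the emission of the cell satisfy
  \<open>length (outs A j) \<le> n\<close>.\<close>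

definition conflict :: "(nat \<Rightarrow> ('a, 'b, 'q, 'r) transition) \<Rightarrow> (nat \<Rightarrow> ('a, 'b, 'q, 'r) transition) \<Rightarrow>
    nat \<Rightarrow> nat \<Rightarrow> bool" where
  "conflict A B k n \<longleftrightarrow> n < length (outs A k) \<and> n < length (outs B k) \<and>
     (fst (outs A k ! n) \<noteq> fst (outs B k ! n) \<or>
      (\<exists>s. snd (outs B k ! n) \<in> asg (B s) \<and> length (outs B s) \<le> n \<and>
         (\<forall>j\<ge>s. length (outs A j) \<le> n \<longrightarrow> snd (outs A k ! n) \<notin> asg (A j))))"

definition conflicting :: "('a, 'b, 'q, 'r) nrt \<Rightarrow> bool" where
  "conflicting T \<longleftrightarrow> (\<exists>A B k n. accepting_path T A \<and> accepting_path T B \<and> (\<forall>i. lab (A i) = lab (B i)) \<and>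
     conflict A B k n)"

lemma conflicting_not_functional:
  fixes d0 :: 'd
  assumes inf: "infinite (UNIV :: 'd set)" and T: "test_free T" and c: "conflicting T"
  shows "\<not> functional d0 T"
proof
  assume f: "functional d0 T"
  obtain A B k n where AB: "accepting_path T A" "accepting_path T B" "\<And>i. lab (A i) = lab (B i)" "conflict A B k n"
    using c by (auto simp: conflicting_def)
  \<comment> \<open>The values are pairwise distinct and avoid \<open>d0\<close>, so an output value
    determines its origin, even if this is \<open>None\<close>.\<close>
  have "infinite (UNIV - {d0})" using inf by simp
  then obtain d :: "nat \<Rightarrow> 'd" where d: "inj d" "d0 \<notin> range d"
    using infinite_countable_subset[of "UNIV - {d0}"] by auto
  have "(\<lambda>i. (lab (A i), d i), concat_omega (outputs d0 A d)) \<in> transduction d0 T"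
    "(\<lambda>i. (lab (A i), d i), concat_omega (outputs d0 B d)) \<in> transduction d0 T"
    using accepting_run_path[OF AB(1) T, of d0 d] accepting_run_path[OF AB(2) T, of d0 d] AB(3)
    unfolding transduction_def by auto
  then have eq: "concat_omega (outputs d0 A d) = concat_omega (outputs d0 B d)"
    using f by (auto simp: functional_def single_valued_def)
  have n: "n < length (outs A k)" "n < length (outs B k)" using AB(4) by (auto simp: conflict_def)
  obtain t where t: "length (outs A t) \<le> n" "n < length (outs A (Suc t))" "concat_omega (outputs d0 A d) n =
       Some (fst (outs A k ! n), val d0 A d (Suc t) (snd (outs A k ! n)))"
    using concat_omega_outputs[OF n(1)] by metis
  obtain t' where t': "length (outs B t') \<le> n" "n < length (outs B (Suc t'))" "concat_omega (outputs d0 B d) n =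
       Some (fst (outs B k ! n), val d0 B d (Suc t') (snd (outs B k ! n)))"
    using concat_omega_outputs[OF n(2)] by metis
  define r r' where "r = snd (outs A k ! n)" and "r' = snd (outs B k ! n)"
  have letters: "fst (outs A k ! n) = fst (outs B k ! n)" and vals: "val d0 A d (Suc t) r = val d0 B d (Suc t') r'"
    using eq t(3) t'(3) by (auto simp: r_def r'_def)
  from letters AB(4) obtain s where s: "r' \<in> asg (B s)" "length (outs B s) \<le> n"
    "\<And>j. j \<ge> s \<Longrightarrow> length (outs A j) \<le> n \<Longrightarrow> r \<notin> asg (A j)"
    by (auto simp: conflict_def r_def r'_def)
  have "s < Suc t'" using length_outs_less[OF s(2) t'(2)] .
  then obtain i where i: "i \<ge> s" "origin B (Suc t') r' = Some i" using origin_ge[of r' B s "Suc t'"] s by blast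
  have vB: "val d0 B d (Suc t') r' = d i" unfolding val_def i(2) by simp
  show False
  proof (cases "origin A (Suc t) r")
    case None
    then have "val d0 A d (Suc t) r = d0" by (simp only: val_def option.case)
    then show False using d(2) vals vB by auto
  next
    case (Some i')
    then have "val d0 A d (Suc t) r = d i'" by (simp only: val_def option.case)
    then have "i' = i" using d(1) vals vB by (auto dest: injD)
    then have "r \<in> asg (A i)" "i \<le> t" using origin_Some[OF Some] by auto
    then show False using s(3)[OF i(1)] length_outs_mono[of i t A] t(1) by linarith
  qed
qed

text \<open>The origin of the value in the cell of B serves as the time s of the conflict.\<close>

lemma conflictI:
  assumes n: "n < length (outs A k)" "n < length (outs B k)"
    and t: "length (outs A t) \<le> n" "n < length (outs A (Suc t))"
    and t': "length (outs B t') \<le> n" "n < length (outs B (Suc t'))"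
    and o: "origin B (Suc t') (snd (outs B k ! n)) = Some s"
      "\<And>i. origin A (Suc t) (snd (outs A k ! n)) = Some i \<Longrightarrow> i < s"
  shows "conflict A B k n"
proof -
  have s: "s < Suc t'" "snd (outs B k ! n) \<in> asg (B s)" using origin_Some[OF o(1)] by auto
  have "snd (outs A k ! n) \<notin> asg (A j)" if "j \<ge> s" "length (outs A j) \<le> n" for j
  proof -
    have "j < Suc t" using length_outs_less[OF that(2) t(2)] .
    then show ?thesis
    proof (cases "origin A (Suc t) (snd (outs A k ! n))")
      case None
      then show ?thesis using origin_None \<open>j < Suc t\<close> by metis
    next
      case (Some i)
      then show ?thesis using o(2)[OF Some] origin_Some[OF Some] \<open>j < Suc t\<close> that(1) by auto
    qed
  qed
  moreover have "length (outs B s) \<le> n" using length_outs_mono[of s t' B] s t' by linarith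
  ultimately show ?thesis using n s by (auto simp: conflict_def)
qed

lemma not_functional_conflicting:
  fixes T :: "('a, 'b, 'q, 'r) nrt"
  assumes inf: "infinite_outputs d0 T" and nf: "\<not> functional d0 T"
  shows "conflicting T"
proof -
  obtain u vs vs' \<rho> \<rho>' where r: "accepting_run d0 T u \<rho> vs" "accepting_run d0 T u \<rho>' vs'"
    "concat_omega vs \<noteq> concat_omega vs'"
    using nf by (auto simp: functional_def single_valued_def transduction_def)
  obtain A where A: "accepting_path T A" "\<And>i. fst (u i) = lab (A i)" "vs = outputs d0 A (snd \<circ> u)"
    using accepting_run_obtain_path[OF r(1)] by metis
  obtain B where B: "accepting_path T B" "\<And>i. fst (u i) = lab (B i)" "vs' = outputs d0 B (snd \<circ> u)"
    using accepting_run_obtain_path[OF r(2)] by metis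
  \<comment> \<open>Infinitely many nonempty outputs make the output longer than any n, so a
    difference of the two output words is one between actual cells.\<close>
  have long: "\<exists>k. n < length (outs A k)" if "accepting_run d0 T u \<rho> (outputs d0 A (snd \<circ> u))"
    for \<rho> n and A :: "nat \<Rightarrow> ('a, 'b, 'q, 'r) transition"
  proof (induction n)
    case 0
    have "\<exists>\<^sub>\<infinity>i. outputs d0 A (snd \<circ> u) i \<noteq> []"
      using inf that unfolding infinite_outputs_def by blast
    then obtain i where "outputs d0 A (snd \<circ> u) i \<noteq> []" by (auto simp: INFM_nat)
    then show ?case by (intro exI[of _ "Suc i"]) (auto simp: outputs_def)
  next
    case (Suc n)
    then obtain k where k: "n < length (outs A k)" by blast
    have "\<exists>\<^sub>\<infinity>i. outputs d0 A (snd \<circ> u) i \<noteq> []"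
      using inf that unfolding infinite_outputs_def by blast
    then obtain i where i: "i > k" "outputs d0 A (snd \<circ> u) i \<noteq> []" by (auto simp: INFM_nat)
    then have "out (A i) \<noteq> []" by (auto simp: outputs_def)
    then have "length (outs A (Suc i)) > length (outs A i)" by simp
    then show ?case using length_outs_mono[of k i A] k i by (intro exI[of _ "Suc i"]) linarith
  qed
  obtain n where n: "concat_omega vs n \<noteq> concat_omega vs' n" using r(3) by blast
  obtain k1 k2 where "n < length (outs A k1)" "n < length (outs B k2)" using long r A(3) B(3) by metis
  then obtain k where k: "n < length (outs A k)" "n < length (outs B k)"
    using length_outs_mono[of k1 "max k1 k2" A] length_outs_mono[of k2 "max k1 k2" B]
    by (metis less_le_trans max.cobounded1 max.cobounded2)
  obtain t where t: "length (outs A t) \<le> n" "n < length (outs A (Suc t))" "concat_omega vs n =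
       Some (fst (outs A k ! n), val d0 A (snd \<circ> u) (Suc t) (snd (outs A k ! n)))"
    using concat_omega_outputs[OF k(1)] A(3) by metis
  obtain t' where t': "length (outs B t') \<le> n" "n < length (outs B (Suc t'))" "concat_omega vs' n =
       Some (fst (outs B k ! n), val d0 B (snd \<circ> u) (Suc t') (snd (outs B k ! n)))"
    using concat_omega_outputs[OF k(2)] B(3) by metis
  let ?o = "origin A (Suc t) (snd (outs A k ! n))" and ?o' = "origin B (Suc t') (snd (outs B k ! n))"
  \<comment> \<open>If the letters agree, the origins differ; the run with the later origin takes
    the role of B, and \<open>None\<close> is earlier than all times.\<close>
  have "conflict A B k n \<or> conflict B A k n"
  proof (cases "fst (outs A k ! n) = fst (outs B k ! n)")
    case True
    then have "?o \<noteq> ?o'" using n t(3) t'(3) unfolding val_def by auto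
    then consider s where "?o' = Some s" "\<And>i. ?o = Some i \<Longrightarrow> i < s" | s where "?o = Some s" "\<And>i. ?o' = Some i \<Longrightarrow> i < s"
      by (cases ?o; cases ?o') (auto, metis linorder_neqE_nat)
    then show ?thesis
      by cases (use conflictI[OF k t(1,2) t'(1,2)] conflictI[OF k(2,1) t'(1,2) t(1,2)] in blast)+
  qed (use k in \<open>auto simp: conflict_def\<close>)
  moreover have "lab (A i) = lab (B i)" for i using A(2) B(2) by metis
  ultimately show ?thesis using A(1) B(1) unfolding conflicting_def by metis
qed

subsection \<open>The counter graph\<close>

text \<open>A node consists of a mode \<open>e\<close>, of flags telling whether the conflicting cell of the first and of the
  second run have been passed, and for each run of the output still to be emitted and the target
  state of the current transition. In mode 2 the letters of the two cells differ; in mode 0 the time \<open>s\<close>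
  of a conflict has not come yet, in mode 1 it has. The weight of an edge is the change of the difference of the
  numbers of cells emitted before the conflicting ones. The parameters \<open>v1\<close> and \<open>v2\<close> are codes of letters
  in mode 2, and codes of registers otherwise.\<close>

type_synonym ('b, 'q, 'r) side = "('b \<times> 'r) list \<times> 'q"
type_synonym ('b, 'q, 'r) node = "nat \<times> nat \<times> nat \<times> ('b, 'q, 'r) side \<times> ('b, 'q, 'r) side"

locale coded_nrt =
  fixes T :: "('a, 'b, 'q, 'r) nrt" and cg :: "'b \<Rightarrow> 'v" and cr :: "'r \<Rightarrow> 'v"
  assumes nrt: "is_nrt T" and inj_cg: "inj cg" and inj_cr: "inj cr"
begin

definition sel :: "nat \<Rightarrow> 'b \<times> 'r \<Rightarrow> 'v" where
  "sel e c = (if e = 2 then cg (fst c) else cr (snd c))"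

definition has_reg :: "'v \<Rightarrow> 'r set \<Rightarrow> bool" where
  "has_reg v A \<longleftrightarrow> v \<in> cr ` A"

text \<open>Mode 0 turns into 1 at the guessed time s, where the second run must assign the register
  of its cell. From then on the first run must not assign the register of its own cell unless that
  cell has been passed. The flag is the one before the transition: assignments come before outputs,
  so one made by the emitting transition still counts.\<close>

definition admissible :: "'v \<Rightarrow> 'v \<Rightarrow> nat \<Rightarrow> nat \<Rightarrow> nat \<Rightarrow> 'r set \<Rightarrow> 'r set \<Rightarrow> bool" where
  "admissible v1 v2 e m1 e' A1 A2 \<longleftrightarrow> e = 0 \<and> e' = 0 \<or> e = 2 \<and> e' = 2 \<or>
     e' = 1 \<and> (m1 = 1 \<or> \<not> has_reg v1 A1) \<and> (e = 1 \<or> e = 0 \<and> has_reg v2 A2)"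

inductive pstep :: "'v \<Rightarrow> 'v \<Rightarrow> ('b, 'q, 'r) node \<Rightarrow> ('b, 'q, 'r) node \<Rightarrow> bool" for v1 v2 where
  pstep: "t1 \<in> transitions T \<Longrightarrow> t2 \<in> transitions T \<Longrightarrow> lab t1 = lab t2 \<Longrightarrow>
    admissible v1 v2 e m1 e' (asg t1) (asg t2) \<Longrightarrow>
    pstep v1 v2 (e, m1, m2, ([], src t1), ([], src t2)) (e', m1, m2, (out t1, tgt t1), (out t2, tgt t2))"

text \<open>Marking leaves the cell in place, so weights count the cells strictly before the marked
  ones, and total weight 0 means equal positions. The second cell cannot be marked in mode 0, since
  s must not come after its emission; the first one may be emitted before s.\<close>

inductive edge :: "'v \<Rightarrow> 'v \<Rightarrow> int \<Rightarrow> ('b, 'q, 'r) node \<Rightarrow> ('b, 'q, 'r) node \<Rightarrow> bool" for v1 v2 where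
  emit1: "edge v1 v2 1 (e, 0, m2, (c # os, q), Y) (e, 0, m2, (os, q), Y)"
| emit2: "edge v1 v2 (- 1) (e, m1, 0, X, (c # os, q)) (e, m1, 0, X, (os, q))"
| skip1: "edge v1 v2 0 (e, 1, m2, (c # os, q), Y) (e, 1, m2, (os, q), Y)"
| skip2: "edge v1 v2 0 (e, m1, 1, X, (c # os, q)) (e, m1, 1, X, (os, q))"
| mark1: "sel e c = v1 \<Longrightarrow> edge v1 v2 0 (e, 0, m2, (c # os, q), Y) (e, 1, m2, (c # os, q), Y)"
| mark2: "sel e c = v2 \<Longrightarrow> e = 1 \<or> e = 2 \<Longrightarrow> edge v1 v2 0 (e, m1, 0, X, (c # os, q)) (e, m1, 1, X, (c # os, q))"
| step: "pstep v1 v2 x y \<Longrightarrow> edge v1 v2 0 x y"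

definition start :: "nat \<Rightarrow> ('b, 'q, 'r) node" where
  "start e = (e, 0, 0, ([], initial T), ([], initial T))"

definition final :: "nat \<Rightarrow> 'q \<Rightarrow> 'q \<Rightarrow> ('b, 'q, 'r) node" where
  "final e q1 q2 = (e, 1, 1, ([], q1), ([], q2))"

text \<open>The first run accepts at q1 and the second at p2, because they need not accept at the
  same time. The explicit \<open>pstep\<close> in each half makes the loop consume input. V limits
  the guesses of v1 and v2 to values that can be found in the code.\<close>

definition has_lasso :: "'v set \<Rightarrow> bool" where
  "has_lasso V \<longleftrightarrow> (\<exists>v1 v2 e0 e q1 q2 p1 p2 a b. v1 \<in> V \<and> v2 \<in> V \<and> (e0 = 0 \<or> e0 = 2 \<and> v1 \<noteq> v2) \<and>
     balanced (edge v1 v2) (start e0) (final e q1 q2) \<and> q1 \<in> accepting T \<and>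
     pstep v1 v2 (final e q1 q2) a \<and> balanced (edge v1 v2) a (final e p1 p2) \<and> p2 \<in> accepting T \<and>
     pstep v1 v2 (final e p1 p2) b \<and> balanced (edge v1 v2) b (final e q1 q2))"

lemma edge_weights: "\<forall>z x y. edge v1 v2 z x y \<longrightarrow> z \<in> {-1, 0, 1}"
  by (auto elim: edge.cases)

subsection \<open>From lassos to conflicts\<close>

text \<open>The invariant along a walk: A and B are histories of k transitions leading to the node;
  n1 and n2 count the emitted cells until a cell is marked and are its position from then on. The
  bound on \<open>length (outs B j)\<close> serves the edge \<open>mark2\<close>, where it shows
  that time s is no later than the emission of the marked cell.\<close>

definition hist :: "'v \<Rightarrow> 'v \<Rightarrow> nat \<Rightarrow> (nat \<Rightarrow> ('a, 'b, 'q, 'r) transition) \<Rightarrow> (nat \<Rightarrow> ('a, 'b, 'q, 'r) transition) \<Rightarrow>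
    nat \<Rightarrow> nat \<Rightarrow> nat \<Rightarrow> ('b, 'q, 'r) node \<Rightarrow> bool" where
  "hist v1 v2 e0 A B k n1 n2 = (\<lambda>(e, m1, m2, (os1, q1), (os2, q2)).
     path T A k \<and> path T B k \<and> (\<forall>i<k. lab (A i) = lab (B i)) \<and> q1 = cur T A k \<and> q2 = cur T B k \<and>
     (\<exists>p1 p2. outs A k = p1 @ os1 \<and> outs B k = p2 @ os2 \<and> (\<forall>j<k. length (outs B j) \<le> length p2) \<and>
       (m1 = 0 \<and> n1 = length p1 \<or> m1 = 1 \<and> n1 < length (outs A k) \<and> sel e (outs A k ! n1) = v1) \<and>
       (m2 = 0 \<and> n2 = length p2 \<or> m2 = 1 \<and> n2 < length (outs B k) \<and> sel e (outs B k ! n2) = v2 \<and> e \<noteq> 0)) \<and>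
     (e = 0 \<or> e = 1 \<or> e = 2) \<and> (e = 2 \<longleftrightarrow> e0 = 2) \<and>
     (e = 1 \<longrightarrow> (\<exists>s<k. has_reg v2 (asg (B s)) \<and> (m2 = 1 \<longrightarrow> length (outs B s) \<le> n2) \<and>
        (\<forall>j. s \<le> j \<and> j < k \<and> (m1 = 1 \<longrightarrow> length (outs A j) \<le> n1) \<longrightarrow> \<not> has_reg v1 (asg (A j))))))"

lemma cur_upd: "i \<le> k \<Longrightarrow> cur T (A(k := t)) i = cur T A i"
  by (cases i) auto

lemma outs_upd: "i \<le> k \<Longrightarrow> outs (A(k := t)) i = outs A i"
  by (rule outs_cong) auto

lemma path_upd: "path T A k \<Longrightarrow> t \<in> transitions T \<Longrightarrow> src t = cur T A k \<Longrightarrow> path T (A(k := t)) (Suc k)"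
  by (auto simp: path_def cur_upd less_Suc_eq)

lemma hist_pstep:
  assumes h: "hist v1 v2 e0 A B k n1 n2 x" and st: "pstep v1 v2 x y"
  shows "\<exists>A B. hist v1 v2 e0 A B (Suc k) n1 n2 y"
  using st
proof cases
  case (pstep t1 t2 e m1 e' m2)
  let ?A = "A(k := t1)" and ?B = "B(k := t2)"
  note h = h[unfolded pstep(1) hist_def prod.case]
  \<comment> \<open>Once its cell is marked, the first run is unconstrained at time k, since its
    output before k already contains position n1.\<close>
  have lenA: "m1 = 1 \<longrightarrow> \<not> length (outs A k) \<le> n1" using h by auto
  have e': "e' = 0 \<or> e' = 1 \<or> e' = 2" "e' = 2 \<longleftrightarrow> e0 = 2" "e' = 0 \<longrightarrow> e = 0" "e' = 2 \<longleftrightarrow> e = 2"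
    using pstep(6) h by (auto simp: admissible_def)
  have sel: "sel e' c = sel e c" for c using e'(4) by (simp add: sel_def)
  have ex: "e' = 1 \<longrightarrow> (\<exists>s<Suc k. has_reg v2 (asg (?B s)) \<and> (m2 = 1 \<longrightarrow> length (outs ?B s) \<le> n2) \<and>
        (\<forall>j. s \<le> j \<and> j < Suc k \<and> (m1 = 1 \<longrightarrow> length (outs ?A j) \<le> n1) \<longrightarrow> \<not> has_reg v1 (asg (?A j))))"
  proof
    assume e': "e' = 1"
    have v1: "m1 = 1 \<or> \<not> has_reg v1 (asg t1)" using pstep(6) e' by (auto simp: admissible_def)
    consider "e = 1" | "e = 0" "has_reg v2 (asg t2)" using pstep(6) e' by (auto simp: admissible_def)
    then show "\<exists>s<Suc k. has_reg v2 (asg (?B s)) \<and> (m2 = 1 \<longrightarrow> length (outs ?B s) \<le> n2) \<and>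
        (\<forall>j. s \<le> j \<and> j < Suc k \<and> (m1 = 1 \<longrightarrow> length (outs ?A j) \<le> n1) \<longrightarrow> \<not> has_reg v1 (asg (?A j)))"
    proof cases
      case 1
      then obtain s where s: "s < k" "has_reg v2 (asg (B s))" "m2 = 1 \<longrightarrow> length (outs B s) \<le> n2"
        "\<And>j. s \<le> j \<Longrightarrow> j < k \<Longrightarrow> (m1 = 1 \<longrightarrow> length (outs A j) \<le> n1) \<Longrightarrow> \<not> has_reg v1 (asg (A j))"
        using h by blast
      then show ?thesis using v1 lenA by (intro exI[of _ s]) (auto simp: outs_upd less_Suc_eq)
    next
      case 2
      then have "m2 \<noteq> 1" using h by auto
      then show ?thesis using v1 lenA 2 by (intro exI[of _ k]) (auto simp: outs_upd less_Suc_eq)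
    qed
  qed
  have paths: "path T ?A (Suc k)" "path T ?B (Suc k)" using h pstep(3,4) by (auto intro: path_upd)
  have labs: "\<forall>i<Suc k. lab (?A i) = lab (?B i)" using h pstep(5) by (auto simp: less_Suc_eq)
  have curs: "tgt t1 = cur T ?A (Suc k)" "tgt t2 = cur T ?B (Suc k)" by simp_all
  have "outs ?A (Suc k) = outs A k @ out t1" "outs ?B (Suc k) = outs B k @ out t2" by (simp_all add: outs_upd)
  moreover have "\<forall>j<Suc k. length (outs ?B j) \<le> length (outs B k)"
    by (auto simp: outs_upd less_Suc_eq intro: length_outs_mono)
  moreover have "m1 = 0 \<and> n1 = length (outs A k) \<or>
      m1 = 1 \<and> n1 < length (outs ?A (Suc k)) \<and> sel e' (outs ?A (Suc k) ! n1) = v1"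
    using h by (auto simp: outs_upd nth_append sel)
  moreover have "m2 = 0 \<and> n2 = length (outs B k) \<or>
      m2 = 1 \<and> n2 < length (outs ?B (Suc k)) \<and> sel e' (outs ?B (Suc k) ! n2) = v2 \<and> e' \<noteq> 0"
    using h e'(3) by (auto simp: outs_upd nth_append sel)
  ultimately have "\<exists>p1 p2. outs ?A (Suc k) = p1 @ out t1 \<and> outs ?B (Suc k) = p2 @ out t2 \<and>
      (\<forall>j<Suc k. length (outs ?B j) \<le> length p2) \<and>
      (m1 = 0 \<and> n1 = length p1 \<or> m1 = 1 \<and> n1 < length (outs ?A (Suc k)) \<and> sel e' (outs ?A (Suc k) ! n1) = v1) \<and>
      (m2 = 0 \<and> n2 = length p2 \<or> m2 = 1 \<and> n2 < length (outs ?B (Suc k)) \<and> sel e' (outs ?B (Suc k) ! n2) = v2 \<and> e' \<noteq> 0)"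
    by blast
  with paths labs curs e'(1,2) ex have "hist v1 v2 e0 ?A ?B (Suc k) n1 n2 y"
    unfolding pstep(2) hist_def prod.case by blast
  then show ?thesis by blast
qed

lemma histI:
  assumes "outs A k = pa @ os1" "outs B k = pb @ os2" "\<forall>j<k. length (outs B j) \<le> length pb"
    "m1 = 0 \<and> n1 = length pa \<or> m1 = 1 \<and> n1 < length (outs A k) \<and> sel e (outs A k ! n1) = v1"
    "m2 = 0 \<and> n2 = length pb \<or> m2 = 1 \<and> n2 < length (outs B k) \<and> sel e (outs B k ! n2) = v2 \<and> e \<noteq> 0"
    "e = 1 \<longrightarrow> (\<exists>s<k. has_reg v2 (asg (B s)) \<and> (m2 = 1 \<longrightarrow> length (outs B s) \<le> n2) \<and>
        (\<forall>j. s \<le> j \<and> j < k \<and> (m1 = 1 \<longrightarrow> length (outs A j) \<le> n1) \<longrightarrow> \<not> has_reg v1 (asg (A j))))"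
    "path T A k" "path T B k" "\<forall>i<k. lab (A i) = lab (B i)" "q1 = cur T A k" "q2 = cur T B k"
    "e = 0 \<or> e = 1 \<or> e = 2" "e = 2 \<longleftrightarrow> e0 = 2"
  shows "hist v1 v2 e0 A B k n1 n2 (e, m1, m2, (os1, q1), (os2, q2))"
  using assms unfolding hist_def prod.case by blast

lemma hist_edge:
  assumes h: "hist v1 v2 e0 A B k n1 n2 x" and "edge v1 v2 z x y"
  shows "\<exists>A B k n1' n2'. hist v1 v2 e0 A B k n1' n2' y \<and> int n1' - int n2' = int n1 - int n2 + z"
  using assms(2)
proof cases
  case (emit1 e m2 c os q Y)
  obtain os2 q2 where Y: "Y = (os2, q2)" by (cases Y)
  note h = h[unfolded emit1 Y hist_def prod.case]
  obtain p1 p2 where p: "outs A k = p1 @ c # os" "outs B k = p2 @ os2" "\<forall>j<k. length (outs B j) \<le> length p2"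
    "n1 = length p1" "m2 = 0 \<and> n2 = length p2 \<or> m2 = 1 \<and> n2 < length (outs B k) \<and> sel e (outs B k ! n2) = v2 \<and> e \<noteq> 0"
    using h by auto
  have "hist v1 v2 e0 A B k (Suc n1) n2 y"
    unfolding emit1 Y
    by (rule histI[where pa = "p1 @ [c]" and pb = p2]) (use h p in \<open>auto simp: le_SucI\<close>)
  then show ?thesis using emit1 by fastforce
next
  case (emit2 e m1 X c os q)
  obtain os1 q1 where X: "X = (os1, q1)" by (cases X)
  note h = h[unfolded emit2 X hist_def prod.case]
  obtain p1 p2 where p: "outs A k = p1 @ os1" "outs B k = p2 @ c # os" "\<forall>j<k. length (outs B j) \<le> length p2"
    "n2 = length p2" "m1 = 0 \<and> n1 = length p1 \<or> m1 = 1 \<and> n1 < length (outs A k) \<and> sel e (outs A k ! n1) = v1"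
    using h by auto
  have "hist v1 v2 e0 A B k n1 (Suc n2) y"
    unfolding emit2 X
    by (rule histI[where pa = p1 and pb = "p2 @ [c]"]) (use h p in \<open>auto simp: le_SucI\<close>)
  then show ?thesis using emit2 by fastforce
next
  case (skip1 e m2 c os q Y)
  obtain os2 q2 where Y: "Y = (os2, q2)" by (cases Y)
  note h = h[unfolded skip1 Y hist_def prod.case]
  obtain p1 p2 where p: "outs A k = p1 @ c # os" "outs B k = p2 @ os2" "\<forall>j<k. length (outs B j) \<le> length p2"
    "n1 < length (outs A k) \<and> sel e (outs A k ! n1) = v1"
    "m2 = 0 \<and> n2 = length p2 \<or> m2 = 1 \<and> n2 < length (outs B k) \<and> sel e (outs B k ! n2) = v2 \<and> e \<noteq> 0"
    using h by auto
  have "hist v1 v2 e0 A B k n1 n2 y"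
    unfolding skip1 Y
    by (rule histI[where pa = "p1 @ [c]" and pb = p2]) (use h p in \<open>auto simp: le_SucI\<close>)
  then show ?thesis using skip1 by fastforce
next
  case (skip2 e m1 X c os q)
  obtain os1 q1 where X: "X = (os1, q1)" by (cases X)
  note h = h[unfolded skip2 X hist_def prod.case]
  obtain p1 p2 where p: "outs A k = p1 @ os1" "outs B k = p2 @ c # os" "\<forall>j<k. length (outs B j) \<le> length p2"
    "m1 = 0 \<and> n1 = length p1 \<or> m1 = 1 \<and> n1 < length (outs A k) \<and> sel e (outs A k ! n1) = v1"
    "n2 < length (outs B k) \<and> sel e (outs B k ! n2) = v2 \<and> e \<noteq> 0"
    using h by auto
  have "hist v1 v2 e0 A B k n1 n2 y"
    unfolding skip2 X
    by (rule histI[where pa = p1 and pb = "p2 @ [c]"]) (use h p in \<open>auto simp: le_SucI\<close>)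
  then show ?thesis using skip2 by fastforce
next
  case (mark1 e c m2 os q Y)
  obtain os2 q2 where Y: "Y = (os2, q2)" by (cases Y)
  note h = h[unfolded mark1 Y hist_def prod.case]
  obtain p1 p2 where p: "outs A k = p1 @ c # os" "outs B k = p2 @ os2" "\<forall>j<k. length (outs B j) \<le> length p2"
    "n1 = length p1" "m2 = 0 \<and> n2 = length p2 \<or> m2 = 1 \<and> n2 < length (outs B k) \<and> sel e (outs B k ! n2) = v2 \<and> e \<noteq> 0"
    using h by auto
  have ex: "\<exists>s<k. has_reg v2 (asg (B s)) \<and> (m2 = 1 \<longrightarrow> length (outs B s) \<le> n2) \<and>
        (\<forall>j. s \<le> j \<and> j < k \<and> ((1::nat) = 1 \<longrightarrow> length (outs A j) \<le> n1) \<longrightarrow> \<not> has_reg v1 (asg (A j)))" if "e = 1"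
    using h that by auto
  have "hist v1 v2 e0 A B k n1 n2 y"
    unfolding mark1 Y
    by (rule histI[where pa = p1 and pb = p2]) (use h p ex mark1(4) in \<open>auto simp: le_SucI\<close>)
  then show ?thesis using mark1 by fastforce
next
  case (mark2 e c m1 X os q)
  obtain os1 q1 where X: "X = (os1, q1)" by (cases X)
  note h = h[unfolded mark2 X hist_def prod.case]
  obtain p1 p2 where p: "outs A k = p1 @ os1" "outs B k = p2 @ c # os" "\<forall>j<k. length (outs B j) \<le> length p2"
    "n2 = length p2" "m1 = 0 \<and> n1 = length p1 \<or> m1 = 1 \<and> n1 < length (outs A k) \<and> sel e (outs A k ! n1) = v1"
    using h by auto
  have ex: "\<exists>s<k. has_reg v2 (asg (B s)) \<and> ((1::nat) = 1 \<longrightarrow> length (outs B s) \<le> n2) \<and>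
        (\<forall>j. s \<le> j \<and> j < k \<and> (m1 = 1 \<longrightarrow> length (outs A j) \<le> n1) \<longrightarrow> \<not> has_reg v1 (asg (A j)))" if "e = 1"
    using h that p(3,4) by blast
  have "hist v1 v2 e0 A B k n1 n2 y"
    unfolding mark2 X
    by (rule histI[where pa = p1 and pb = p2]) (use h p ex mark2(4,5) in \<open>auto simp: le_SucI\<close>)
  then show ?thesis using mark2 by fastforce
next
  case step
  then show ?thesis using hist_pstep[OF h] by fastforce
qed

lemma hist_walk:
  "walk (edge v1 v2) l x z y \<Longrightarrow> hist v1 v2 e0 A B k n1 n2 x \<Longrightarrow>
    \<exists>A B k n1' n2'. hist v1 v2 e0 A B k n1' n2' y \<and> int n1' - int n2' = int n1 - int n2 + z"
proof (induction arbitrary: A B k n1 n2 rule: walk.induct)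
  case (walk_refl x)
  then show ?case by force
next
  case (walk_step z x a n w y)
  from hist_edge[OF walk_step.prems walk_step.hyps(1)] obtain A B k n1' n2' where
    h: "hist v1 v2 e0 A B k n1' n2' a" "int n1' - int n2' = int n1 - int n2 + z" by blast
  from walk_step.IH[OF h(1)] show ?case unfolding h(2) add.assoc .
qed

text \<open>Behind the two marked cells it remains only to accept forever on common labels, so the
  loop of the lasso is projected to pairs of states.\<close>

definition sync :: "'q \<times> 'q \<Rightarrow> 'q \<times> 'q \<Rightarrow> bool" where
  "sync p p' \<longleftrightarrow> (\<exists>t1\<in>transitions T. \<exists>t2\<in>transitions T. lab t1 = lab t2 \<and> p = (src t1, src t2) \<and> p' = (tgt t1, tgt t2))"

definition targets :: "('b, 'q, 'r) node \<Rightarrow> 'q \<times> 'q" where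
  "targets = (\<lambda>(e, m1, m2, X, Y). (snd X, snd Y))"

lemma pstep_sync:
  assumes "pstep v1 v2 x y"
  shows "sync (targets x) (targets y)"
  using assms
proof cases
  case (pstep t1 t2 e m1 e' m2)
  then show ?thesis unfolding sync_def
    by (intro bexI[of _ t1] bexI[of _ t2]) (simp_all add: targets_def)
qed

lemma edge_sync: "edge v1 v2 z x y \<Longrightarrow> sync\<^sup>*\<^sup>* (targets x) (targets y)"
  by (cases rule: edge.cases) (auto simp: targets_def dest: pstep_sync)

lemma balanced_sync: "balanced (edge v1 v2) x y \<Longrightarrow> sync\<^sup>*\<^sup>* (targets x) (targets y)"
  by (induction rule: balanced.induct) (auto dest: edge_sync intro: rtranclp_trans)

lemma has_lasso_conflicting:
  assumes "has_lasso V"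
  shows "conflicting T"
proof -
  obtain v1 v2 e0 e q1 q2 p1 p2 a b where l: "e0 = 0 \<or> e0 = 2 \<and> v1 \<noteq> v2"
    "balanced (edge v1 v2) (start e0) (final e q1 q2)" "q1 \<in> accepting T"
    "pstep v1 v2 (final e q1 q2) a" "balanced (edge v1 v2) a (final e p1 p2)" "p2 \<in> accepting T"
    "pstep v1 v2 (final e p1 p2) b" "balanced (edge v1 v2) b (final e q1 q2)"
    using assms unfolding has_lasso_def by metis
  have tf: "targets (final e r r') = (r, r')" for r r' by (simp add: targets_def final_def)
  have "sync\<^sup>+\<^sup>+ (q1, q2) (p1, p2)" "sync\<^sup>+\<^sup>+ (p1, p2) (q1, q2)"
    using pstep_sync[OF l(4)] balanced_sync[OF l(5)] pstep_sync[OF l(7)] balanced_sync[OF l(8)]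
    by (auto simp: tf intro: rtranclp_into_tranclp2)
  then obtain f where f: "f 0 = (q1, q2)" "\<And>i. sync (f i) (f (Suc i))" "\<exists>\<^sub>\<infinity>i. f i = (q1, q2)" "\<exists>\<^sub>\<infinity>i. f i = (p1, p2)"
    using lasso[of sync "(q1, q2)" "(p1, p2)"] by metis
  then obtain A' B' where AB': "\<And>i. A' i \<in> transitions T" "\<And>i. B' i \<in> transitions T" "\<And>i. lab (A' i) = lab (B' i)"
    "\<And>i. f i = (src (A' i), src (B' i))" "\<And>i. f (Suc i) = (tgt (A' i), tgt (B' i))"
    unfolding sync_def by metis
  \<comment> \<open>No transition has been taken at time 0, so any two sequences are a
    history.\<close>
  have h0: "hist v1 v2 e0 (\<lambda>_. undefined) (\<lambda>_. undefined) 0 0 0 (start e0)"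
    using l(1) by (auto simp: hist_def start_def path_def)
  obtain m where "walk (edge v1 v2) m (start e0) 0 (final e q1 q2)" using balanced_walk[OF l(2)] by blast
  from hist_walk[OF this h0] obtain A0 B0 k n n' where
    h: "hist v1 v2 e0 A0 B0 k n n' (final e q1 q2)" and "int n - int n' = int 0 - int 0 + 0" by blast
  then have "n = n'" by simp
  define A where "A i = (if i < k then A0 i else A' (i - k))" for i
  define B where "B i = (if i < k then B0 i else B' (i - k))" for i
  note h1 = h(1)[unfolded final_def hist_def prod.case, folded \<open>n = n'\<close>]
  have f0: "fst (f 0) = cur T A0 k" "snd (f 0) = cur T B0 k" using h1 f(1) by auto
  have curA: "cur T A i = (if i \<le> k then cur T A0 i else fst (f (i - k)))" for i
    by (cases i) (auto simp: A_def AB'(5) Suc_diff_le not_le)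
  have curB: "cur T B i = (if i \<le> k then cur T B0 i else snd (f (i - k)))" for i
    by (cases i) (auto simp: B_def AB'(5) Suc_diff_le not_le)
  have curA': "cur T A i = fst (f (i - k))" if "i \<ge> k" for i using curA[of i] f0 that by (cases "i = k") auto
  have curB': "cur T B i = snd (f (i - k))" if "i \<ge> k" for i using curB[of i] f0 that by (cases "i = k") auto
  have "A i \<in> transitions T \<and> src (A i) = cur T A i \<and> B i \<in> transitions T \<and> src (B i) = cur T B i" for i
  proof (cases "i < k")
    case True
    then show ?thesis using h1 curA[of i] curB[of i] by (auto simp: path_def A_def B_def)
  next
    case False
    then show ?thesis using AB'(1,2,4)[of "i - k"] curA'[of i] curB'[of i] by (auto simp: A_def B_def)
  qed
  then have paths: "path T A j" "path T B j" for j by (auto simp: path_def)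
  have inf: "\<exists>\<^sub>\<infinity>i. P (cur T A i) (cur T B i)" if "\<exists>\<^sub>\<infinity>i. P (fst (f i)) (snd (f i))" for P
    unfolding INFM_nat
  proof
    fix m
    obtain i where "i > m" "P (fst (f i)) (snd (f i))" using \<open>\<exists>\<^sub>\<infinity>i. P (fst (f i)) (snd (f i))\<close> by (auto simp: INFM_nat)
    then show "\<exists>i>m. P (cur T A i) (cur T B i)" using curA'[of "i + k"] curB'[of "i + k"] by (intro exI[of _ "i + k"]) auto
  qed
  have "\<exists>\<^sub>\<infinity>i. cur T A i \<in> accepting T"
    by (rule inf) (rule INFM_mono[OF f(3)], use l(3) in simp)
  moreover have "\<exists>\<^sub>\<infinity>i. cur T B i \<in> accepting T"
    by (rule inf) (rule INFM_mono[OF f(4)], use l(6) in simp)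
  ultimately have acc: "accepting_path T A" "accepting_path T B" using paths by (auto simp: accepting_path_def)
  have labs: "lab (A i) = lab (B i)" for i using h1 AB'(3) by (auto simp: A_def B_def)
  have eq: "outs A j = outs A0 j" "outs B j = outs B0 j" if "j \<le> k" for j
    using that by (auto intro!: outs_cong simp: A_def B_def)
  have n: "n < length (outs A k)" "sel e (outs A k ! n) = v1" "n < length (outs B k)" "sel e (outs B k ! n) = v2"
    "e = 1 \<or> e = 2" "e = 2 \<longleftrightarrow> e0 = 2"
    using h1 eq[of k] by auto
  have "conflict A B k n"
  proof (cases "e = 2")
    case True
    then have "v1 \<noteq> v2" using n l(1) by auto
    then show ?thesis using n True by (auto simp: conflict_def sel_def)
  next
    case False
    then have e: "e = 1" using n by auto
    then obtain s where s: "s < k" "has_reg v2 (asg (B0 s))" "length (outs B0 s) \<le> n"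
      "\<And>j. s \<le> j \<Longrightarrow> j < k \<Longrightarrow> length (outs A0 j) \<le> n \<Longrightarrow> \<not> has_reg v1 (asg (A0 j))"
      using h1 by auto
    have "snd (outs B k ! n) \<in> asg (B s)"
      using s(1,2) n(4) e inj_cr by (auto simp: sel_def B_def has_reg_def dest: injD)
    moreover have "snd (outs A k ! n) \<notin> asg (A j)" if "j \<ge> s" "length (outs A j) \<le> n" for j
    proof -
      have "j < k" using length_outs_less[OF that(2) n(1)] .
      then show ?thesis using s(4)[of j] that eq(1)[of j] n(2) e by (auto simp: sel_def A_def has_reg_def)
    qed
    moreover have "length (outs B s) \<le> n" using s eq(2)[of s] by simp
    ultimately show ?thesis using n by (auto simp: conflict_def)
  qed
  then show ?thesis using acc labs unfolding conflicting_def by metis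
qed

subsection \<open>From conflicts to lassos\<close>

lemma walk_emit1:
  "m = 0 \<or> m = 1 \<Longrightarrow> \<exists>l. walk (edge v1 v2) l (e, m, m2, (os @ os', q), Y) (if m = 0 then int (length os) else 0)
     (e, m, m2, (os', q), Y)"
proof (induction os)
  case Nil
  show ?case by (intro exI[of _ 0]) (auto simp: walk_refl)
next
  case (Cons c os)
  then obtain l where l: "walk (edge v1 v2) l (e, m, m2, (os @ os', q), Y) (if m = 0 then int (length os) else 0)
     (e, m, m2, (os', q), Y)" by blast
  have "edge v1 v2 (if m = 0 then 1 else 0) (e, m, m2, (c # os @ os', q), Y) (e, m, m2, (os @ os', q), Y)"
    using Cons.prems emit1[of v1 v2 e m2 c "os @ os'" q Y] skip1[of v1 v2 e m2 c "os @ os'" q Y] by auto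
  from walk_step[of "edge v1 v2", OF this l] show ?case by (intro exI[of _ "Suc l"]) (auto split: if_splits)
qed

lemma walk_emit2:
  "m = 0 \<or> m = 1 \<Longrightarrow> \<exists>l. walk (edge v1 v2) l (e, m1, m, X, (os @ os', q)) (if m = 0 then - int (length os) else 0)
     (e, m1, m, X, (os', q))"
proof (induction os)
  case Nil
  show ?case by (intro exI[of _ 0]) (auto simp: walk_refl)
next
  case (Cons c os)
  then obtain l where l: "walk (edge v1 v2) l (e, m1, m, X, (os @ os', q)) (if m = 0 then - int (length os) else 0)
     (e, m1, m, X, (os', q))" by blast
  have "edge v1 v2 (if m = 0 then - 1 else 0) (e, m1, m, X, (c # os @ os', q)) (e, m1, m, X, (os @ os', q))"
    using Cons.prems emit2[of v1 v2 e m1 X c "os @ os'" q] skip2[of v1 v2 e m1 X c "os @ os'" q] by auto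
  from walk_step[of "edge v1 v2", OF this l] show ?case by (intro exI[of _ "Suc l"]) (auto split: if_splits)
qed

definition passed :: "nat \<Rightarrow> (nat \<Rightarrow> ('a, 'b, 'q, 'r) transition) \<Rightarrow> nat \<Rightarrow> nat" where
  "passed n A t = of_bool (n < length (outs A t))"

text \<open>The minimum with n counts the emitted cells before cell n and is constant once this cell
  is passed, just as \<open>skip1\<close> has weight 0. The mark is set in the transition that emits
  cell n.\<close>

lemma walk_out1:
  assumes c: "n < length (outs A k)" "sel e (outs A k ! n) = v1"
  shows "\<exists>l. walk (edge v1 v2) l (e, passed n A t, m2, (out (A t), q), Y)
    (int (min n (length (outs A (Suc t)))) - int (min n (length (outs A t)))) (e, passed n A (Suc t), m2, ([], q), Y)"
proof -
  consider "n < length (outs A t)" | "length (outs A (Suc t)) \<le> n"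
    | "length (outs A t) \<le> n" "n < length (outs A (Suc t))" by linarith
  then show ?thesis
  proof cases
    case 1
    then show ?thesis using walk_emit1[of 1 v1 v2 e m2 "out (A t)" "[]" q Y] by (simp add: passed_def)
  next
    case 2
    then show ?thesis using walk_emit1[of 0 v1 v2 e m2 "out (A t)" "[]" q Y] by (simp add: passed_def)
  next
    case 3
    define j where "j = n - length (outs A t)"
    have j: "j < length (out (A t))" using 3 by (auto simp: j_def)
    define c where "c = out (A t) ! j"
    have out: "out (A t) = take j (out (A t)) @ c # drop (Suc j) (out (A t))"
      using j by (simp add: c_def id_take_nth_drop)
    have "c = outs A (Suc t) ! n" using 3 by (simp add: c_def j_def nth_append)
    then have "sel e c = v1" using c nth_outs[of n A "Suc t" k] 3(2) by simp
    from walk_edge[of "edge v1 v2", OF mark1[of e c v1 v2 m2 "drop (Suc j) (out (A t))" q Y, OF this]]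
    have w: "walk (edge v1 v2) 1 (e, 0, m2, (c # drop (Suc j) (out (A t)), q), Y) 0
        (e, 1, m2, (c # drop (Suc j) (out (A t)), q), Y)" .
    obtain l where l: "walk (edge v1 v2) l (e, 0, m2, (take j (out (A t)) @ c # drop (Suc j) (out (A t)), q), Y)
        (int j) (e, 0, m2, (c # drop (Suc j) (out (A t)), q), Y)"
      using walk_emit1[of 0 v1 v2 e m2 "take j (out (A t))" "c # drop (Suc j) (out (A t))" q Y] j by auto
    obtain l' where l': "walk (edge v1 v2) l' (e, 1, m2, (c # drop (Suc j) (out (A t)), q), Y) 0 (e, 1, m2, ([], q), Y)"
      using walk_emit1[of 1 v1 v2 e m2 "c # drop (Suc j) (out (A t))" "[]" q Y] by auto
    from walk_append[OF l walk_append[OF w l']]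
    have w: "\<exists>l. walk (edge v1 v2) l (e, 0, m2, (out (A t), q), Y) (int j) (e, 1, m2, ([], q), Y)"
      using out by auto
    have "passed n A t = 0" "passed n A (Suc t) = 1"
      "int (min n (length (outs A (Suc t)))) - int (min n (length (outs A t))) = int j"
      using 3 by (auto simp: passed_def j_def)
    then show ?thesis using w by (simp only:)
  qed
qed

lemma walk_out2:
  assumes c: "n < length (outs B k)" "sel e (outs B k ! n) = v2" and e: "n < length (outs B (Suc t)) \<Longrightarrow> e = 1 \<or> e = 2"
  shows "\<exists>l. walk (edge v1 v2) l (e, m1, passed n B t, X, (out (B t), q))
    (int (min n (length (outs B t))) - int (min n (length (outs B (Suc t))))) (e, m1, passed n B (Suc t), X, ([], q))"
proof -
  consider "n < length (outs B t)" | "length (outs B (Suc t)) \<le> n"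
    | "length (outs B t) \<le> n" "n < length (outs B (Suc t))" by linarith
  then show ?thesis
  proof cases
    case 1
    then show ?thesis using walk_emit2[of 1 v1 v2 e m1 X "out (B t)" "[]" q] by (simp add: passed_def)
  next
    case 2
    then show ?thesis using walk_emit2[of 0 v1 v2 e m1 X "out (B t)" "[]" q] by (simp add: passed_def)
  next
    case 3
    define j where "j = n - length (outs B t)"
    have j: "j < length (out (B t))" using 3 by (auto simp: j_def)
    define c where "c = out (B t) ! j"
    have out: "out (B t) = take j (out (B t)) @ c # drop (Suc j) (out (B t))"
      using j by (simp add: c_def id_take_nth_drop)
    have "c = outs B (Suc t) ! n" using 3 by (simp add: c_def j_def nth_append)
    then have "sel e c = v2" using c nth_outs[of n B "Suc t" k] 3(2) by simp
    from walk_edge[of "edge v1 v2", OF mark2[of e c v2 v1 m1 X "drop (Suc j) (out (B t))" q, OF this e[OF 3(2)]]]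
    have w: "walk (edge v1 v2) 1 (e, m1, 0, X, (c # drop (Suc j) (out (B t)), q)) 0
        (e, m1, 1, X, (c # drop (Suc j) (out (B t)), q))" .
    obtain l where l: "walk (edge v1 v2) l (e, m1, 0, X, (take j (out (B t)) @ c # drop (Suc j) (out (B t)), q))
        (- int j) (e, m1, 0, X, (c # drop (Suc j) (out (B t)), q))"
      using walk_emit2[of 0 v1 v2 e m1 X "take j (out (B t))" "c # drop (Suc j) (out (B t))" q] j by auto
    obtain l' where l': "walk (edge v1 v2) l' (e, m1, 1, X, (c # drop (Suc j) (out (B t)), q)) 0 (e, m1, 1, X, ([], q))"
      using walk_emit2[of 1 v1 v2 e m1 X "c # drop (Suc j) (out (B t))" "[]" q] by auto
    from walk_append[OF l walk_append[OF w l']]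
    have w: "\<exists>l. walk (edge v1 v2) l (e, m1, 0, X, (out (B t), q)) (- int j) (e, m1, 1, X, ([], q))"
      using out by auto
    have "passed n B t = 0" "passed n B (Suc t) = 1"
      "int (min n (length (outs B t))) - int (min n (length (outs B (Suc t)))) = - int j"
      using 3 by (auto simp: passed_def j_def)
    then show ?thesis using w by (simp only:)
  qed
qed

lemma conflicting_has_lasso:
  assumes "conflicting T"
  shows "has_lasso (\<Union>t\<in>transitions T. \<Union>c\<in>set (out t). {cg (fst c), cr (snd c)})"
    (is "has_lasso ?V")
proof -
  obtain A B k n where AB: "accepting_path T A" "accepting_path T B" "\<And>i. lab (A i) = lab (B i)" "conflict A B k n"
    using assms by (auto simp: conflicting_def)
  have n: "n < length (outs A k)" "n < length (outs B k)" using AB(4) by (auto simp: conflict_def)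
  have tr: "A i \<in> transitions T" "src (A i) = cur T A i" "B i \<in> transitions T" "src (B i) = cur T B i" for i
    using AB(1,2) by (auto simp: accepting_path_def path_def)
  define e0 :: nat where "e0 = (if fst (outs A k ! n) \<noteq> fst (outs B k ! n) then 2 else 0)"
  define v1 where "v1 = sel e0 (outs A k ! n)"
  define v2 where "v2 = sel e0 (outs B k ! n)"
  have e0: "e0 = 0 \<or> e0 = 2 \<and> v1 \<noteq> v2"
    using inj_cg by (auto simp: e0_def v1_def v2_def sel_def dest: injD)
  obtain s where s: "e0 = 0 \<Longrightarrow> has_reg v2 (asg (B s)) \<and> length (outs B s) \<le> n \<and>
      (\<forall>j\<ge>s. length (outs A j) \<le> n \<longrightarrow> \<not> has_reg v1 (asg (A j)))"
  proof (cases "e0 = 0")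
    case True
    then have eq: "fst (outs A k ! n) = fst (outs B k ! n)" by (auto simp: e0_def split: if_splits)
    then obtain s where "snd (outs B k ! n) \<in> asg (B s)" "length (outs B s) \<le> n"
      "\<And>j. j \<ge> s \<Longrightarrow> length (outs A j) \<le> n \<Longrightarrow> snd (outs A k ! n) \<notin> asg (A j)"
      using AB(4) by (auto simp: conflict_def)
    then show ?thesis using that[of s] True inj_cr
      by (auto simp: has_reg_def v1_def v2_def sel_def inj_image_mem_iff)
  qed (use that in auto)
  \<comment> \<open>The transition at time s changes the mode from 0 to 1, so the nodes in mode 1
    are those strictly after s.\<close>
  define ph where "ph t = (if e0 = 2 then 2 else if s < t then 1 else 0 :: nat)" for t
  define nd where "nd t = (ph t, passed n A t, passed n B t, ([] :: ('b \<times> 'r) list, cur T A t), ([] :: ('b \<times> 'r) list, cur T B t))" for t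
  define z where "z t = int (min n (length (outs A t))) - int (min n (length (outs B t)))" for t
  have sel: "sel (ph t) c = sel e0 c" for t c using e0 by (auto simp: sel_def ph_def)
  have step: "\<exists>y l. pstep v1 v2 (nd t) y \<and> walk (edge v1 v2) l y (z (Suc t) - z t) (nd (Suc t))" for t
  proof -
    let ?y = "(ph (Suc t), passed n A t, passed n B t, (out (A t), tgt (A t)), (out (B t), tgt (B t)))"
    have "admissible v1 v2 (ph t) (passed n A t) (ph (Suc t)) (asg (A t)) (asg (B t))"
    proof (cases "e0 = 2")
      case False
      then have 0: "e0 = 0" using e0 by auto
      have "passed n A t = 1 \<or> \<not> has_reg v1 (asg (A t))" if "s \<le> t"
        using s[OF 0] that by (auto simp: passed_def)
      then show ?thesis using 0 s[OF 0] by (cases s t rule: linorder_cases) (auto simp: admissible_def ph_def)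
    qed (auto simp: admissible_def ph_def)
    then have "pstep v1 v2 (nd t) ?y"
      unfolding nd_def using pstep.pstep[of "A t" "B t"] tr[of t] AB(3)[of t] by metis
    moreover have "\<exists>l. walk (edge v1 v2) l ?y (z (Suc t) - z t) (nd (Suc t))"
    proof -
      have s1: "sel (ph (Suc t)) (outs A k ! n) = v1" and s2: "sel (ph (Suc t)) (outs B k ! n) = v2"
        by (simp_all add: sel v1_def v2_def)
      from walk_out1[OF n(1) s1, of v2 t "passed n B t" "tgt (A t)" "(out (B t), tgt (B t))"]
      obtain l where l: "walk (edge v1 v2) l ?y (int (min n (length (outs A (Suc t)))) - int (min n (length (outs A t))))
          (ph (Suc t), passed n A (Suc t), passed n B t, ([], tgt (A t)), (out (B t), tgt (B t)))"
        by blast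
      have p: "ph (Suc t) = 1 \<or> ph (Suc t) = 2" if "n < length (outs B (Suc t))"
      proof (cases "e0 = 2")
        case False
        then have 0: "e0 = 0" using e0 by auto
        have "s < Suc t" using length_outs_less[OF _ that] s[OF 0] by blast
        then show ?thesis by (simp add: ph_def)
      qed (simp add: ph_def)
      have "\<exists>l. walk (edge v1 v2) l
          (ph (Suc t), passed n A (Suc t), passed n B t, ([], tgt (A t)), (out (B t), tgt (B t)))
          (int (min n (length (outs B t))) - int (min n (length (outs B (Suc t)))))
          (ph (Suc t), passed n A (Suc t), passed n B (Suc t), ([], tgt (A t)), ([], tgt (B t)))"
        by (rule walk_out2[OF n(2) s2]) (rule p)
      then obtain l' where l': "walk (edge v1 v2) l'
          (ph (Suc t), passed n A (Suc t), passed n B t, ([], tgt (A t)), (out (B t), tgt (B t)))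
          (int (min n (length (outs B t))) - int (min n (length (outs B (Suc t))))) (nd (Suc t))"
        by (auto simp: nd_def)
      have "int (min n (length (outs A (Suc t)))) - int (min n (length (outs A t))) +
        (int (min n (length (outs B t))) - int (min n (length (outs B (Suc t))))) = z (Suc t) - z t"
        by (simp add: z_def)
      with walk_append[OF l l'] show ?thesis by (metis)
    qed
    ultimately show ?thesis by blast
  qed
  note step_y = step
  have walks: "\<exists>l. walk (edge v1 v2) l (nd t) (z t' - z t) (nd t')" if "t \<le> t'" for t t'
    using that
  proof (induction rule: dec_induct)
    case base
    show ?case using walk_refl[of "edge v1 v2" "nd t"] by auto
  next
    case (step j)
    then obtain l where l: "walk (edge v1 v2) l (nd t) (z j - z t) (nd j)" by blast
    obtain y l' where y: "pstep v1 v2 (nd j) y" "walk (edge v1 v2) l' y (z (Suc j) - z j) (nd (Suc j))"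
      using step_y by blast
    from walk_append[OF l walk_append[OF walk_edge[of "edge v1 v2", OF edge.step[OF y(1)]] y(2)]]
    show ?case by (auto simp: add.assoc intro: exI)
  qed
  \<comment> \<open>From here on both runs have emitted cell n and s is past, so all nodes are final
    and the counter is 0.\<close>
  define t0 where "t0 = Suc (max s k)"
  define e where "e = ph t0"
  have fin: "nd t = final e (cur T A t) (cur T B t)" "z t = 0" if "t \<ge> t0" for t
  proof -
    have "k \<le> t" using that by (simp add: t0_def)
    then have "n < length (outs A t)" "n < length (outs B t)"
      using n length_outs_mono[of k t A] length_outs_mono[of k t B] by auto
    then show "nd t = final e (cur T A t) (cur T B t)" "z t = 0"
      using that by (auto simp: nd_def final_def e_def ph_def passed_def t0_def z_def)
  qed
  have nd0: "nd 0 = start e0" "z 0 = 0" using e0 by (auto simp: nd_def start_def ph_def passed_def z_def)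
  \<comment> \<open>Pigeonhole on the accepting times of A gives a time t1 whose pair of states
    recurs infinitely often; a time t2 at which B accepts is then enclosed between t1 and a
    recurrence t3.\<close>
  define I where "I = {t. t0 \<le> t \<and> cur T A t \<in> accepting T}"
  have infI: "infinite I"
    unfolding I_def infinite_nat_iff_unbounded
  proof
    fix m
    have "\<forall>m. \<exists>t>m. cur T A t \<in> accepting T"
      using AB(1) by (auto simp: accepting_path_def INFM_nat)
    then obtain t where "t > max m t0" "cur T A t \<in> accepting T" by blast
    then show "\<exists>n>m. n \<in> {t. t0 \<le> t \<and> cur T A t \<in> accepting T}" by auto
  qed
  have st: "cur T A t \<in> states T" "cur T B t \<in> states T" for t
    using tr[of "t - 1"] nrt by (cases t; force simp: is_nrt_def)+
  have "(\<lambda>t. (cur T A t, cur T B t)) ` I \<subseteq> states T \<times> states T" using st by blast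
  moreover have "finite (states T \<times> states T)" using nrt by (simp add: is_nrt_def)
  ultimately have "finite ((\<lambda>t. (cur T A t, cur T B t)) ` I)" by (rule finite_subset)
  with infI obtain t1 where t1: "t1 \<in> I" "infinite {t \<in> I. (cur T A t, cur T B t) = (cur T A t1, cur T B t1)}"
    using pigeonhole_infinite[of I "\<lambda>t. (cur T A t, cur T B t)"] by blast
  obtain t2 where t2: "t2 > t1" "cur T B t2 \<in> accepting T"
    using AB(2) by (auto simp: accepting_path_def INFM_nat)
  obtain t3 where t3: "t3 > t2" "cur T A t3 = cur T A t1" "cur T B t3 = cur T B t1"
    using t1(2) unfolding infinite_nat_iff_unbounded by blast
  have ge: "t1 \<ge> t0" "t2 \<ge> t0" "t3 \<ge> t0" "cur T A t1 \<in> accepting T" using t1(1) t2 t3 by (auto simp: I_def)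
  have bal: "\<exists>y. pstep v1 v2 (nd t) y \<and> balanced (edge v1 v2) y (nd t')" if "t0 \<le> t" "t < t'" for t t'
  proof -
    have lt: "Suc t \<le> t'" using that by simp
    obtain y l where y: "pstep v1 v2 (nd t) y" "walk (edge v1 v2) l y (z (Suc t) - z t) (nd (Suc t))"
      using step by blast
    obtain l' where "walk (edge v1 v2) l' (nd (Suc t)) (z t' - z (Suc t)) (nd t')"
      using walks[of "Suc t" t'] lt by blast
    from walk_append[OF y(2) this] have "walk (edge v1 v2) (l + l') y 0 (nd t')" using fin(2) that by simp
    then show ?thesis using walk_balanced[OF edge_weights] y(1) by blast
  qed
  obtain l where "walk (edge v1 v2) l (nd 0) (z t1 - z 0) (nd t1)" using walks[of 0 t1] by auto
  then have b0: "balanced (edge v1 v2) (start e0) (final e (cur T A t1) (cur T B t1))"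
    using walk_balanced[OF edge_weights, of v1 v2 l "nd 0" "nd t1"] fin ge nd0 by simp
  obtain a where a: "pstep v1 v2 (nd t1) a" "balanced (edge v1 v2) a (nd t2)" using bal[of t1 t2] ge t2 by blast
  obtain b where b: "pstep v1 v2 (nd t2) b" "balanced (edge v1 v2) b (nd t3)" using bal[of t2 t3] ge t3 by blast
  have nd: "nd t1 = final e (cur T A t1) (cur T B t1)" "nd t2 = final e (cur T A t2) (cur T B t2)"
    "nd t3 = final e (cur T A t1) (cur T B t1)"
    using fin(1) ge t3 by simp_all
  have "sel e0 (outs C k ! n) \<in> ?V" if "n < length (outs C k)" "\<And>i. C i \<in> transitions T" for C
  proof -
    have "outs C k ! n \<in> set (outs C k)" using that(1) by simp
    then obtain i where "outs C k ! n \<in> set (out (C i))" by (auto simp: outs_def)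
    then have "{cg (fst (outs C k ! n)), cr (snd (outs C k ! n))} \<subseteq> ?V" using that(2)[of i] by blast
    then show ?thesis by (simp add: sel_def)
  qed
  then have "v1 \<in> ?V" "v2 \<in> ?V" using n tr unfolding v1_def v2_def by blast+
  then show ?thesis
    unfolding has_lasso_def using e0 b0 a b ge(4) t2(2) unfolding nd by blast
qed

end

subsection \<open>Factors of a word\<close>

text \<open>By recursion on the factor, so that simplification can read a code bit by bit along with
  the positions.\<close>

primrec seg :: "'c list \<Rightarrow> nat \<Rightarrow> 'c list \<Rightarrow> nat \<Rightarrow> bool" where
  "seg w p [] q \<longleftrightarrow> q = p"
| "seg w p (b # u) q \<longleftrightarrow> p < length w \<and> w ! p = b \<and> seg w (Suc p) u q"

lemma seg_append: "seg w p (u @ v) q \<longleftrightarrow> (\<exists>m. seg w p u m \<and> seg w m v q)"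
  by (induction u arbitrary: p) auto

lemma seg_le: "seg w p u q \<Longrightarrow> p \<le> length w \<Longrightarrow> q \<le> length w"
  by (induction u arbitrary: p) auto

lemma seg_drop: "seg (x @ u @ y) (length x) u (length x + length u)"
proof (induction u arbitrary: x)
  case (Cons b u)
  then show ?case using Cons[of "x @ [b]"] by (simp add: nth_append)
qed simp

lemma seg_nonempty: "seg w p u q \<Longrightarrow> u \<noteq> [] \<Longrightarrow> p < length w"
  by (cases u) auto

lemma seg_det: "seg w p u q \<Longrightarrow> seg w p u q' \<Longrightarrow> q = q'"
  by (induction u arbitrary: p) auto

text \<open>The shape of the codes of natural numbers; not every such word is one.\<close>

inductive raw :: "bool list \<Rightarrow> bool" where
  raw_end: "raw [False]"
| raw_bit: "raw u \<Longrightarrow> raw (True # b # u)"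

lemma raw_enc_nat: "raw (enc_nat n)"
proof (induction n rule: enc_nat.induct)
  case (1 n)
  then show ?case by (subst enc_nat.simps) (auto intro: raw.intros)
qed

text \<open>Raw words are prefix-free: the flags tell where such a word ends, so at most one starts
  at a position.\<close>

lemma raw_unique: "raw u \<Longrightarrow> raw u' \<Longrightarrow> seg w p u q \<Longrightarrow> seg w p u' q' \<Longrightarrow> u = u' \<and> q = q'"
proof (induction arbitrary: p u' rule: raw.induct)
  case raw_end
  from raw_end(1) show ?case by cases (use raw_end in auto)
next
  case (raw_bit u b)
  from raw_bit(3) show ?case by cases (use raw_bit in auto)
qed

lemma inj_enc_nat: "inj enc_nat"
proof
  fix m n
  show "enc_nat m = enc_nat n \<Longrightarrow> m = n"
  proof (induction m arbitrary: n rule: enc_nat.induct)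
    case (1 m)
    show ?case
    proof (cases "m = 0 \<or> n = 0")
      case True
      then show ?thesis using 1(2)
        by (subst (asm) enc_nat.simps, subst (asm) (2) enc_nat.simps) (auto split: if_splits)
    next
      case False
      then have "odd m = odd n" "enc_nat (m div 2) = enc_nat (n div 2)"
        using 1(2) by (subst (asm) enc_nat.simps, subst (asm) (2) enc_nat.simps, simp)+
      then show ?thesis using 1(1)[of "n div 2"] False
        by (metis dvd_mult_div_cancel odd_two_times_div_two_succ)
    qed
  qed
qed

lemma enc_list_Nil [simp]: "enc_list f [] = [False]"
  by (simp add: enc_list_def)

lemma enc_list_Cons [simp]: "enc_list f (x # xs) = True # f x @ enc_list f xs"
  by (simp add: enc_list_def)

lemma enc_list_map: "enc_list f xs = enc_list id (map f xs)"
  by (induction xs) auto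

lemma enc_list_last: "\<exists>u. enc_list f xs = u @ [False]"
  by (simp add: enc_list_def)

definition code :: "bool list \<Rightarrow> nat \<Rightarrow> bool list \<Rightarrow> bool" where
  "code w p u \<longleftrightarrow> raw u \<and> (\<exists>q. seg w p u q)"

lemma code_seg: "raw u \<Longrightarrow> seg w p u q \<Longrightarrow> code w p u"
  by (auto simp: code_def)

subsection \<open>The Datalog program\<close>

abbreviation (input) Eq :: nat where "Eq \<equiv> 1"
abbreviation (input) Neq :: nat where "Neq \<equiv> 2"
abbreviation (input) Skip :: nat where "Skip \<equiv> 3"
abbreviation (input) Elem :: nat where "Elem \<equiv> 4"
abbreviation (input) Notin :: nat where "Notin \<equiv> 5"
abbreviation (input) Header :: nat where "Header \<equiv> 6"
abbreviation (input) Outs :: nat where "Outs \<equiv> 7"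
abbreviation (input) Cell :: nat where "Cell \<equiv> 8"
abbreviation (input) Parse :: nat where "Parse \<equiv> 9"
abbreviation (input) Tail :: nat where "Tail \<equiv> 10"
abbreviation (input) Trans :: nat where "Trans \<equiv> 11"
abbreviation (input) Acc :: nat where "Acc \<equiv> 12"
abbreviation (input) Flat :: nat where "Flat \<equiv> 13"
abbreviation (input) Up :: nat where "Up \<equiv> 14"
abbreviation (input) Down :: nat where "Down \<equiv> 15"
abbreviation (input) Pstep :: nat where "Pstep \<equiv> 16"
abbreviation (input) Bal :: nat where "Bal \<equiv> 17"
abbreviation (input) Free :: nat where "Free \<equiv> 18"
abbreviation (input) Adm :: nat where "Adm \<equiv> 19"
abbreviation (input) Same :: nat where "Same \<equiv> 20"
abbreviation (input) Init :: nat where "Init \<equiv> 21"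
abbreviation (input) Goal :: nat where "Goal \<equiv> 22"

text \<open>Numbers are referred to by the positions of their codes. \<open>Eq\<close> also reports
  where the two codes end, and \<open>Eq p x p x\<close> merely reads one code.\<close>

definition P_numbers :: "rule list" where
  "P_numbers = (let p = TV 0; p' = TV 1; q = TV 2; q' = TV 3; a = TV 4; b = TV 5; a' = TV 6; b' = TV 7 in
    [([TC Eq, p, p', q, q'], [Bit False p, Bit False q, Sc p p', Sc q q']),
     ([TC Eq, p, p', q, q'], [Bit True p, Bit True q, Sc p a, Sc q b, Bit False a, Bit False b, Sc a a', Sc b b',
        Rel [TC Eq, a', p', b', q']]),
     ([TC Eq, p, p', q, q'], [Bit True p, Bit True q, Sc p a, Sc q b, Bit True a, Bit True b, Sc a a', Sc b b',
        Rel [TC Eq, a', p', b', q']]),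
     ([TC Neq, p, q], [Bit False p, Bit True q]),
     ([TC Neq, p, q], [Bit True p, Bit False q]),
     ([TC Neq, p, q], [Bit True p, Bit True q, Sc p a, Sc q b, Bit False a, Bit True b]),
     ([TC Neq, p, q], [Bit True p, Bit True q, Sc p a, Sc q b, Bit True a, Bit False b]),
     ([TC Neq, p, q], [Bit True p, Bit True q, Sc p a, Sc q b, Sc a a', Sc b b', Rel [TC Neq, a', b']])])"

text \<open>\<open>Elem\<close> delivers the position of some entry and leaves comparisons to
  \<open>Eq\<close>; \<open>Notin\<close> has to go through the whole list, being a negative
  statement.\<close>

definition P_lists :: "rule list" where
  "P_lists = (let p = TV 0; q = TV 1; x = TV 2; y = TV 3; z = TV 4 in
    [([TC Skip, p, q], [Bit False p, Sc p q]),
     ([TC Skip, p, q], [Bit True p, Sc p x, Rel [TC Eq, x, y, x, y], Rel [TC Skip, y, q]]),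
     ([TC Elem, p, x], [Bit True p, Sc p x]),
     ([TC Elem, p, x], [Bit True p, Sc p y, Rel [TC Eq, y, z, y, z], Rel [TC Elem, z, x]]),
     ([TC Notin, p, x], [Bit False p]),
     ([TC Notin, p, x], [Bit True p, Sc p y, Rel [TC Neq, y, x], Rel [TC Eq, y, z, y, z], Rel [TC Notin, z, x]])])"

text \<open>A side of a node is a position from which an output list and then a state can be read.
  To this end c in \<open>Header\<close> is the last bit of the list of registers: it is False and
  reads as an empty output before the initial state. \<open>Parse\<close> passes over a single bit
  for the test, the code of \<open>TTop\<close>, and holds at arbitrary positions, among which
  \<open>Tail\<close> selects the genuine ones.\<close>

definition P_transitions :: "rule list" where
  "P_transitions = (let c = TV 0; f = TV 1; l = TV 2; p = TV 3; q = TV 4; d = TV 5; g = TV 6; r = TV 7; d' = TV 8;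
      t = TV 9; a = TV 10; s = TV 11; l' = TV 12; b = TV 13; x = TV 14; y = TV 15 in
    [([TC Header, c, f, l], [Rel [TC Skip, TC 0, p], Rel [TC Skip, p, q], Sc c q, Rel [TC Eq, q, f, q, f], Rel [TC Skip, f, l]]),
     ([TC Cell, d, g, r, d'], [Bit True d, Sc d g, Rel [TC Eq, g, r, g, r], Rel [TC Eq, r, d', r, d']]),
     ([TC Outs, d, f], [Bit False d, Sc d f]),
     ([TC Outs, d, f], [Rel [TC Cell, d, g, r, d'], Rel [TC Outs, d', f]]),
     ([TC Parse, t, a, s, d, l'], [Rel [TC Eq, t, a, t, a], Rel [TC Eq, a, b, a, b], Sc b s, Rel [TC Skip, s, d],
        Rel [TC Outs, d, f], Rel [TC Eq, f, l', f, l']]),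
     ([TC Tail, l], [Rel [TC Header, c, f, l]]),
     ([TC Tail, l'], [Rel [TC Tail, l], Bit True l, Sc l t, Rel [TC Parse, t, a, s, d, l']]),
     ([TC Trans, t, a, s, d], [Rel [TC Tail, l], Bit True l, Sc l t, Rel [TC Parse, t, a, s, d, l']]),
     ([TC Acc, c], [Rel [TC Outs, c, f], Rel [TC Header, p, q, l], Rel [TC Elem, q, x], Rel [TC Eq, f, y, x, d]])])"

text \<open>\<open>Flat\<close>, \<open>Up\<close> and \<open>Down\<close> are the edges of weight
  0, 1 and -1; v1 and v2 are positions of codes. In a cell, g is the position of the letter and r
  that of the register. In the rule from \<open>Pstep\<close> to \<open>Flat\<close>, however, g and
  r stand for the flags of the target node.\<close>

definition P_edges :: "rule list" where
  "P_edges = (let v1 = TV 0; v2 = TV 1; e = TV 2; m1 = TV 3; m2 = TV 4; c1 = TV 5; c2 = TV 6; d1 = TV 7; d2 = TV 8;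
      e' = TV 9; g = TV 10; r = TV 11; x = TV 12; y = TV 13; f1 = TV 14; f2 = TV 15; t1 = TV 16; t2 = TV 17;
      a1 = TV 18; a2 = TV 19; s1 = TV 20; s2 = TV 21; x' = TV 22; y' = TV 23; x'' = TV 24; y'' = TV 25 in
    [([TC Up, v1, v2, e, TC 0, m2, c1, c2, e, TC 0, m2, d1, c2], [Rel [TC Cell, c1, g, r, d1]]),
     ([TC Down, v1, v2, e, m1, TC 0, c1, c2, e, m1, TC 0, c1, d2], [Rel [TC Cell, c2, g, r, d2]]),
     ([TC Flat, v1, v2, e, TC 1, m2, c1, c2, e, TC 1, m2, d1, c2], [Rel [TC Cell, c1, g, r, d1]]),
     ([TC Flat, v1, v2, e, m1, TC 1, c1, c2, e, m1, TC 1, c1, d2], [Rel [TC Cell, c2, g, r, d2]]),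
     ([TC Flat, v1, v2, TC 2, TC 0, m2, c1, c2, TC 2, TC 1, m2, c1, c2],
        [Rel [TC Cell, c1, g, r, d1], Rel [TC Eq, g, x, v1, y]]),
     ([TC Flat, v1, v2, TC 0, TC 0, m2, c1, c2, TC 0, TC 1, m2, c1, c2],
        [Rel [TC Cell, c1, g, r, d1], Rel [TC Eq, r, x, v1, y]]),
     ([TC Flat, v1, v2, TC 1, TC 0, m2, c1, c2, TC 1, TC 1, m2, c1, c2],
        [Rel [TC Cell, c1, g, r, d1], Rel [TC Eq, r, x, v1, y]]),
     ([TC Flat, v1, v2, TC 2, m1, TC 0, c1, c2, TC 2, m1, TC 1, c1, c2],
        [Rel [TC Cell, c2, g, r, d2], Rel [TC Eq, g, x, v2, y]]),
     ([TC Flat, v1, v2, TC 1, m1, TC 0, c1, c2, TC 1, m1, TC 1, c1, c2],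
        [Rel [TC Cell, c2, g, r, d2], Rel [TC Eq, r, x, v2, y]]),
     ([TC Flat, v1, v2, e, m1, m2, c1, c2, e', g, r, d1, d2], [Rel [TC Pstep, v1, v2, e, m1, m2, c1, c2, e', g, r, d1, d2]]),
     ([TC Free, v1, TC 1, s1], []),
     ([TC Free, v1, m1, s1], [Rel [TC Notin, s1, v1]]),
     ([TC Adm, v1, v2, TC 0, m1, TC 0, s1, s2], []),
     ([TC Adm, v1, v2, TC 2, m1, TC 2, s1, s2], []),
     ([TC Adm, v1, v2, TC 1, m1, TC 1, s1, s2], [Rel [TC Free, v1, m1, s1]]),
     ([TC Adm, v1, v2, TC 0, m1, TC 1, s1, s2], [Rel [TC Free, v1, m1, s1], Rel [TC Elem, s2, x], Rel [TC Eq, v2, y, x, g]]),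
     ([TC Pstep, v1, v2, e, m1, m2, c1, c2, e', m1, m2, d1, d2],
        [Bit False c1, Sc c1 f1, Bit False c2, Sc c2 f2, Rel [TC Trans, t1, a1, s1, d1], Rel [TC Trans, t2, a2, s2, d2],
         Rel [TC Eq, f1, x, t1, y], Rel [TC Eq, f2, x', t2, y'], Rel [TC Eq, a1, x'', a2, y''],
         Rel [TC Adm, v1, v2, e, m1, e', s1, s2]])])"

text \<open>\<open>Same\<close> compares states instead of positions, because a loop may come back
  to another occurrence of the same state in the code.\<close>

definition P_lasso :: "rule list" where
  "P_lasso = (let v1 = TV 0; v2 = TV 1; e = TV 2; m1 = TV 3; m2 = TV 4; c1 = TV 5; c2 = TV 6;
      ae = TV 7; a1 = TV 8; a2 = TV 9; a3 = TV 10; a4 = TV 11; be = TV 12; b1 = TV 13; b2 = TV 14; b3 = TV 15; b4 = TV 16;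
      de = TV 17; d1 = TV 18; d2 = TV 19; d3 = TV 20; d4 = TV 21; x = TV 22; y = TV 23; z = TV 24; u = TV 25 in
    [([TC Bal, v1, v2, e, m1, m2, c1, c2, e, m1, m2, c1, c2], []),
     ([TC Bal, v1, v2, e, m1, m2, c1, c2, ae, a1, a2, a3, a4], [Rel [TC Flat, v1, v2, e, m1, m2, c1, c2, ae, a1, a2, a3, a4]]),
     ([TC Bal, v1, v2, e, m1, m2, c1, c2, de, d1, d2, d3, d4],
       [Rel [TC Up, v1, v2, e, m1, m2, c1, c2, ae, a1, a2, a3, a4],
        Rel [TC Bal, v1, v2, ae, a1, a2, a3, a4, be, b1, b2, b3, b4],
        Rel [TC Down, v1, v2, be, b1, b2, b3, b4, de, d1, d2, d3, d4]]),
     ([TC Bal, v1, v2, e, m1, m2, c1, c2, de, d1, d2, d3, d4],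
       [Rel [TC Down, v1, v2, e, m1, m2, c1, c2, ae, a1, a2, a3, a4],
        Rel [TC Bal, v1, v2, ae, a1, a2, a3, a4, be, b1, b2, b3, b4],
        Rel [TC Up, v1, v2, be, b1, b2, b3, b4, de, d1, d2, d3, d4]]),
     ([TC Bal, v1, v2, e, m1, m2, c1, c2, be, b1, b2, b3, b4],
       [Rel [TC Bal, v1, v2, e, m1, m2, c1, c2, ae, a1, a2, a3, a4],
        Rel [TC Bal, v1, v2, ae, a1, a2, a3, a4, be, b1, b2, b3, b4]]),
     ([TC Same, a1, b1], [Bit False a1, Bit False b1, Sc a1 a2, Sc b1 b2, Rel [TC Eq, a2, a3, b2, b3]]),
     ([TC Init, v1, v2, TC 0, c1], [Rel [TC Header, c1, x, y], Rel [TC Eq, v1, z, v1, z], Rel [TC Eq, v2, u, v2, u]]),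
     ([TC Init, v1, v2, TC 2, c1], [Rel [TC Header, c1, x, y], Rel [TC Eq, v1, z, v1, z], Rel [TC Eq, v2, u, v2, u],
        Rel [TC Neq, v1, v2]]),
     ([TC Goal], [Rel [TC Init, v1, v2, e, c1], Rel [TC Bal, v1, v2, e, TC 0, TC 0, c1, c1, x, TC 1, TC 1, a1, a2],
        Rel [TC Acc, a1], Rel [TC Pstep, v1, v2, x, TC 1, TC 1, a1, a2, ae, m1, m2, a3, a4],
        Rel [TC Bal, v1, v2, ae, m1, m2, a3, a4, x, TC 1, TC 1, b1, b2],
        Rel [TC Acc, b2], Rel [TC Pstep, v1, v2, x, TC 1, TC 1, b1, b2, be, y, z, b3, b4],
        Rel [TC Bal, v1, v2, be, y, z, b3, b4, x, TC 1, TC 1, d1, d2], Rel [TC Same, a1, d1], Rel [TC Same, a2, d2]])])"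

definition program :: "rule list" where
  "program = P_numbers @ P_lists @ P_transitions @ P_edges @ P_lasso"

lemmas P_defs = P_numbers_def P_lists_def P_transitions_def P_edges_def P_lasso_def

text \<open>The arity 13 is that of an edge: the name, v1, v2 and two nodes of five numbers
  each.\<close>

lemma wf_program: "list_all (wfr 26 23 13) program"
  unfolding program_def P_defs Let_def by (simp add: wfr_def)

subsection \<open>Soundness of the program\<close>

definition enc_cell :: "('b::finite) \<times> nat \<Rightarrow> bool list" where
  "enc_cell = (\<lambda>(\<gamma>, r). enc_nat (to_nat \<gamma>) @ enc_nat r)"

locale encoded_nrt =
  fixes T :: "('a::finite, 'b::finite, nat, nat) nrt" and w :: "bool list"
    and ts :: "('a, 'b, nat, nat) transition list"
  assumes nrt: "is_nrt T" and test_free: "test_free T" and ts: "set ts = transitions T"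
    and w: "w = enc_set (states T) @ enc_set (registers T) @ enc_nat (initial T) @
            enc_set (accepting T) @ enc_list enc_transition ts"
begin

sublocale coded_nrt T "\<lambda>\<gamma>::'b. enc_nat (to_nat \<gamma>)" enc_nat
proof
  show "inj (\<lambda>\<gamma>::'b. enc_nat (to_nat \<gamma>))"
    using inj_compose[OF inj_enc_nat, of "to_nat :: 'b \<Rightarrow> nat"] by (simp add: comp_def inj_def)
qed (use nrt inj_enc_nat in auto)

abbreviation N :: nat where "N \<equiv> length w + 23"

text \<open>What remains of an output, followed by the target state, is a suffix of the code of a
  transition, so a position in w represents it and there are only polynomially many nodes.\<close>

definition dec :: "nat \<Rightarrow> ('b, nat, nat) side \<Rightarrow> bool" where
  "dec c X \<longleftrightarrow> (\<exists>f l. seg w c (enc_list enc_cell (fst X)) f \<and> seg w f (enc_nat (snd X)) l)"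

text \<open>Facts are also derived at positions where no code starts, so most of the meanings are conditional on what
  can be read at the positions.\<close>

definition Eq_sem :: "nat \<Rightarrow> nat \<Rightarrow> nat \<Rightarrow> nat \<Rightarrow> bool" where
  "Eq_sem p p' q q' \<longleftrightarrow> (\<exists>u. raw u \<and> seg w p u p' \<and> seg w q u q')"

definition Neq_sem :: "nat \<Rightarrow> nat \<Rightarrow> bool" where
  "Neq_sem p q \<longleftrightarrow> (\<forall>u. code w p u \<longrightarrow> \<not> code w q u)"

definition Skip_sem :: "nat \<Rightarrow> nat \<Rightarrow> bool" where
  "Skip_sem p q \<longleftrightarrow> (\<forall>us q'. (\<forall>u\<in>set us. raw u) \<longrightarrow> seg w p (enc_list id us) q' \<longrightarrow> q' = q)"

definition Elem_sem :: "nat \<Rightarrow> nat \<Rightarrow> bool" where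
  "Elem_sem p x \<longleftrightarrow> (\<forall>us q. (\<forall>u\<in>set us. raw u) \<longrightarrow> seg w p (enc_list id us) q \<longrightarrow> (\<exists>u\<in>set us. code w x u))"

definition Notin_sem :: "nat \<Rightarrow> nat \<Rightarrow> bool" where
  "Notin_sem p x \<longleftrightarrow> (\<forall>us q u. (\<forall>u\<in>set us. raw u) \<longrightarrow> seg w p (enc_list id us) q \<longrightarrow> code w x u \<longrightarrow> u \<notin> set us)"

definition Header_sem :: "nat \<Rightarrow> nat \<Rightarrow> nat \<Rightarrow> bool" where
  "Header_sem c f l \<longleftrightarrow> dec c ([], initial T) \<and> (\<exists>x. seg w f (enc_set (accepting T)) x) \<and>
     seg w l (enc_list enc_transition ts) (length w)"

definition Outs_sem :: "nat \<Rightarrow> nat \<Rightarrow> bool" where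
  "Outs_sem d f \<longleftrightarrow> (\<forall>os f'. seg w d (enc_list enc_cell (os :: ('b \<times> nat) list)) f' \<longrightarrow> f' = f)"

definition Cell_sem :: "nat \<Rightarrow> nat \<Rightarrow> nat \<Rightarrow> nat \<Rightarrow> bool" where
  "Cell_sem d g r d' \<longleftrightarrow> d < length w \<and> w ! d \<and> g = Suc d \<and>
     (\<exists>u v. raw u \<and> raw v \<and> seg w g u r \<and> seg w r v d')"

definition at_transition :: "nat \<Rightarrow> ('a, 'b, nat, nat) transition \<Rightarrow> nat \<Rightarrow> nat \<Rightarrow> nat \<Rightarrow> bool" where
  "at_transition t tr a s d \<longleftrightarrow> seg w t (enc_nat (src tr)) a \<and> code w a (enc_nat (to_nat (lab tr))) \<and>
     (\<exists>x. seg w s (enc_set (asg tr)) x) \<and> dec d (out tr, tgt tr)"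

definition Parse_sem :: "nat \<Rightarrow> nat \<Rightarrow> nat \<Rightarrow> nat \<Rightarrow> nat \<Rightarrow> bool" where
  "Parse_sem t a s d l \<longleftrightarrow> (\<forall>tr\<in>transitions T. \<forall>l'. seg w t (enc_transition tr) l' \<longrightarrow>
     l' = l \<and> at_transition t tr a s d)"

definition Tail_sem :: "nat \<Rightarrow> bool" where
  "Tail_sem l \<longleftrightarrow> (\<exists>us. set us \<subseteq> transitions T \<and> seg w l (enc_list enc_transition us) (length w))"

definition Trans_sem :: "nat \<Rightarrow> nat \<Rightarrow> nat \<Rightarrow> nat \<Rightarrow> bool" where
  "Trans_sem t a s d \<longleftrightarrow> (\<exists>tr\<in>transitions T. at_transition t tr a s d)"

definition Acc_sem :: "nat \<Rightarrow> bool" where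
  "Acc_sem c \<longleftrightarrow> (\<forall>os q. dec c (os, q) \<longrightarrow> q \<in> accepting T)"

type_synonym pnode = "nat \<times> nat \<times> nat \<times> nat \<times> nat"

definition decn :: "pnode \<Rightarrow> ('b, nat, nat) node \<Rightarrow> bool" where
  "decn = (\<lambda>(e, m1, m2, c1, c2) (e', m1', m2', X1, X2). e = e' \<and> m1 = m1' \<and> m2 = m2' \<and>
     dec c1 X1 \<and> dec c2 X2)"

text \<open>Universal for the source and existential for the target, so that facts compose along a
  walk from a node known to be decoded.\<close>

definition lift_sem :: "(bool list \<Rightarrow> bool list \<Rightarrow> ('b, nat, nat) node \<Rightarrow> ('b, nat, nat) node \<Rightarrow> bool) \<Rightarrow>
    nat \<Rightarrow> nat \<Rightarrow> pnode \<Rightarrow> pnode \<Rightarrow> bool" where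
  "lift_sem R v1 v2 n n' \<longleftrightarrow> (\<forall>u1 u2 x. code w v1 u1 \<longrightarrow> code w v2 u2 \<longrightarrow> decn n x \<longrightarrow>
     (\<exists>y. decn n' y \<and> R u1 u2 x y))"

definition Free_sem :: "nat \<Rightarrow> nat \<Rightarrow> nat \<Rightarrow> bool" where
  "Free_sem v1 m1 s \<longleftrightarrow> (\<forall>u1 A q. code w v1 u1 \<longrightarrow> finite A \<longrightarrow> seg w s (enc_set A) q \<longrightarrow> m1 = 1 \<or> \<not> has_reg u1 A)"

definition Adm_sem :: "nat \<Rightarrow> nat \<Rightarrow> nat \<Rightarrow> nat \<Rightarrow> nat \<Rightarrow> nat \<Rightarrow> nat \<Rightarrow> bool" where
  "Adm_sem v1 v2 e m1 e' s1 s2 \<longleftrightarrow> (\<forall>u1 u2 A1 A2 q1 q2. code w v1 u1 \<longrightarrow> code w v2 u2 \<longrightarrow> finite A1 \<longrightarrow> finite A2 \<longrightarrow>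
     seg w s1 (enc_set A1) q1 \<longrightarrow> seg w s2 (enc_set A2) q2 \<longrightarrow> admissible u1 u2 e m1 e' A1 A2)"

definition Same_sem :: "nat \<Rightarrow> nat \<Rightarrow> bool" where
  "Same_sem c c' \<longleftrightarrow> (\<forall>X X'. dec c X \<longrightarrow> dec c' X' \<longrightarrow> X = X')"

text \<open>Here existence is asserted: this starts the chain of conditional meanings in a proof of
  the goal.\<close>

definition Init_sem :: "nat \<Rightarrow> nat \<Rightarrow> nat \<Rightarrow> nat \<Rightarrow> bool" where
  "Init_sem v1 v2 e c \<longleftrightarrow> (\<exists>u1 u2. code w v1 u1 \<and> code w v2 u2 \<and> (e = 0 \<or> e = 2 \<and> u1 \<noteq> u2)) \<and> dec c ([], initial T)"

definition meaning :: "nat list \<Rightarrow> bool" where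
  "meaning f \<longleftrightarrow>
     (\<forall>p p' q q'. f = [Eq, p, p', q, q'] \<longrightarrow> Eq_sem p p' q q') \<and>
     (\<forall>p q. f = [Neq, p, q] \<longrightarrow> Neq_sem p q) \<and>
     (\<forall>p q. f = [Skip, p, q] \<longrightarrow> Skip_sem p q) \<and>
     (\<forall>p q. f = [Elem, p, q] \<longrightarrow> Elem_sem p q) \<and>
     (\<forall>p q. f = [Notin, p, q] \<longrightarrow> Notin_sem p q) \<and>
     (\<forall>p q r. f = [Header, p, q, r] \<longrightarrow> Header_sem p q r) \<and>
     (\<forall>p q. f = [Outs, p, q] \<longrightarrow> Outs_sem p q) \<and>
     (\<forall>p q r s. f = [Cell, p, q, r, s] \<longrightarrow> Cell_sem p q r s) \<and>
     (\<forall>p q r s t. f = [Parse, p, q, r, s, t] \<longrightarrow> Parse_sem p q r s t) \<and>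
     (\<forall>p. f = [Tail, p] \<longrightarrow> Tail_sem p) \<and>
     (\<forall>p q r s. f = [Trans, p, q, r, s] \<longrightarrow> Trans_sem p q r s) \<and>
     (\<forall>p. f = [Acc, p] \<longrightarrow> Acc_sem p) \<and>
     (\<forall>v1 v2 e m1 m2 c1 c2 e' m1' m2' c1' c2'. f = [Flat, v1, v2, e, m1, m2, c1, c2, e', m1', m2', c1', c2'] \<longrightarrow>
        lift_sem (\<lambda>u1 u2. edge u1 u2 0) v1 v2 (e, m1, m2, c1, c2) (e', m1', m2', c1', c2')) \<and>
     (\<forall>v1 v2 e m1 m2 c1 c2 e' m1' m2' c1' c2'. f = [Up, v1, v2, e, m1, m2, c1, c2, e', m1', m2', c1', c2'] \<longrightarrow>
        lift_sem (\<lambda>u1 u2. edge u1 u2 1) v1 v2 (e, m1, m2, c1, c2) (e', m1', m2', c1', c2')) \<and>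
     (\<forall>v1 v2 e m1 m2 c1 c2 e' m1' m2' c1' c2'. f = [Down, v1, v2, e, m1, m2, c1, c2, e', m1', m2', c1', c2'] \<longrightarrow>
        lift_sem (\<lambda>u1 u2. edge u1 u2 (- 1)) v1 v2 (e, m1, m2, c1, c2) (e', m1', m2', c1', c2')) \<and>
     (\<forall>v1 v2 e m1 m2 c1 c2 e' m1' m2' c1' c2'. f = [Pstep, v1, v2, e, m1, m2, c1, c2, e', m1', m2', c1', c2'] \<longrightarrow>
        lift_sem pstep v1 v2 (e, m1, m2, c1, c2) (e', m1', m2', c1', c2')) \<and>
     (\<forall>v1 v2 e m1 m2 c1 c2 e' m1' m2' c1' c2'. f = [Bal, v1, v2, e, m1, m2, c1, c2, e', m1', m2', c1', c2'] \<longrightarrow>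
        lift_sem (\<lambda>u1 u2. balanced (edge u1 u2)) v1 v2 (e, m1, m2, c1, c2) (e', m1', m2', c1', c2')) \<and>
     (\<forall>p q r. f = [Free, p, q, r] \<longrightarrow> Free_sem p q r) \<and>
     (\<forall>v1 v2 e m1 e' s1 s2. f = [Adm, v1, v2, e, m1, e', s1, s2] \<longrightarrow> Adm_sem v1 v2 e m1 e' s1 s2) \<and>
     (\<forall>p q. f = [Same, p, q] \<longrightarrow> Same_sem p q) \<and>
     (\<forall>v1 v2 e c. f = [Init, v1, v2, e, c] \<longrightarrow> Init_sem v1 v2 e c) \<and>
     (f = [Goal] \<longrightarrow> has_lasso UNIV)"

lemma meaning_simps:
  "meaning [Eq, p, p', q, q'] \<longleftrightarrow> Eq_sem p p' q q'"
  "meaning [Neq, p, q] \<longleftrightarrow> Neq_sem p q"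
  "meaning [Skip, p, q] \<longleftrightarrow> Skip_sem p q"
  "meaning [Elem, p, q] \<longleftrightarrow> Elem_sem p q"
  "meaning [Notin, p, q] \<longleftrightarrow> Notin_sem p q"
  "meaning [Header, p, q, r] \<longleftrightarrow> Header_sem p q r"
  "meaning [Outs, p, q] \<longleftrightarrow> Outs_sem p q"
  "meaning [Cell, p, q, r, s] \<longleftrightarrow> Cell_sem p q r s"
  "meaning [Parse, p, q, r, s, t] \<longleftrightarrow> Parse_sem p q r s t"
  "meaning [Tail, p] \<longleftrightarrow> Tail_sem p"
  "meaning [Trans, p, q, r, s] \<longleftrightarrow> Trans_sem p q r s"
  "meaning [Acc, p] \<longleftrightarrow> Acc_sem p"
  "meaning [Flat, v1, v2, e, m1, m2, c1, c2, e', m1', m2', c1', c2'] \<longleftrightarrow>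
     lift_sem (\<lambda>u1 u2. edge u1 u2 0) v1 v2 (e, m1, m2, c1, c2) (e', m1', m2', c1', c2')"
  "meaning [Up, v1, v2, e, m1, m2, c1, c2, e', m1', m2', c1', c2'] \<longleftrightarrow>
     lift_sem (\<lambda>u1 u2. edge u1 u2 1) v1 v2 (e, m1, m2, c1, c2) (e', m1', m2', c1', c2')"
  "meaning [Down, v1, v2, e, m1, m2, c1, c2, e', m1', m2', c1', c2'] \<longleftrightarrow>
     lift_sem (\<lambda>u1 u2. edge u1 u2 (- 1)) v1 v2 (e, m1, m2, c1, c2) (e', m1', m2', c1', c2')"
  "meaning [Pstep, v1, v2, e, m1, m2, c1, c2, e', m1', m2', c1', c2'] \<longleftrightarrow>
     lift_sem pstep v1 v2 (e, m1, m2, c1, c2) (e', m1', m2', c1', c2')"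
  "meaning [Bal, v1, v2, e, m1, m2, c1, c2, e', m1', m2', c1', c2'] \<longleftrightarrow>
     lift_sem (\<lambda>u1 u2. balanced (edge u1 u2)) v1 v2 (e, m1, m2, c1, c2) (e', m1', m2', c1', c2')"
  "meaning [Free, p, q, r] \<longleftrightarrow> Free_sem p q r"
  "meaning [Adm, v1, v2, e, m1, e', s1, s2] \<longleftrightarrow> Adm_sem v1 v2 e m1 e' s1 s2"
  "meaning [Same, p, q] \<longleftrightarrow> Same_sem p q"
  "meaning [Init, v1, v2, e, c] \<longleftrightarrow> Init_sem v1 v2 e c"
  "meaning [Goal] \<longleftrightarrow> has_lasso UNIV"
  by (simp_all add: meaning_def)

definition sound :: "rule \<Rightarrow> bool" where
  "sound rl \<longleftrightarrow> (\<forall>e. list_all (holds w meaning e) (snd rl) \<longrightarrow> meaning (map (tval e) (fst rl)))"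

section \<open>Soundness of the rules that read the code\<close>

lemma Neq_sem_step:
  assumes "w ! p" "w ! q"
    and "Suc p < length w \<and> Suc q < length w \<and> w ! Suc p \<noteq> w ! Suc q \<or> Neq_sem (Suc (Suc p)) (Suc (Suc q))"
  shows "Neq_sem p q"
  unfolding Neq_sem_def
proof (intro allI impI notI)
  fix u assume u: "code w p u" "code w q u"
  then have "raw u" by (simp add: code_def)
  then show False
  proof cases
    case (raw_bit u' b)
    then show False using u assms by (auto simp: code_def Neq_sem_def)
  qed (use u assms in \<open>auto simp: code_def\<close>)
qed

lemma Neq_sem_end: "w ! p \<noteq> w ! q \<Longrightarrow> Neq_sem p q"
  unfolding Neq_sem_def
proof (intro allI impI notI)
  fix u assume u: "w ! p \<noteq> w ! q" "code w p u" "code w q u"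
  then have "raw u" by (simp add: code_def)
  then show False by cases (use u in \<open>auto simp: code_def\<close>)
qed

lemma sound_numbers: "list_all sound P_numbers"
  unfolding P_numbers_def Let_def
  by (simp add: sound_def meaning_simps[simplified], intro conjI allI impI; (elim conjE)?)
     (auto simp: Eq_sem_def intro: raw.intros Neq_sem_step Neq_sem_end)

lemma Eq_code: "Eq_sem p p' q q' \<Longrightarrow> code w p u \<Longrightarrow> code w q u' \<Longrightarrow> u = u'"
  unfolding Eq_sem_def code_def using raw_unique by metis

lemma Eq_seg: "Eq_sem p p' q q' \<Longrightarrow> raw u \<Longrightarrow> seg w p u m \<Longrightarrow> m = p'"
  unfolding Eq_sem_def using raw_unique by metis

lemma seg_list_True:
  assumes "seg w p (enc_list f us) q" "w ! p"
  obtains u us' m where "us = u # us'" "seg w (Suc p) (f u) m" "seg w m (enc_list f us') q"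
  using assms by (cases us) (auto simp: seg_append)

lemma seg_list_False: "seg w p (enc_list f us) q \<Longrightarrow> \<not> w ! p \<Longrightarrow> us = [] \<and> q = Suc p"
  by (cases us) auto

lemma Skip_sem_end: "\<not> w ! p \<Longrightarrow> Skip_sem p (Suc p)"
  unfolding Skip_sem_def using seg_list_False by blast

lemma Skip_sem_step:
  assumes "w ! p" "Eq_sem (Suc p) y (Suc p) y" "Skip_sem y q"
  shows "Skip_sem p q"
  unfolding Skip_sem_def
proof (intro allI impI)
  fix us q' assume us: "\<forall>u\<in>set us. raw u" "seg w p (enc_list id us) q'"
  then obtain u us' m where u: "us = u # us'" "seg w (Suc p) u m" "seg w m (enc_list id us') q'"
    using assms(1) by (auto elim: seg_list_True)
  then have "m = y" using Eq_seg[OF assms(2), of u m] us by simp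
  then have "seg w y (enc_list id us') q'" "\<forall>u\<in>set us'. raw u" using u us by auto
  then show "q' = q" using assms(3) unfolding Skip_sem_def by blast
qed

lemma Elem_sem_end: "w ! p \<Longrightarrow> Elem_sem p (Suc p)"
  unfolding Elem_sem_def
proof (intro allI impI)
  fix us q' assume us: "w ! p" "\<forall>u\<in>set us. raw u" "seg w p (enc_list id us) q'"
  from seg_list_True[OF us(3,1)] obtain u us' m where "us = u # us'" "seg w (Suc p) (id u) m" by metis
  then show "\<exists>u\<in>set us. code w (Suc p) u" using us(2) by (auto intro: code_seg)
qed

lemma Elem_sem_step:
  assumes "w ! p" "Eq_sem (Suc p) z (Suc p) z" "Elem_sem z x"
  shows "Elem_sem p x"
  unfolding Elem_sem_def
proof (intro allI impI)
  fix us q' assume us: "\<forall>u\<in>set us. raw u" "seg w p (enc_list id us) q'"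
  then obtain u us' m where u: "us = u # us'" "seg w (Suc p) u m" "seg w m (enc_list id us') q'"
    using assms(1) by (auto elim: seg_list_True)
  then have "m = z" using Eq_seg[OF assms(2), of u m] us by simp
  then have "seg w z (enc_list id us') q'" "\<forall>u\<in>set us'. raw u" using u us by auto
  then have "\<exists>u\<in>set us'. code w x u" using assms(3) unfolding Elem_sem_def by blast
  then show "\<exists>u\<in>set us. code w x u" using u by auto
qed

lemma Notin_sem_end: "\<not> w ! p \<Longrightarrow> Notin_sem p x"
  unfolding Notin_sem_def using seg_list_False by fastforce

lemma Notin_sem_step:
  assumes "w ! p" "Neq_sem (Suc p) x" "Eq_sem (Suc p) z (Suc p) z" "Notin_sem z x"
  shows "Notin_sem p x"
  unfolding Notin_sem_def
proof (intro allI impI)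
  fix us q' v assume us: "\<forall>u\<in>set us. raw u" "seg w p (enc_list id us) q'" and v: "code w x v"
  then obtain u us' m where u: "us = u # us'" "seg w (Suc p) u m" "seg w m (enc_list id us') q'"
    using assms(1) by (auto elim: seg_list_True)
  then have "m = z" using Eq_seg[OF assms(3), of u m] us by simp
  then have "seg w z (enc_list id us') q'" "\<forall>u\<in>set us'. raw u" using u us by auto
  then have "v \<notin> set us'" using assms(4) v unfolding Notin_sem_def by blast
  moreover have "code w (Suc p) u" using u us by (intro code_seg) auto
  then have "v \<noteq> u" using assms(2) v unfolding Neq_sem_def by blast
  ultimately show "v \<notin> set us" using u by simp
qed

lemma sound_lists: "list_all sound P_lists"
  unfolding P_lists_def Let_def
  by (simp add: sound_def meaning_simps[simplified], intro conjI allI impI; (elim conjE)?)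
     (auto intro: Skip_sem_end Skip_sem_step Elem_sem_end Elem_sem_step Notin_sem_end Notin_sem_step)

lemma enc_set_list: "enc_set A = enc_list id (map enc_nat (sorted_list_of_set A))"
  unfolding enc_set_def by (rule enc_list_map)

lemma raw_map: "\<forall>u\<in>set (map enc_nat ns). raw u"
  by (auto intro: raw_enc_nat)

lemma Skip_set: "Skip_sem p q \<Longrightarrow> seg w p (enc_set A) q' \<Longrightarrow> q' = q"
  unfolding Skip_sem_def enc_set_list using raw_map by blast

lemma Elem_set: "Elem_sem p x \<Longrightarrow> seg w p (enc_set A) q \<Longrightarrow> finite A \<Longrightarrow> \<exists>a\<in>A. code w x (enc_nat a)"
  unfolding Elem_sem_def enc_set_list using raw_map[of "sorted_list_of_set A"] by fastforce

lemma Notin_set: "Notin_sem p x \<Longrightarrow> seg w p (enc_set A) q \<Longrightarrow> finite A \<Longrightarrow> code w x u \<Longrightarrow> u \<notin> enc_nat ` A"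
  unfolding Notin_sem_def enc_set_list using raw_map[of "sorted_list_of_set A"] by fastforce

lemma layout:
  obtains p q f l where "seg w 0 (enc_set (states T)) p" "seg w p (enc_set (registers T)) q"
    "seg w q (enc_nat (initial T)) f" "seg w f (enc_set (accepting T)) l"
    "seg w l (enc_list enc_transition ts) (length w)"
proof -
  have "seg w 0 w (length w)" using seg_drop[of "[]" w "[]"] by simp
  then have "seg w 0 (enc_set (states T) @ enc_set (registers T) @ enc_nat (initial T) @
            enc_set (accepting T) @ enc_list enc_transition ts) (length w)" using w by metis
  then show ?thesis unfolding seg_append using that by blast
qed

lemma Header_sem_I:
  assumes "Skip_sem 0 p" "Skip_sem p (Suc c)" "Eq_sem (Suc c) f (Suc c) f" "Skip_sem f l"
  shows "Header_sem c f l"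
proof -
  obtain p' q' f' l' where s: "seg w 0 (enc_set (states T)) p'" "seg w p' (enc_set (registers T)) q'"
    "seg w q' (enc_nat (initial T)) f'" "seg w f' (enc_set (accepting T)) l'"
    "seg w l' (enc_list enc_transition ts) (length w)" by (rule layout)
  have p: "p' = p" using Skip_set assms(1) s(1) by blast
  have q: "q' = Suc c" using Skip_set assms(2) s(2) p by blast
  have f: "f' = f" using Eq_seg[OF assms(3) raw_enc_nat] s(3) q by blast
  have l: "l' = l" using Skip_set assms(4) s(4) f by blast
  \<comment> \<open>The code of a list ends with False, which is the bit at position c.\<close>
  obtain u where "enc_set (registers T) = u @ [False]"
    using enc_list_last unfolding enc_set_def by blast
  then have "seg w c [False] (Suc c)" using s(2) q by (auto simp: seg_append)
  then show ?thesis using s q f l by (auto simp: Header_sem_def dec_def)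
qed

lemma Cell_sem_I:
  "d < length w \<Longrightarrow> w ! d \<Longrightarrow> Eq_sem (Suc d) r (Suc d) r \<Longrightarrow> Eq_sem r d' r d' \<Longrightarrow> Cell_sem d (Suc d) r d'"
  unfolding Cell_sem_def Eq_sem_def by blast

lemma Cell_list:
  assumes "Cell_sem d g r d'" "seg w d (enc_list enc_cell os) f"
  obtains \<gamma> \<rho> os' where "os = (\<gamma>, \<rho>) # os'" "code w g (enc_nat (to_nat \<gamma>))" "code w r (enc_nat \<rho>)"
    "seg w d' (enc_list enc_cell os') f"
proof -
  obtain u v where uv: "w ! d" "g = Suc d" "raw u" "raw v" "seg w g u r" "seg w r v d'"
    using assms(1) by (auto simp: Cell_sem_def)
  from seg_list_True[OF assms(2) uv(1)] obtain c os' m where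
    c: "os = c # os'" "seg w (Suc d) (enc_cell c) m" "seg w m (enc_list enc_cell os') f" by metis
  obtain \<gamma> \<rho> where c': "c = (\<gamma>, \<rho>)" by (cases c)
  then obtain k where k: "seg w g (enc_nat (to_nat \<gamma>)) k" "seg w k (enc_nat \<rho>) m"
    using c uv(2) by (auto simp: enc_cell_def seg_append)
  then have "k = r" using raw_unique[OF raw_enc_nat uv(3) k(1) uv(5)] by simp
  moreover have "m = d'" using raw_unique[OF raw_enc_nat uv(4), of w r _ m] k uv(6) \<open>k = r\<close> by blast
  ultimately show ?thesis using that[of \<gamma> \<rho> os'] c c' k by (auto intro: code_seg raw_enc_nat)
qed

lemma Outs_sem_end: "\<not> w ! d \<Longrightarrow> Outs_sem d (Suc d)"
  unfolding Outs_sem_def using seg_list_False by blast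

lemma Outs_sem_step: "Cell_sem d g r d' \<Longrightarrow> Outs_sem d' f \<Longrightarrow> Outs_sem d f"
  unfolding Outs_sem_def by (metis Cell_list)

lemma Parse_sem_I:
  assumes "Eq_sem t a t a" "Eq_sem a b a b" "Skip_sem (Suc b) d" "Outs_sem d f" "Eq_sem f l f l"
  shows "Parse_sem t a (Suc b) d l"
  unfolding Parse_sem_def
proof (intro ballI allI impI)
  fix tr l' assume tr: "tr \<in> transitions T" and s: "seg w t (enc_transition tr) l'"
  obtain q \<sigma> \<phi> A os q' where tr': "tr = (q, \<sigma>, \<phi>, A, os, q')" by (cases tr) auto
  have phi: "\<phi> = TTop" using test_free tr tr' by (auto simp: test_free_def)
  \<comment> \<open>In a test-free transducer every test is coded by this single bit, which accounts
    for the successor of b.\<close>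
  have "enc_nat 0 = [False]" by (subst enc_nat.simps) simp
  then obtain a' b' d' f' where s: "seg w t (enc_nat q) a'" "seg w a' (enc_nat (to_nat \<sigma>)) b'"
    "seg w (Suc b') (enc_set A) d'" "seg w d' (enc_list enc_cell os) f'" "seg w f' (enc_nat q') l'"
    using s by (auto simp: tr' phi seg_append enc_cell_def)
  have a: "a' = a" using Eq_seg[OF assms(1) raw_enc_nat s(1)] .
  have b: "b' = b" using Eq_seg[OF assms(2) raw_enc_nat] s(2) a by blast
  have d: "d' = d" using Skip_set[OF assms(3)] s(3) b by blast
  have f: "f' = f" using assms(4) s(4) d by (auto simp: Outs_sem_def)
  have l: "l' = l" using Eq_seg[OF assms(5) raw_enc_nat] s(5) f by blast
  show "l' = l \<and> at_transition t tr a (Suc b) d"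
    using s a b d f l by (auto simp: at_transition_def tr' dec_def code_def raw_enc_nat)
qed

lemma Header_Tail: "Header_sem c f l \<Longrightarrow> Tail_sem l"
  unfolding Header_sem_def Tail_sem_def using ts by blast

text \<open>At a genuine list position the conditional meaning of \<open>Parse\<close> applies to an
  actual transition and yields the unconditional one of \<open>Trans\<close>.\<close>

lemma Tail_Parse:
  assumes "Tail_sem l" "w ! l" "Parse_sem (Suc l) a s d l'"
  shows "Tail_sem l'" "Trans_sem (Suc l) a s d"
proof -
  obtain us where us: "set us \<subseteq> transitions T" "seg w l (enc_list enc_transition us) (length w)"
    using assms(1) by (auto simp: Tail_sem_def)
  from seg_list_True[OF us(2) assms(2)] obtain tr us' m where
    u: "us = tr # us'" "seg w (Suc l) (enc_transition tr) m" "seg w m (enc_list enc_transition us') (length w)" by metis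
  have "tr \<in> transitions T" using u(1) us(1) by simp
  then have "m = l' \<and> at_transition (Suc l) tr a s d" using assms(3) u(2) unfolding Parse_sem_def by blast
  then show "Tail_sem l'" "Trans_sem (Suc l) a s d" using u us by (auto simp: Tail_sem_def Trans_sem_def)
qed

lemma Acc_sem_I:
  assumes "Outs_sem c f" "Header_sem p q l" "Elem_sem q x" "Eq_sem f y x z"
  shows "Acc_sem c"
  unfolding Acc_sem_def
proof (intro allI impI)
  fix os r assume "dec c (os, r)"
  then have r: "code w f (enc_nat r)" using assms(1) by (auto simp: dec_def Outs_sem_def code_def raw_enc_nat)
  have "finite (accepting T)" using nrt by (auto simp: is_nrt_def intro: finite_subset)
  then obtain a where "a \<in> accepting T" "code w x (enc_nat a)"
    using Elem_set[OF assms(3)] assms(2) by (auto simp: Header_sem_def)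
  then show "r \<in> accepting T" using Eq_code[OF assms(4) r] inj_enc_nat by (auto dest: injD)
qed

lemma sound_transitions: "list_all sound P_transitions"
  unfolding P_transitions_def Let_def
  by (simp add: sound_def meaning_simps[simplified], intro conjI allI impI; (elim conjE)?)
     (auto intro: Header_sem_I Cell_sem_I Outs_sem_end Outs_sem_step Parse_sem_I Header_Tail Tail_Parse Acc_sem_I)

section \<open>Soundness of the rules for the counter graph\<close>

lemma Cell_dec:
  assumes "Cell_sem d g r d'" "dec d X"
  obtains \<gamma> \<rho> os q where "X = ((\<gamma>, \<rho>) # os, q)" "code w g (enc_nat (to_nat \<gamma>))" "code w r (enc_nat \<rho>)"
    "dec d' (os, q)"
proof -
  obtain f l where f: "seg w d (enc_list enc_cell (fst X)) f" "seg w f (enc_nat (snd X)) l"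
    using assms(2) by (auto simp: dec_def)
  from Cell_list[OF assms(1) f(1)] obtain \<gamma> \<rho> os' where "fst X = (\<gamma>, \<rho>) # os'"
    "code w g (enc_nat (to_nat \<gamma>))" "code w r (enc_nat \<rho>)" "seg w d' (enc_list enc_cell os') f" by metis
  then show ?thesis using that[of \<gamma> \<rho> os' "snd X"] f(2) by (cases X) (auto simp: dec_def)
qed

lemma dec_end:
  assumes "dec c X" "\<not> w ! c"
  obtains q where "X = ([], q)" "code w (Suc c) (enc_nat q)"
proof -
  obtain f l where f: "seg w c (enc_list enc_cell (fst X)) f" "seg w f (enc_nat (snd X)) l"
    using assms(1) by (auto simp: dec_def)
  then have "fst X = []" "f = Suc c" using seg_list_False[OF f(1) assms(2)] by auto
  then show ?thesis using that[of "snd X"] f(2) by (cases X) (auto intro: code_seg raw_enc_nat)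
qed

lemma lift_semI:
  assumes "\<And>u1 u2 X1 X2. code w v1 u1 \<Longrightarrow> code w v2 u2 \<Longrightarrow> dec c1 X1 \<Longrightarrow> dec c2 X2 \<Longrightarrow>
    \<exists>Y1 Y2. dec d1 Y1 \<and> dec d2 Y2 \<and> R u1 u2 (e, m1, m2, X1, X2) (e', m1', m2', Y1, Y2)"
  shows "lift_sem R v1 v2 (e, m1, m2, c1, c2) (e', m1', m2', d1, d2)"
  unfolding lift_sem_def
proof (intro allI impI)
  fix u1 u2 x assume u: "code w v1 u1" "code w v2 u2" "decn (e, m1, m2, c1, c2) x"
  then obtain X1 X2 where x: "x = (e, m1, m2, X1, X2)" "dec c1 X1" "dec c2 X2"
    unfolding decn_def by (cases x) auto
  obtain Y1 Y2 where "dec d1 Y1" "dec d2 Y2" "R u1 u2 (e, m1, m2, X1, X2) (e', m1', m2', Y1, Y2)"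
    using assms[OF u(1,2) x(2,3)] by blast
  then show "\<exists>y. decn (e', m1', m2', d1, d2) y \<and> R u1 u2 x y"
    unfolding x(1) decn_def by (intro exI[of _ "(e', m1', m2', Y1, Y2)"]) simp
qed

lemma Up_I: "Cell_sem c1 g r d1 \<Longrightarrow>
    lift_sem (\<lambda>u1 u2. edge u1 u2 1) v1 v2 (e, 0, m2, c1, c2) (e, 0, m2, d1, c2)"
  by (rule lift_semI, erule (1) Cell_dec) (blast intro: emit1)

lemma Down_I: "Cell_sem c2 g r d2 \<Longrightarrow>
    lift_sem (\<lambda>u1 u2. edge u1 u2 (- 1)) v1 v2 (e, m1, 0, c1, c2) (e, m1, 0, c1, d2)"
  by (rule lift_semI, erule (1) Cell_dec) (blast intro: emit2)

lemma Flat_skip1: "Cell_sem c1 g r d1 \<Longrightarrow>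
    lift_sem (\<lambda>u1 u2. edge u1 u2 0) v1 v2 (e, 1, m2, c1, c2) (e, 1, m2, d1, c2)"
  by (rule lift_semI, erule (1) Cell_dec) (blast intro: skip1)

lemma Flat_skip2: "Cell_sem c2 g r d2 \<Longrightarrow>
    lift_sem (\<lambda>u1 u2. edge u1 u2 0) v1 v2 (e, m1, 1, c1, c2) (e, m1, 1, c1, d2)"
  by (rule lift_semI, erule (1) Cell_dec) (blast intro: skip2)

lemma Flat_mark1:
  assumes c: "Cell_sem c1 g r d1" and eq: "Eq_sem (if e = 2 then g else r) x v1 y"
  shows "lift_sem (\<lambda>u1 u2. edge u1 u2 0) v1 v2 (e, 0, m2, c1, c2) (e, 1, m2, c1, c2)"
proof (rule lift_semI)
  fix u1 u2 X1 X2 assume u: "code w v1 u1" "dec c1 X1" "dec c2 X2"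
  obtain \<gamma> \<rho> os q where X: "X1 = ((\<gamma>, \<rho>) # os, q)" "code w g (enc_nat (to_nat \<gamma>))" "code w r (enc_nat \<rho>)"
    using Cell_dec[OF c u(2)] by metis
  have "sel e (\<gamma>, \<rho>) = u1"
    using Eq_code[OF eq _ u(1)] X(2,3) by (auto simp: sel_def split: if_splits)
  then have "edge u1 u2 0 (e, 0, m2, X1, X2) (e, 1, m2, X1, X2)" unfolding X(1) by (rule mark1)
  then show "\<exists>Y1 Y2. dec c1 Y1 \<and> dec c2 Y2 \<and> edge u1 u2 0 (e, 0, m2, X1, X2) (e, 1, m2, Y1, Y2)"
    using u by blast
qed

lemma Flat_mark2:
  assumes c: "Cell_sem c2 g r d2" and eq: "Eq_sem (if e = 2 then g else r) x v2 y" and e: "e = 1 \<or> e = 2"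
  shows "lift_sem (\<lambda>u1 u2. edge u1 u2 0) v1 v2 (e, m1, 0, c1, c2) (e, m1, 1, c1, c2)"
proof (rule lift_semI)
  fix u1 u2 X1 X2 assume u: "code w v2 u2" "dec c1 X1" "dec c2 X2"
  obtain \<gamma> \<rho> os q where X: "X2 = ((\<gamma>, \<rho>) # os, q)" "code w g (enc_nat (to_nat \<gamma>))" "code w r (enc_nat \<rho>)"
    using Cell_dec[OF c u(3)] by metis
  have "sel e (\<gamma>, \<rho>) = u2"
    using Eq_code[OF eq _ u(1)] X(2,3) by (auto simp: sel_def split: if_splits)
  then have "edge u1 u2 0 (e, m1, 0, X1, X2) (e, m1, 1, X1, X2)" unfolding X(1) using e by (rule mark2)
  then show "\<exists>Y1 Y2. dec c1 Y1 \<and> dec c2 Y2 \<and> edge u1 u2 0 (e, m1, 0, X1, X2) (e, m1, 1, Y1, Y2)"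
    using u by blast
qed

lemma Flat_marks:
  "Cell_sem c1 g r d1 \<Longrightarrow> Eq_sem g x v1 y \<Longrightarrow>
    lift_sem (\<lambda>u1 u2. edge u1 u2 0) v1 v2 (2, 0, m2, c1, c2) (2, 1, m2, c1, c2)"
  "Cell_sem c1 g r d1 \<Longrightarrow> Eq_sem r x v1 y \<Longrightarrow>
    lift_sem (\<lambda>u1 u2. edge u1 u2 0) v1 v2 (0, 0, m2, c1, c2) (0, 1, m2, c1, c2)"
  "Cell_sem c1 g r d1 \<Longrightarrow> Eq_sem r x v1 y \<Longrightarrow>
    lift_sem (\<lambda>u1 u2. edge u1 u2 0) v1 v2 (1, 0, m2, c1, c2) (1, 1, m2, c1, c2)"
  "Cell_sem c2 g r d2 \<Longrightarrow> Eq_sem g x v2 y \<Longrightarrow>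
    lift_sem (\<lambda>u1 u2. edge u1 u2 0) v1 v2 (2, m1, 0, c1, c2) (2, m1, 1, c1, c2)"
  "Cell_sem c2 g r d2 \<Longrightarrow> Eq_sem r x v2 y \<Longrightarrow>
    lift_sem (\<lambda>u1 u2. edge u1 u2 0) v1 v2 (1, m1, 0, c1, c2) (1, m1, 1, c1, c2)"
  using Flat_mark1[of c1 g r d1 2] Flat_mark1[of c1 g r d1 0] Flat_mark1[of c1 g r d1 1]
    Flat_mark2[of c2 g r d2 2] Flat_mark2[of c2 g r d2 1] by auto

lemma lift_mono:
  "lift_sem R v1 v2 n n' \<Longrightarrow> (\<And>u1 u2 x y. R u1 u2 x y \<Longrightarrow> R' u1 u2 x y) \<Longrightarrow> lift_sem R' v1 v2 n n'"
  unfolding lift_sem_def by blast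

lemma Flat_Pstep: "lift_sem pstep v1 v2 n n' \<Longrightarrow> lift_sem (\<lambda>u1 u2. edge u1 u2 0) v1 v2 n n'"
  by (erule lift_mono) (rule edge.step)

lemma Free_1: "Free_sem v1 1 s"
  by (simp add: Free_sem_def)

lemma Free_Notin: "Notin_sem s v1 \<Longrightarrow> Free_sem v1 m1 s"
  unfolding Free_sem_def has_reg_def using Notin_set by blast

lemma Adm_const: "Adm_sem v1 v2 0 m1 0 s1 s2" "Adm_sem v1 v2 2 m1 2 s1 s2"
  by (auto simp: Adm_sem_def admissible_def)

lemma Adm_Free: "Free_sem v1 m1 s1 \<Longrightarrow> Adm_sem v1 v2 1 m1 1 s1 s2"
  unfolding Adm_sem_def admissible_def Free_sem_def by blast

lemma Adm_Elem:
  assumes "Free_sem v1 m1 s1" "Elem_sem s2 x" "Eq_sem v2 y x z"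
  shows "Adm_sem v1 v2 0 m1 1 s1 s2"
  unfolding Adm_sem_def
proof (intro allI impI)
  fix u1 u2 A1 A2 q1 q2
  assume a: "code w v1 u1" "code w v2 u2" "finite A1" "finite A2" "seg w s1 (enc_set A1) q1" "seg w s2 (enc_set A2) q2"
  obtain r where "r \<in> A2" "code w x (enc_nat r)" using Elem_set[OF assms(2) a(6,4)] by blast
  then have "has_reg u2 A2" using Eq_code[OF assms(3) a(2)] by (auto simp: has_reg_def)
  moreover have "m1 = 1 \<or> \<not> has_reg u1 A1" using assms(1) a unfolding Free_sem_def by blast
  ultimately show "admissible u1 u2 0 m1 1 A1 A2" by (simp add: admissible_def)
qed

lemma at_transition_src: "at_transition t tr a s d \<Longrightarrow> code w t (enc_nat (src tr))"
  by (auto simp: at_transition_def code_def raw_enc_nat)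

lemma finite_asg:
  assumes "tr \<in> transitions T"
  shows "finite (asg tr)"
proof -
  obtain q \<sigma> \<phi> A os q' where tr: "tr = (q, \<sigma>, \<phi>, A, os, q')" by (cases tr) auto
  have R: "\<forall>(q, \<sigma>, \<phi>, A, os, q') \<in> transitions T. A \<subseteq> registers T" "finite (registers T)"
    using nrt unfolding is_nrt_def by blast+
  then have "A \<subseteq> registers T" using assms tr by auto
  then show ?thesis using R(2) by (auto simp: tr intro: finite_subset)
qed

lemma Pstep_I:
  assumes c: "\<not> w ! c1" "\<not> w ! c2" and t: "Trans_sem t1 a1 s1 d1" "Trans_sem t2 a2 s2 d2"
    and eq: "Eq_sem (Suc c1) x t1 y" "Eq_sem (Suc c2) x' t2 y'" "Eq_sem a1 x'' a2 y''"
    and adm: "Adm_sem v1 v2 e m1 e' s1 s2"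
  shows "lift_sem pstep v1 v2 (e, m1, m2, c1, c2) (e', m1, m2, d1, d2)"
proof (rule lift_semI)
  fix u1 u2 X1 X2 assume u: "code w v1 u1" "code w v2 u2" "dec c1 X1" "dec c2 X2"
  obtain q1 where q1: "X1 = ([], q1)" "code w (Suc c1) (enc_nat q1)" using dec_end[OF u(3) c(1)] .
  obtain q2 where q2: "X2 = ([], q2)" "code w (Suc c2) (enc_nat q2)" using dec_end[OF u(4) c(2)] .
  obtain tr1 where tr1: "tr1 \<in> transitions T" "at_transition t1 tr1 a1 s1 d1" using t(1) by (auto simp only: Trans_sem_def)
  obtain tr2 where tr2: "tr2 \<in> transitions T" "at_transition t2 tr2 a2 s2 d2" using t(2) by (auto simp only: Trans_sem_def)
  have "enc_nat q1 = enc_nat (src tr1)" "enc_nat q2 = enc_nat (src tr2)"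
    using Eq_code[OF eq(1) q1(2) at_transition_src[OF tr1(2)]] Eq_code[OF eq(2) q2(2) at_transition_src[OF tr2(2)]] .
  then have q: "q1 = src tr1" "q2 = src tr2" using inj_enc_nat by (auto dest: injD)
  have "enc_nat (to_nat (lab tr1)) = enc_nat (to_nat (lab tr2))"
    using Eq_code[OF eq(3)] tr1(2) tr2(2) by (auto simp: at_transition_def)
  then have "lab tr1 = lab tr2" using inj_enc_nat by (auto dest: injD)
  moreover have "admissible u1 u2 e m1 e' (asg tr1) (asg tr2)"
    using adm u(1,2) tr1 tr2 finite_asg unfolding Adm_sem_def at_transition_def by blast
  ultimately have "pstep u1 u2 (e, m1, m2, X1, X2) (e', m1, m2, (out tr1, tgt tr1), (out tr2, tgt tr2))"
    unfolding q1(1) q2(1) q using tr1(1) tr2(1) by (intro pstep.pstep)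
  moreover have "dec d1 (out tr1, tgt tr1)" "dec d2 (out tr2, tgt tr2)" using tr1(2) tr2(2) by (auto simp: at_transition_def)
  ultimately show "\<exists>Y1 Y2. dec d1 Y1 \<and> dec d2 Y2 \<and> pstep u1 u2 (e, m1, m2, X1, X2) (e', m1, m2, Y1, Y2)" by blast
qed

lemma sound_edges: "list_all sound P_edges"
  unfolding P_edges_def Let_def
  by (simp add: sound_def meaning_simps[simplified], intro conjI allI impI; (elim conjE)?)
     (simp_all add: Up_I[simplified] Down_I[simplified] Flat_Pstep Free_1[simplified] Free_Notin Adm_const Adm_Free[simplified],
      (blast intro: Up_I Down_I Flat_skip1[simplified] Flat_skip2[simplified] Flat_marks[simplified] Adm_Elem[simplified] Pstep_I)+)

section \<open>Soundness of the rules for lassos\<close>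

lemma lift_refl: "(\<And>u1 u2 x. R u1 u2 x x) \<Longrightarrow> lift_sem R v1 v2 n n"
  unfolding lift_sem_def by blast

lemma Bal_bracket:
  assumes "lift_sem (\<lambda>u1 u2. edge u1 u2 z) v1 v2 n a" "lift_sem (\<lambda>u1 u2. balanced (edge u1 u2)) v1 v2 a b"
    "lift_sem (\<lambda>u1 u2. edge u1 u2 (- z)) v1 v2 b n'" "z = 1 \<or> z = - 1"
  shows "lift_sem (\<lambda>u1 u2. balanced (edge u1 u2)) v1 v2 n n'"
  unfolding lift_sem_def
proof (intro allI impI)
  fix u1 u2 x assume u: "code w v1 u1" "code w v2 u2" "decn n x"
  obtain y where y: "decn a y" "edge u1 u2 z x y" using assms(1) u unfolding lift_sem_def by blast
  obtain y' where y': "decn b y'" "balanced (edge u1 u2) y y'" using assms(2) u y unfolding lift_sem_def by blast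
  obtain y'' where y'': "decn n' y''" "edge u1 u2 (- z) y' y''" using assms(3) u y' unfolding lift_sem_def by blast
  have "balanced (edge u1 u2) x y''"
    using assms(4) y y' y'' bal_up[of "edge u1 u2" x y y' y''] bal_down[of "edge u1 u2" x y y' y''] by auto
  then show "\<exists>y. decn n' y \<and> balanced (edge u1 u2) x y" using y'' by blast
qed

lemma Bal_trans:
  assumes "lift_sem (\<lambda>u1 u2. balanced (edge u1 u2)) v1 v2 n a" "lift_sem (\<lambda>u1 u2. balanced (edge u1 u2)) v1 v2 a n'"
  shows "lift_sem (\<lambda>u1 u2. balanced (edge u1 u2)) v1 v2 n n'"
  unfolding lift_sem_def
proof (intro allI impI)
  fix u1 u2 x assume u: "code w v1 u1" "code w v2 u2" "decn n x"
  obtain y where y: "decn a y" "balanced (edge u1 u2) x y" using assms(1) u unfolding lift_sem_def by blast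
  obtain y' where y': "decn n' y'" "balanced (edge u1 u2) y y'" using assms(2) u y unfolding lift_sem_def by blast
  show "\<exists>y. decn n' y \<and> balanced (edge u1 u2) x y" using y' bal_trans[OF y(2) y'(2)] by blast
qed

lemma Bal_Flat: "lift_sem (\<lambda>u1 u2. edge u1 u2 0) v1 v2 n n' \<Longrightarrow> lift_sem (\<lambda>u1 u2. balanced (edge u1 u2)) v1 v2 n n'"
  by (erule lift_mono) (rule bal_edge)

lemma Same_I:
  assumes "\<not> w ! a" "\<not> w ! b" "Eq_sem (Suc a) x (Suc b) y"
  shows "Same_sem a b"
  unfolding Same_sem_def
proof (intro allI impI)
  fix X X' assume "dec a X" "dec b X'"
  obtain q where q: "X = ([], q)" "code w (Suc a) (enc_nat q)" using dec_end[OF \<open>dec a X\<close> assms(1)] .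
  obtain q' where q': "X' = ([], q')" "code w (Suc b) (enc_nat q')" using dec_end[OF \<open>dec b X'\<close> assms(2)] .
  show "X = X'" using Eq_code[OF assms(3) q(2) q'(2)] q q' inj_enc_nat by (auto dest: injD)
qed

lemma Eq_code_ex: "Eq_sem p q p q \<Longrightarrow> \<exists>u. code w p u"
  by (auto simp: Eq_sem_def code_def)

lemma Init_0: "Header_sem c x y \<Longrightarrow> Eq_sem v1 z v1 z \<Longrightarrow> Eq_sem v2 z' v2 z' \<Longrightarrow> Init_sem v1 v2 0 c"
  using Eq_code_ex[of v1 z] Eq_code_ex[of v2 z'] unfolding Init_sem_def Header_sem_def by blast

lemma Init_2:
  assumes "Header_sem c x y" "Eq_sem v1 z v1 z" "Eq_sem v2 z' v2 z'" "Neq_sem v1 v2"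
  shows "Init_sem v1 v2 2 c"
proof -
  obtain u1 u2 where u: "code w v1 u1" "code w v2 u2" using Eq_code_ex assms by metis
  then have "u1 \<noteq> u2" using assms(4) by (auto simp: Neq_sem_def)
  then show ?thesis using u assms(1) unfolding Init_sem_def Header_sem_def by blast
qed

lemma decn_obtain:
  assumes "decn (e, m1, m2, c1, c2) x"
  obtains X1 X2 where "x = (e, m1, m2, X1, X2)" "dec c1 X1" "dec c2 X2"
  using assms by (cases x) (auto simp: decn_def)

text \<open>The goal rule lets the step that leaves a node enforce that its outputs are
  exhausted.\<close>

lemma pstep_final: "pstep u1 u2 (e, 1, 1, X1, X2) y \<Longrightarrow> \<exists>q1 q2. X1 = ([], q1) \<and> X2 = ([], q2)"
  by (cases rule: pstep.cases) auto

text \<open>The conditional meanings are instantiated one after the other from the start node;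
  \<open>Same_sem\<close> then identifies the last node with the first one of the loop.\<close>

lemma Goal_I:
  assumes init: "Init_sem v1 v2 e0 c"
    and b0: "lift_sem (\<lambda>u1 u2. balanced (edge u1 u2)) v1 v2 (e0, 0, 0, c, c) (e, 1, 1, a1, a2)"
    and acc1: "Acc_sem a1" and s1: "lift_sem pstep v1 v2 (e, 1, 1, a1, a2) n"
    and b1: "lift_sem (\<lambda>u1 u2. balanced (edge u1 u2)) v1 v2 n (e, 1, 1, c1, c2)"
    and acc2: "Acc_sem c2" and s2: "lift_sem pstep v1 v2 (e, 1, 1, c1, c2) n'"
    and b2: "lift_sem (\<lambda>u1 u2. balanced (edge u1 u2)) v1 v2 n' (e, 1, 1, d1, d2)"
    and same: "Same_sem a1 d1" "Same_sem a2 d2"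
  shows "has_lasso UNIV"
proof -
  obtain u1 u2 where u: "code w v1 u1" "code w v2 u2" "e0 = 0 \<or> e0 = 2 \<and> u1 \<noteq> u2" and c: "dec c ([], initial T)"
    using init by (auto simp: Init_sem_def)
  have "decn (e0, 0, 0, c, c) (start e0)" using c by (simp add: decn_def start_def)
  then obtain x where x: "decn (e, 1, 1, a1, a2) x" "balanced (edge u1 u2) (start e0) x"
    using b0 u(1,2) unfolding lift_sem_def by blast
  obtain X1 X2 where X: "x = (e, 1, 1, X1, X2)" "dec a1 X1" "dec a2 X2" using decn_obtain[OF x(1)] .
  obtain y where y: "decn n y" "pstep u1 u2 x y" using s1 u(1,2) x(1) unfolding lift_sem_def by blast
  obtain x' where x': "decn (e, 1, 1, c1, c2) x'" "balanced (edge u1 u2) y x'"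
    using b1 u(1,2) y(1) unfolding lift_sem_def by blast
  obtain X1' X2' where X': "x' = (e, 1, 1, X1', X2')" "dec c1 X1'" "dec c2 X2'" using decn_obtain[OF x'(1)] .
  obtain y' where y': "decn n' y'" "pstep u1 u2 x' y'" using s2 u(1,2) x'(1) unfolding lift_sem_def by blast
  obtain x'' where x'': "decn (e, 1, 1, d1, d2) x''" "balanced (edge u1 u2) y' x''"
    using b2 u(1,2) y'(1) unfolding lift_sem_def by blast
  obtain X1'' X2'' where X'': "x'' = (e, 1, 1, X1'', X2'')" "dec d1 X1''" "dec d2 X2''" using decn_obtain[OF x''(1)] .
  have "X1 = X1''" "X2 = X2''" using same X(2,3) X''(2,3) unfolding Same_sem_def by blast+
  then have eq: "x'' = x" using X(1) X''(1) by simp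
  obtain q1 q2 where q: "X1 = ([], q1)" "X2 = ([], q2)" using pstep_final y(2) unfolding X(1) by blast
  obtain p1 p2 where p: "X1' = ([], p1)" "X2' = ([], p2)" using pstep_final y'(2) unfolding X'(1) by blast
  have f: "x = final e q1 q2" "x' = final e p1 p2" using X(1) X'(1) q p by (simp_all add: final_def)
  have "q1 \<in> accepting T" "p2 \<in> accepting T" using acc1 acc2 X(2) X'(3) q p by (auto simp: Acc_sem_def)
  then show ?thesis
    unfolding has_lasso_def using u(3) x(2) y(2) x'(2) y'(2) x''(2) eq f by blast
qed

lemma sound_lasso: "list_all sound P_lasso"
  unfolding P_lasso_def Let_def
  by (simp add: sound_def meaning_simps[simplified], intro conjI allI impI; (elim conjE)?)
     (simp_all add: lift_refl bal_refl Bal_Flat,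
      (blast intro: Bal_bracket[where z = 1, simplified] Bal_bracket[where z = "- 1", simplified] Bal_trans
        Same_I Init_0 Init_2 Goal_I[simplified])+)

lemma sound_program: "rl \<in> set program \<Longrightarrow> sound rl"
  using sound_numbers sound_lists sound_transitions sound_edges sound_lasso
  by (auto simp: program_def list_all_iff)

lemma derives_meaning: "derives program w N f \<Longrightarrow> meaning f"
proof (induction rule: derives.induct)
  case (derives h bd e)
  then have "list_all (holds w meaning e) bd"
    by (auto simp: list_all_iff intro: holds_subset)
  then show ?case using sound_program[OF derives(1)] by (auto simp: sound_def)
qed

end

subsection \<open>Completeness of the program\<close>

context encoded_nrt
begin

abbreviation D :: "nat list \<Rightarrow> bool" where "D \<equiv> derives program w N"

text \<open>Rules are applied with an explicit list of the values of \<open>TV 0\<close>,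
  \<open>TV 1\<close> and so on; 0 fills the places of variables absent from the rule.\<close>

lemma derive_rule:
  assumes "r \<in> set program" "list_all (\<lambda>x. x < N) vs"
    and "list_all (holds w D (\<lambda>j. if j < length vs then vs ! j else 0)) (snd r)"
  shows "D (map (tval (\<lambda>j. if j < length vs then vs ! j else 0)) (fst r))"
  using assms by (intro derives[of "fst r" "snd r"]) (auto simp: list_all_iff)

lemma program_mem:
  "i < 8 \<Longrightarrow> P_numbers ! i \<in> set program" "i < 6 \<Longrightarrow> P_lists ! i \<in> set program"
  "i < 9 \<Longrightarrow> P_transitions ! i \<in> set program" "i < 17 \<Longrightarrow> P_edges ! i \<in> set program"
  "i < 9 \<Longrightarrow> P_lasso ! i \<in> set program"
proof -
  have "length P_numbers = 8" "length P_lists = 6" "length P_transitions = 9" "length P_edges = 17" "length P_lasso = 9"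
    by (simp_all add: P_defs Let_def)
  then show "i < 8 \<Longrightarrow> P_numbers ! i \<in> set program" "i < 6 \<Longrightarrow> P_lists ! i \<in> set program"
    "i < 9 \<Longrightarrow> P_transitions ! i \<in> set program" "i < 17 \<Longrightarrow> P_edges ! i \<in> set program"
    "i < 9 \<Longrightarrow> P_lasso ! i \<in> set program"
    by (auto simp: program_def)
qed

lemmas numbers_rule = derive_rule[OF program_mem(1)]
lemmas lists_rule = derive_rule[OF program_mem(2)]
lemmas transitions_rule = derive_rule[OF program_mem(3)]
lemmas edges_rule = derive_rule[OF program_mem(4)]
lemmas lasso_rule = derive_rule[OF program_mem(5)]

section \<open>Completeness for numbers and lists\<close>

lemma raw_nonempty: "raw u \<Longrightarrow> u \<noteq> []"
  by (erule raw.cases) auto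

lemma seg_raw_less: "raw u \<Longrightarrow> seg w p u q \<Longrightarrow> p < length w \<and> q \<le> length w"
  using seg_nonempty[of w p u q] raw_nonempty[of u] seg_le[of w p u q] by auto

lemma code_less: "code w p u \<Longrightarrow> p < length w"
  unfolding code_def using seg_raw_less by blast

lemma seg_list_less: "seg w p (enc_list f us) q \<Longrightarrow> p < length w \<and> q \<le> length w"
  using seg_nonempty[of w p "enc_list f us" q] seg_le[of w p "enc_list f us" q] by (cases us) auto

lemma D_Eq: "raw u \<Longrightarrow> seg w p u p' \<Longrightarrow> seg w q u q' \<Longrightarrow> D [Eq, p, p', q, q']"
proof (induction arbitrary: p q rule: raw.induct)
  case raw_end
  then show ?case
    using numbers_rule[of 0 "[p, p', q, q']"] by (simp add: P_numbers_def Let_def)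
next
  case (raw_bit u b)
  then have "D [Eq, Suc (Suc p), p', Suc (Suc q), q']" by auto
  moreover have "p' \<le> length w" "q' \<le> length w"
    using seg_raw_less[OF raw.raw_bit[OF raw_bit(1)]] raw_bit.prems by blast+
  ultimately show ?case
    using numbers_rule[of 1 "[p, p', q, q', Suc p, Suc q, Suc (Suc p), Suc (Suc q)]"]
      numbers_rule[of 2 "[p, p', q, q', Suc p, Suc q, Suc (Suc p), Suc (Suc q)]"] raw_bit.prems
    by (cases b) (simp_all add: P_numbers_def Let_def)
qed

lemma D_Neq: "raw u \<Longrightarrow> raw u' \<Longrightarrow> u \<noteq> u' \<Longrightarrow> seg w p u p' \<Longrightarrow> seg w q u' q' \<Longrightarrow> D [Neq, p, q]"
proof (induction arbitrary: p q u' rule: raw.induct)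
  case raw_end
  from raw_end(1) show ?case
    by cases (use numbers_rule[of 3 "[p, 0, q]"] raw_end in \<open>simp_all add: P_numbers_def Let_def\<close>)
next
  case (raw_bit u b)
  from raw_bit.prems(1) show ?case
  proof cases
    case raw_end
    then show ?thesis
      using numbers_rule[of 4 "[p, 0, q]"] raw_bit.prems by (simp add: P_numbers_def Let_def)
  next
    case (raw_bit v b')
    note s = raw_bit.prems this
    show ?thesis
    proof (cases "b = b'")
      case True
      then have "D [Neq, Suc (Suc p), Suc (Suc q)]" using raw_bit.IH[of v] s by auto
      then show ?thesis
        using numbers_rule[of 7 "[p, 0, q, 0, Suc p, Suc q, Suc (Suc p), Suc (Suc q)]"] s
        by (simp add: P_numbers_def Let_def)
    next
      case False
      then show ?thesis
        using numbers_rule[of 5 "[p, 0, q, 0, Suc p, Suc q]"] numbers_rule[of 6 "[p, 0, q, 0, Suc p, Suc q]"] s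
        by (cases b) (simp_all add: P_numbers_def Let_def)
    qed
  qed
qed

lemma D_Eq_code: "code w p u \<Longrightarrow> code w q u \<Longrightarrow> \<exists>x y. D [Eq, p, x, q, y] \<and> x \<le> length w \<and> y \<le> length w"
  unfolding code_def using D_Eq seg_raw_less by blast

lemma D_Neq_code: "code w p u \<Longrightarrow> code w q v \<Longrightarrow> u \<noteq> v \<Longrightarrow> D [Neq, p, q]"
  unfolding code_def using D_Neq by blast

lemma seg_list_Cons:
  "seg w p (enc_list f (u # us)) q \<Longrightarrow> \<exists>m. seg w (Suc p) (f u) m \<and> seg w m (enc_list f us) q \<and> p < length w \<and> w ! p"
  by (auto simp: seg_append)

lemma D_Skip: "\<forall>u\<in>set us. raw u \<Longrightarrow> seg w p (enc_list id us) q \<Longrightarrow> D [Skip, p, q]"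
proof (induction us arbitrary: p)
  case Nil
  then show ?case using lists_rule[of 0 "[p, q]"] by (simp add: P_lists_def Let_def)
next
  case (Cons u us)
  from seg_list_Cons[OF Cons.prems(2)] obtain m where
    m: "seg w (Suc p) u m" "seg w m (enc_list id us) q" "p < length w" "w ! p"
    unfolding id_apply by blast
  show ?case
    using lists_rule[of 1 "[p, q, Suc p, m]"] Cons.IH[OF _ m(2)] Cons.prems m(3,4) D_Eq[OF _ m(1) m(1)] seg_raw_less[OF _ m(1)] seg_list_less[OF m(2)]
    by (simp add: P_lists_def Let_def)
qed

lemma D_Elem: "\<forall>u\<in>set us. raw u \<Longrightarrow> seg w p (enc_list id us) q \<Longrightarrow> u \<in> set us \<Longrightarrow> \<exists>x. D [Elem, p, x] \<and> code w x u"
proof (induction us arbitrary: p)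
  case (Cons v us)
  from seg_list_Cons[OF Cons.prems(2)] obtain m where
    m: "seg w (Suc p) v m" "seg w m (enc_list id us) q" "p < length w" "w ! p"
    unfolding id_apply by blast
  show ?case
  proof (cases "u = v")
    case True
    then show ?thesis
      using lists_rule[of 2 "[p, 0, Suc p]"] m Cons.prems code_seg[OF _ m(1)]
      by (intro exI[of _ "Suc p"]) (simp add: P_lists_def Let_def)
  next
    case False
    then obtain x where x: "D [Elem, m, x]" "code w x u" using Cons.IH[OF _ m(2)] Cons.prems by auto
    then show ?thesis
      using lists_rule[of 3 "[p, 0, x, Suc p, m]"] m Cons.prems D_Eq[OF _ m(1) m(1)] seg_raw_less[OF _ m(1)] code_less[OF x(2)]
      by (intro exI[of _ x]) (simp add: P_lists_def Let_def)
  qed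
qed simp

lemma D_Notin: "\<forall>u\<in>set us. raw u \<Longrightarrow> seg w p (enc_list id us) q \<Longrightarrow> u \<notin> set us \<Longrightarrow> code w x u \<Longrightarrow> D [Notin, p, x]"
proof (induction us arbitrary: p)
  case Nil
  then show ?case using lists_rule[of 4 "[p, 0, x]"] code_less[of x u] by (simp add: P_lists_def Let_def)
next
  case (Cons v us)
  from seg_list_Cons[OF Cons.prems(2)] obtain m where
    m: "seg w (Suc p) v m" "seg w m (enc_list id us) q" "p < length w" "w ! p"
    unfolding id_apply by blast
  have "D [Neq, Suc p, x]" using Cons.prems code_seg[OF _ m(1)] by (intro D_Neq_code) auto
  then show ?case
    using lists_rule[of 5 "[p, 0, x, Suc p, m]"] m(3,4) Cons.IH[OF _ m(2)] Cons.prems D_Eq[OF _ m(1) m(1)] seg_raw_less[OF _ m(1)] code_less[of x u]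
    by (simp add: P_lists_def Let_def)
qed

lemma D_Skip_set: "seg w p (enc_set A) q \<Longrightarrow> D [Skip, p, q]"
  unfolding enc_set_list by (rule D_Skip[OF raw_map])

lemma D_Elem_set: "seg w p (enc_set A) q \<Longrightarrow> finite A \<Longrightarrow> a \<in> A \<Longrightarrow> \<exists>x. D [Elem, p, x] \<and> code w x (enc_nat a)"
  unfolding enc_set_list by (rule D_Elem[OF raw_map]) auto

lemma D_Notin_set: "seg w p (enc_set A) q \<Longrightarrow> finite A \<Longrightarrow> u \<notin> enc_nat ` A \<Longrightarrow> code w x u \<Longrightarrow> D [Notin, p, x]"
  unfolding enc_set_list by (rule D_Notin[OF raw_map]) auto

lemma enc_set_less: "seg w p (enc_set A) q \<Longrightarrow> p < length w \<and> q \<le> length w"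
  unfolding enc_set_def by (rule seg_list_less)

section \<open>Completeness for the code of the transducer\<close>

lemma D_Header:
  obtains c f l where "D [Header, c, f, l]" "dec c ([], initial T)" "seg w f (enc_set (accepting T)) l"
    "seg w l (enc_list enc_transition ts) (length w)"
proof -
  obtain p q f l where s: "seg w 0 (enc_set (states T)) p" "seg w p (enc_set (registers T)) q"
    "seg w q (enc_nat (initial T)) f" "seg w f (enc_set (accepting T)) l"
    "seg w l (enc_list enc_transition ts) (length w)" by (rule layout)
  obtain u where "enc_set (registers T) = u @ [False]"
    using enc_list_last unfolding enc_set_def by blast
  then obtain c where c: "seg w c [False] q" using s(2) by (auto simp: seg_append)
  have "D [Header, c, f, l]"
    using transitions_rule[of 0 "[c, f, l, p, q]"] D_Skip_set[OF s(1)] D_Skip_set[OF s(2)] D_Skip_set[OF s(4)]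
      D_Eq[OF raw_enc_nat s(3) s(3)] enc_set_less[OF s(2)] enc_set_less[OF s(4)] c
    by (simp add: P_transitions_def Let_def)
  moreover have "dec c ([], initial T)" using c s(3) by (auto simp: dec_def)
  ultimately show ?thesis using that s by blast
qed

lemma D_Cell:
  assumes "seg w d (enc_list enc_cell ((\<gamma>, \<rho>) # os)) f"
  obtains r d' where "D [Cell, d, Suc d, r, d']" "code w (Suc d) (enc_nat (to_nat \<gamma>))" "code w r (enc_nat \<rho>)"
    "seg w d' (enc_list enc_cell os) f" "r \<le> length w" "d' \<le> length w" "d < length w"
proof -
  obtain r d' where s: "d < length w" "w ! d" "seg w (Suc d) (enc_nat (to_nat \<gamma>)) r" "seg w r (enc_nat \<rho>) d'"
    "seg w d' (enc_list enc_cell os) f"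
    using assms by (auto simp: seg_append enc_cell_def)
  have le: "r \<le> length w" "d' \<le> length w" using seg_raw_less[OF raw_enc_nat s(3)] seg_raw_less[OF raw_enc_nat s(4)] by auto
  have "D [Cell, d, Suc d, r, d']"
    using transitions_rule[of 1 "[0, 0, 0, 0, 0, d, Suc d, r, d']"] s(1,2) le
      D_Eq[OF raw_enc_nat s(3) s(3)] D_Eq[OF raw_enc_nat s(4) s(4)]
    by (simp add: P_transitions_def Let_def)
  then show ?thesis using that s le by (auto intro: code_seg raw_enc_nat)
qed

lemma D_Outs: "seg w d (enc_list enc_cell (os :: ('b \<times> nat) list)) f \<Longrightarrow> D [Outs, d, f]"
proof (induction os arbitrary: d)
  case Nil
  then show ?case using transitions_rule[of 2 "[0, f, 0, 0, 0, d]"] by (simp add: P_transitions_def Let_def)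
next
  case (Cons c os)
  obtain \<gamma> \<rho> where c: "c = (\<gamma>, \<rho>)" by (cases c)
  from D_Cell[OF Cons.prems[unfolded c]] obtain r d' where
    s: "D [Cell, d, Suc d, r, d']" "seg w d' (enc_list enc_cell os) f" "r \<le> length w" "d' \<le> length w" "d < length w" by metis
  then show ?case
    using transitions_rule[of 3 "[0, f, 0, 0, 0, d, Suc d, r, d']"] Cons.IH[OF s(2)] seg_list_less[OF s(2)]
    by (simp add: P_transitions_def Let_def)
qed

lemma D_Parse:
  assumes tr: "tr \<in> transitions T" and s: "seg w t (enc_transition tr) l'"
  obtains a s d where "D [Parse, t, a, s, d, l']" "at_transition t tr a s d"
    "t < length w" "a < length w" "s < length w" "d < length w" "l' \<le> length w"
proof -
  obtain q \<sigma> \<phi> A os q' where tr': "tr = (q, \<sigma>, \<phi>, A, os, q')" by (cases tr) auto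
  have phi: "\<phi> = TTop" using test_free tr tr' by (auto simp: test_free_def)
  have "enc_nat 0 = [False]" by (subst enc_nat.simps) simp
  then obtain a b d f where s: "seg w t (enc_nat q) a" "seg w a (enc_nat (to_nat \<sigma>)) b"
    "seg w (Suc b) (enc_set A) d" "seg w d (enc_list enc_cell os) f" "seg w f (enc_nat q') l'"
    using s by (auto simp: tr' phi seg_append enc_cell_def)
  note le = seg_raw_less[OF raw_enc_nat s(1)] seg_raw_less[OF raw_enc_nat s(2)] enc_set_less[OF s(3)]
    seg_list_less[OF s(4)] seg_raw_less[OF raw_enc_nat s(5)]
  have "D [Parse, t, a, Suc b, d, l']"
    using transitions_rule[of 4 "[0, f, 0, 0, 0, d, 0, 0, 0, t, a, Suc b, l', b]"] le
      D_Eq[OF raw_enc_nat s(1) s(1)] D_Eq[OF raw_enc_nat s(2) s(2)] D_Skip_set[OF s(3)] D_Outs[OF s(4)]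
      D_Eq[OF raw_enc_nat s(5) s(5)]
    by (simp add: P_transitions_def Let_def)
  moreover have "at_transition t tr a (Suc b) d"
    using s by (auto simp: at_transition_def tr' dec_def code_def raw_enc_nat)
  ultimately show ?thesis using that[of a "Suc b" d] le by blast
qed

lemma D_Tail:
  assumes "D [Tail, l]" "seg w l (enc_list enc_transition us) (length w)" "set us \<subseteq> transitions T" "tr \<in> set us"
  shows "\<exists>t a s d. D [Trans, t, a, s, d] \<and> at_transition t tr a s d \<and> t < length w \<and> a < length w \<and> s < length w \<and> d < length w"
  using assms
proof (induction us arbitrary: l)
  case (Cons u us)
  then obtain m where m: "seg w (Suc l) (enc_transition u) m" "seg w m (enc_list enc_transition us) (length w)" "l < length w" "w ! l"
    by (auto simp: seg_append)
  have u: "u \<in> transitions T" using Cons.prems by auto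
  from D_Parse[OF u m(1)] obtain a s d where
    p: "D [Parse, Suc l, a, s, d, m]" "at_transition (Suc l) u a s d"
      "Suc l < length w" "a < length w" "s < length w" "d < length w" "m \<le> length w" by metis
  show ?case
  proof (cases "tr = u")
    case True
    have "D [Trans, Suc l, a, s, d]"
      using transitions_rule[of 7 "[0, 0, l, 0, 0, d, 0, 0, 0, Suc l, a, s, m]"] p m Cons.prems
      by (simp add: P_transitions_def Let_def)
    then show ?thesis using p True by blast
  next
    case False
    have "D [Tail, m]"
      using transitions_rule[of 6 "[0, 0, l, 0, 0, d, 0, 0, 0, Suc l, a, s, m]"] p m Cons.prems
      by (simp add: P_transitions_def Let_def)
    then show ?thesis using Cons m False by auto
  qed
qed simp

lemma D_Trans:
  assumes "tr \<in> transitions T"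
  obtains t a s d where "D [Trans, t, a, s, d]" "at_transition t tr a s d"
    "t < length w" "a < length w" "s < length w" "d < length w"
proof -
  obtain c f l where h: "D [Header, c, f, l]" "dec c ([], initial T)" "seg w f (enc_set (accepting T)) l"
    "seg w l (enc_list enc_transition ts) (length w)" by (rule D_Header)
  have "c < length w" using h(2) by (auto simp: dec_def)
  then have "D [Tail, l]"
    using transitions_rule[of 5 "[c, f, l]"] h(1) enc_set_less[OF h(3)] by (simp add: P_transitions_def Let_def)
  from D_Tail[OF this h(4), of tr] show ?thesis using that assms ts by auto
qed

lemma dec_less: "dec c X \<Longrightarrow> c < length w"
  unfolding dec_def using seg_list_less by blast

lemma D_Acc:
  assumes "dec c (os, q)" "q \<in> accepting T"
  shows "D [Acc, c]"
proof -
  obtain f l' where f: "seg w c (enc_list enc_cell os) f" "seg w f (enc_nat q) l'"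
    using assms(1) by (auto simp: dec_def)
  obtain p q' l where h: "D [Header, p, q', l]" "dec p ([], initial T)" "seg w q' (enc_set (accepting T)) l" by (rule D_Header)
  have "finite (accepting T)" using nrt by (auto simp: is_nrt_def intro: finite_subset)
  then obtain x where x: "D [Elem, q', x]" "code w x (enc_nat q)" using D_Elem_set[OF h(3)] assms(2) by blast
  have "code w f (enc_nat q)" using f(2) by (auto intro: code_seg raw_enc_nat)
  then obtain y z where y: "D [Eq, f, y, x, z]" "y \<le> length w" "z \<le> length w" using D_Eq_code x(2) by blast
  show ?thesis
    using transitions_rule[of 8 "[c, f, l, p, q', z, 0, 0, 0, 0, 0, 0, 0, 0, x, y]"] D_Outs[OF f(1)] h(1) x(1) y
      seg_list_less[OF f(1)] enc_set_less[OF h(3)] dec_less[OF h(2)] code_less[OF x(2)]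
    by (simp add: P_transitions_def Let_def)
qed

section \<open>Completeness for the counter graph\<close>

lemma D_Free:
  assumes "code w v1 u1" "finite A" "seg w s (enc_set A) q" "m1 = 1 \<or> \<not> has_reg u1 A" "m1 \<le> 1"
  shows "D [Free, v1, m1, s]"
proof (cases "m1 = 1")
  case True
  then show ?thesis
    using edges_rule[of 10 "[v1, 0, 0, 0, 0, 0, 0, 0, 0, 0, 0, 0, 0, 0, 0, 0, 0, 0, 0, 0, s]"]
      code_less[OF assms(1)] enc_set_less[OF assms(3)]
    by (simp add: P_edges_def Let_def)
next
  case False
  then have "D [Notin, s, v1]" using assms by (intro D_Notin_set) (auto simp: has_reg_def)
  then show ?thesis
    using edges_rule[of 11 "[v1, 0, 0, m1, 0, 0, 0, 0, 0, 0, 0, 0, 0, 0, 0, 0, 0, 0, 0, 0, s]"]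
      code_less[OF assms(1)] enc_set_less[OF assms(3)] assms(5)
    by (simp add: P_edges_def Let_def)
qed

lemma D_Adm:
  assumes v: "code w v1 u1" "code w v2 u2" and A: "finite A1" "finite A2"
    and s: "seg w s1 (enc_set A1) q1" "seg w s2 (enc_set A2) q2"
    and adm: "admissible u1 u2 e m1 e' A1 A2" and m1: "m1 \<le> 1"
  shows "D [Adm, v1, v2, e, m1, e', s1, s2]"
proof -
  note less = code_less[OF v(1)] code_less[OF v(2)] enc_set_less[OF s(1)] enc_set_less[OF s(2)]
  from adm consider "e = 0" "e' = 0" | "e = 2" "e' = 2"
    | "e' = 1" "m1 = 1 \<or> \<not> has_reg u1 A1" "e = 1" | "e' = 1" "m1 = 1 \<or> \<not> has_reg u1 A1" "e = 0" "has_reg u2 A2"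
    unfolding admissible_def by blast
  then show ?thesis
  proof cases
    case 1
    then show ?thesis
      using edges_rule[of 12 "[v1, v2, 0, m1, 0, 0, 0, 0, 0, 0, 0, 0, 0, 0, 0, 0, 0, 0, 0, 0, s1, s2]"] less m1
      by (simp add: P_edges_def Let_def)
  next
    case 2
    then show ?thesis
      using edges_rule[of 13 "[v1, v2, 0, m1, 0, 0, 0, 0, 0, 0, 0, 0, 0, 0, 0, 0, 0, 0, 0, 0, s1, s2]"] less m1
      by (simp add: P_edges_def Let_def)
  next
    case 3
    then show ?thesis
      using edges_rule[of 14 "[v1, v2, 0, m1, 0, 0, 0, 0, 0, 0, 0, 0, 0, 0, 0, 0, 0, 0, 0, 0, s1, s2]"] less m1
        D_Free[OF v(1) A(1) s(1) 3(2) m1]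
      by (simp add: P_edges_def Let_def)
  next
    case 4
    then obtain r where r: "r \<in> A2" "u2 = enc_nat r" by (auto simp: has_reg_def)
    obtain x where x: "D [Elem, s2, x]" "code w x u2" using D_Elem_set[OF s(2) A(2) r(1)] r(2) by blast
    obtain y g where "D [Eq, v2, y, x, g]" "y \<le> length w" "g \<le> length w" using D_Eq_code[OF v(2) x(2)] by blast
    then show ?thesis
      using edges_rule[of 15 "[v1, v2, 0, m1, 0, 0, 0, 0, 0, 0, g, 0, x, y, 0, 0, 0, 0, 0, 0, s1, s2]"] less m1 4
        D_Free[OF v(1) A(1) s(1) 4(2) m1] x code_less[OF x(2)]
      by (simp add: P_edges_def Let_def)
  qed
qed

text \<open>In addition to \<open>decn\<close>, mode and flags are bounded, so that all entries are
  below N and can be values of variables.\<close>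

definition decodes :: "pnode \<Rightarrow> ('b, nat, nat) node \<Rightarrow> bool" where
  "decodes n x \<longleftrightarrow> decn n x \<and> (case n of (e, m1, m2, c1, c2) \<Rightarrow> e \<le> 2 \<and> m1 \<le> 1 \<and> m2 \<le> 1)"

definition entries :: "pnode \<Rightarrow> nat list" where
  "entries = (\<lambda>(e, m1, m2, c1, c2). [e, m1, m2, c1, c2])"

lemma entries_simp [simp]: "entries (e, m1, m2, c1, c2) = [e, m1, m2, c1, c2]"
  by (simp add: entries_def)

lemma decodes_simp [simp]: "decodes (e, m1, m2, c1, c2) (e', m1', m2', X1, X2) \<longleftrightarrow>
    e = e' \<and> m1 = m1' \<and> m2 = m2' \<and> dec c1 X1 \<and> dec c2 X2 \<and> e \<le> 2 \<and> m1 \<le> 1 \<and> m2 \<le> 1"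
  by (auto simp: decodes_def decn_def)

lemma decodes_obtain:
  assumes "decodes n (e, m1, m2, X1, X2)"
  obtains c1 c2 where "n = (e, m1, m2, c1, c2)" "dec c1 X1" "dec c2 X2" "e \<le> 2" "m1 \<le> 1" "m2 \<le> 1"
    "c1 < length w" "c2 < length w"
  using assms dec_less by (cases n) (auto simp: decodes_def decn_def)

lemma at_transition_facts:
  assumes "at_transition t tr a s d"
  shows "code w t (enc_nat (src tr))" "code w a (enc_nat (to_nat (lab tr)))" "dec d (out tr, tgt tr)"
  using assms by (auto simp: at_transition_def code_def raw_enc_nat)

lemma dec_Nil: "dec c ([], q) \<Longrightarrow> \<not> w ! c \<and> code w (Suc c) (enc_nat q)"
  by (auto simp: dec_def code_def raw_enc_nat)

lemma D_Pstep:
  assumes v: "code w v1 u1" "code w v2 u2" and n: "decodes n x" and st: "pstep u1 u2 x y"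
  shows "\<exists>n'. decodes n' y \<and> D (Pstep # v1 # v2 # entries n @ entries n')"
  using st
proof cases
  case (pstep t1 t2 e m1 e' m2)
  obtain c1 c2 where c: "n = (e, m1, m2, c1, c2)" "dec c1 ([], src t1)" "dec c2 ([], src t2)" "e \<le> 2" "m1 \<le> 1" "m2 \<le> 1"
    "c1 < length w" "c2 < length w"
    using decodes_obtain[OF n[unfolded pstep(1)]] .
  obtain p1 a1 s1 d1 where t1: "D [Trans, p1, a1, s1, d1]" "at_transition p1 t1 a1 s1 d1"
    "p1 < length w" "a1 < length w" "s1 < length w" "d1 < length w" by (rule D_Trans[OF pstep(3)])
  obtain p2 a2 s2 d2 where t2: "D [Trans, p2, a2, s2, d2]" "at_transition p2 t2 a2 s2 d2"
    "p2 < length w" "a2 < length w" "s2 < length w" "d2 < length w" by (rule D_Trans[OF pstep(4)])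
  note f1 = at_transition_facts[OF t1(2)] and f2 = at_transition_facts[OF t2(2)]
  obtain q1 where q1: "seg w s1 (enc_set (asg t1)) q1" using t1(2) by (auto simp: at_transition_def)
  obtain q2 where q2: "seg w s2 (enc_set (asg t2)) q2" using t2(2) by (auto simp: at_transition_def)
  have adm: "D [Adm, v1, v2, e, m1, e', s1, s2]"
    using D_Adm[OF v finite_asg[OF pstep(3)] finite_asg[OF pstep(4)] q1 q2 pstep(6) c(5)] .
  have e': "e' \<le> 2" using pstep(6) by (auto simp: admissible_def)
  note n1 = dec_Nil[OF c(2)] and n2 = dec_Nil[OF c(3)]
  obtain x y where e1: "D [Eq, Suc c1, x, p1, y]" "x \<le> length w" "y \<le> length w" using D_Eq_code n1 f1(1) by blast
  obtain x' y' where e2: "D [Eq, Suc c2, x', p2, y']" "x' \<le> length w" "y' \<le> length w" using D_Eq_code n2 f2(1) by blast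
  obtain x'' y'' where e3: "D [Eq, a1, x'', a2, y'']" "x'' \<le> length w" "y'' \<le> length w"
    using D_Eq_code[OF f1(2) f2(2)[folded pstep(5)]] by blast
  have "D [Pstep, v1, v2, e, m1, m2, c1, c2, e', m1, m2, d1, d2]"
    using edges_rule[of 16 "[v1, v2, e, m1, m2, c1, c2, d1, d2, e', 0, 0, x, y, Suc c1, Suc c2, p1, p2, a1, a2, s1, s2,
        x', y', x'', y'']"] code_less[OF v(1)] code_less[OF v(2)] c n1 n2 e1 e2 e3 adm e' t1 t2
    by (simp add: P_edges_def Let_def)
  then show ?thesis
    using c e' f1(3) f2(3) unfolding pstep(2)
    by (intro exI[of _ "(e', m1, m2, d1, d2)"]) simp
qed

definition edge_id :: "int \<Rightarrow> nat" where
  "edge_id z = (if z = 0 then Flat else if z = 1 then Up else Down)"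

lemma D_Cell_dec:
  assumes "dec c (k # os, q)"
  obtains g r d where "D [Cell, c, g, r, d]" "dec d (os, q)" "code w g (enc_nat (to_nat (fst k)))"
    "code w r (enc_nat (snd k))" "c < length w" "g \<le> length w" "r \<le> length w" "d \<le> length w"
proof -
  obtain \<gamma> \<rho> where k: "k = (\<gamma>, \<rho>)" by (cases k)
  obtain f l where f: "seg w c (enc_list enc_cell ((\<gamma>, \<rho>) # os)) f" "seg w f (enc_nat q) l"
    using assms k by (auto simp only: dec_def fst_conv snd_conv)
  from D_Cell[OF f(1)] obtain r d where d: "D [Cell, c, Suc c, r, d]" "code w (Suc c) (enc_nat (to_nat \<gamma>))" "code w r (enc_nat \<rho>)"
    "seg w d (enc_list enc_cell os) f" "r \<le> length w" "d \<le> length w" "c < length w" by metis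
  show ?thesis using that[of "Suc c" r d] d f(2) k by (auto simp: dec_def)
qed

lemma D_edge:
  assumes v: "code w v1 u1" "code w v2 u2" and n: "decodes n x" and st: "edge u1 u2 z x y"
  shows "\<exists>n'. decodes n' y \<and> D (edge_id z # v1 # v2 # entries n @ entries n')"
proof -
  note less = code_less[OF v(1)] code_less[OF v(2)]
  from st show ?thesis
  proof cases
    case (emit1 e m2 k os q Y)
    obtain c1 c2 where c: "n = (e, 0, m2, c1, c2)" "dec c1 (k # os, q)" "dec c2 Y" "e \<le> 2" "m2 \<le> 1" "c2 < length w"
      using decodes_obtain[OF n[unfolded emit1]] by metis
    obtain g r d where d: "D [Cell, c1, g, r, d]" "dec d (os, q)" "c1 < length w" "g \<le> length w" "r \<le> length w" "d \<le> length w"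
      using D_Cell_dec[OF c(2)] by metis
    have "D [Up, v1, v2, e, 0, m2, c1, c2, e, 0, m2, d, c2]"
      using edges_rule[of 0 "[v1, v2, e, 0, m2, c1, c2, d, 0, 0, g, r]"] less c d by (simp add: P_edges_def Let_def)
    then show ?thesis using c d unfolding emit1 by (intro exI[of _ "(e, 0, m2, d, c2)"]) (simp add: edge_id_def)
  next
    case (emit2 e m1 X k os q)
    obtain c1 c2 where c: "n = (e, m1, 0, c1, c2)" "dec c1 X" "dec c2 (k # os, q)" "e \<le> 2" "m1 \<le> 1" "c1 < length w"
      using decodes_obtain[OF n[unfolded emit2]] by metis
    obtain g r d where d: "D [Cell, c2, g, r, d]" "dec d (os, q)" "c2 < length w" "g \<le> length w" "r \<le> length w" "d \<le> length w"
      using D_Cell_dec[OF c(3)] by metis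
    have "D [Down, v1, v2, e, m1, 0, c1, c2, e, m1, 0, c1, d]"
      using edges_rule[of 1 "[v1, v2, e, m1, 0, c1, c2, 0, d, 0, g, r]"] less c d by (simp add: P_edges_def Let_def)
    then show ?thesis using c d unfolding emit2 by (intro exI[of _ "(e, m1, 0, c1, d)"]) (simp add: edge_id_def)
  next
    case (skip1 e m2 k os q Y)
    obtain c1 c2 where c: "n = (e, 1, m2, c1, c2)" "dec c1 (k # os, q)" "dec c2 Y" "e \<le> 2" "m2 \<le> 1" "c2 < length w"
      using decodes_obtain[OF n[unfolded skip1]] by metis
    obtain g r d where d: "D [Cell, c1, g, r, d]" "dec d (os, q)" "c1 < length w" "g \<le> length w" "r \<le> length w" "d \<le> length w"
      using D_Cell_dec[OF c(2)] by metis
    have "D [Flat, v1, v2, e, 1, m2, c1, c2, e, 1, m2, d, c2]"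
      using edges_rule[of 2 "[v1, v2, e, 1, m2, c1, c2, d, 0, 0, g, r]"] less c d by (simp add: P_edges_def Let_def)
    then show ?thesis using c d unfolding skip1 by (intro exI[of _ "(e, 1, m2, d, c2)"]) (simp add: edge_id_def)
  next
    case (skip2 e m1 X k os q)
    obtain c1 c2 where c: "n = (e, m1, 1, c1, c2)" "dec c1 X" "dec c2 (k # os, q)" "e \<le> 2" "m1 \<le> 1" "c1 < length w"
      using decodes_obtain[OF n[unfolded skip2]] by metis
    obtain g r d where d: "D [Cell, c2, g, r, d]" "dec d (os, q)" "c2 < length w" "g \<le> length w" "r \<le> length w" "d \<le> length w"
      using D_Cell_dec[OF c(3)] by metis
    have "D [Flat, v1, v2, e, m1, 1, c1, c2, e, m1, 1, c1, d]"
      using edges_rule[of 3 "[v1, v2, e, m1, 1, c1, c2, 0, d, 0, g, r]"] less c d by (simp add: P_edges_def Let_def)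
    then show ?thesis using c d unfolding skip2 by (intro exI[of _ "(e, m1, 1, c1, d)"]) (simp add: edge_id_def)
  next
    case (mark1 e k m2 os q Y)
    obtain c1 c2 where c: "n = (e, 0, m2, c1, c2)" "dec c1 (k # os, q)" "dec c2 Y" "e \<le> 2" "m2 \<le> 1" "c2 < length w"
      using decodes_obtain[OF n[unfolded mark1]] by metis
    obtain g r d where d: "D [Cell, c1, g, r, d]" "code w g (enc_nat (to_nat (fst k)))" "code w r (enc_nat (snd k))"
      "c1 < length w" "g \<le> length w" "r \<le> length w" "d \<le> length w"
      using D_Cell_dec[OF c(2)] by metis
    have "code w (if e = 2 then g else r) u1" using d mark1(4) by (auto simp: sel_def split: if_splits)
    then obtain a b where ab: "D [Eq, if e = 2 then g else r, a, v1, b]" "a \<le> length w" "b \<le> length w"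
      using D_Eq_code v(1) by blast
    have "e = 0 \<or> e = 1 \<or> e = 2" using c(4) by auto
    then have "D [Flat, v1, v2, e, 0, m2, c1, c2, e, 1, m2, c1, c2]"
      using edges_rule[of 4 "[v1, v2, 0, 0, m2, c1, c2, d, 0, 0, g, r, a, b]"]
        edges_rule[of 5 "[v1, v2, 0, 0, m2, c1, c2, d, 0, 0, g, r, a, b]"]
        edges_rule[of 6 "[v1, v2, 0, 0, m2, c1, c2, d, 0, 0, g, r, a, b]"] less c d ab
      by (elim disjE) (simp_all add: P_edges_def Let_def)
    then show ?thesis using c d unfolding mark1 by (intro exI[of _ "(e, 1, m2, c1, c2)"]) (simp add: edge_id_def)
  next
    case (mark2 e k m1 X os q)
    obtain c1 c2 where c: "n = (e, m1, 0, c1, c2)" "dec c1 X" "dec c2 (k # os, q)" "e \<le> 2" "m1 \<le> 1" "c1 < length w"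
      using decodes_obtain[OF n[unfolded mark2]] by metis
    obtain g r d where d: "D [Cell, c2, g, r, d]" "code w g (enc_nat (to_nat (fst k)))" "code w r (enc_nat (snd k))"
      "c2 < length w" "g \<le> length w" "r \<le> length w" "d \<le> length w"
      using D_Cell_dec[OF c(3)] by metis
    have "code w (if e = 2 then g else r) u2" using d mark2(4) by (auto simp: sel_def split: if_splits)
    then obtain a b where ab: "D [Eq, if e = 2 then g else r, a, v2, b]" "a \<le> length w" "b \<le> length w"
      using D_Eq_code v(2) by blast
    from mark2(5) have "D [Flat, v1, v2, e, m1, 0, c1, c2, e, m1, 1, c1, c2]"
      using edges_rule[of 7 "[v1, v2, 0, m1, 0, c1, c2, 0, d, 0, g, r, a, b]"]
        edges_rule[of 8 "[v1, v2, 0, m1, 0, c1, c2, 0, d, 0, g, r, a, b]"] less c d ab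
      by (elim disjE) (simp_all add: P_edges_def Let_def)
    then show ?thesis using c d unfolding mark2 by (intro exI[of _ "(e, m1, 1, c1, c2)"]) (simp add: edge_id_def)
  next
    case step
    from D_Pstep[OF v n step(2)] obtain n' where n': "decodes n' y" "D (Pstep # v1 # v2 # entries n @ entries n')" by blast
    obtain e m1 m2 X1 X2 where x: "x = (e, m1, m2, X1, X2)" by (cases x) auto
    obtain e' m1' m2' Y1 Y2 where y: "y = (e', m1', m2', Y1, Y2)" by (cases y) auto
    obtain c1 c2 where c: "n = (e, m1, m2, c1, c2)" "e \<le> 2" "m1 \<le> 1" "m2 \<le> 1" "c1 < length w" "c2 < length w"
      using decodes_obtain[OF n[unfolded x]] by metis
    obtain d1 d2 where d: "n' = (e', m1', m2', d1, d2)" "e' \<le> 2" "m1' \<le> 1" "m2' \<le> 1" "d1 < length w" "d2 < length w"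
      using decodes_obtain[OF n'(1)[unfolded y]] by metis
    have "D [Flat, v1, v2, e, m1, m2, c1, c2, e', m1', m2', d1, d2]"
      using edges_rule[of 9 "[v1, v2, e, m1, m2, c1, c2, d1, d2, e', m1', m2']"] less c d n'(2)
      by (simp add: P_edges_def Let_def)
    then show ?thesis using n'(1) c d step(1) by (intro exI[of _ n']) (simp add: edge_id_def)
  qed
qed

section \<open>Completeness for balanced pairs and lassos\<close>

definition small :: "pnode \<Rightarrow> bool" where
  "small = (\<lambda>(e, m1, m2, c1, c2). e \<le> 2 \<and> m1 \<le> 1 \<and> m2 \<le> 1 \<and> c1 < length w \<and> c2 < length w)"

lemma decodes_small: "decodes n x \<Longrightarrow> small n"
  using dec_less by (auto simp: decodes_def decn_def small_def split: prod.splits)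

lemma D_bracket:
  assumes "v1 < length w" "v2 < length w" "small n" "small n'" "small a" "small b"
    and "D (edge_id z # v1 # v2 # entries n @ entries a)" "D (Bal # v1 # v2 # entries a @ entries b)"
    "D (edge_id (- z) # v1 # v2 # entries b @ entries n')" "z = 1 \<or> z = - 1"
  shows "D (Bal # v1 # v2 # entries n @ entries n')"
proof -
  obtain e m1 m2 c1 c2 where n: "n = (e, m1, m2, c1, c2)" by (cases n) auto
  obtain ae a1 a2 a3 a4 where a: "a = (ae, a1, a2, a3, a4)" by (cases a) auto
  obtain be b1 b2 b3 b4 where b: "b = (be, b1, b2, b3, b4)" by (cases b) auto
  obtain de d1 d2 d3 d4 where d: "n' = (de, d1, d2, d3, d4)" by (cases n') auto
  from assms(10) show ?thesis
    using assms(1-9) lasso_rule[of 2 "[v1, v2, e, m1, m2, c1, c2, ae, a1, a2, a3, a4, be, b1, b2, b3, b4, de, d1, d2, d3, d4]"]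
      lasso_rule[of 3 "[v1, v2, e, m1, m2, c1, c2, ae, a1, a2, a3, a4, be, b1, b2, b3, b4, de, d1, d2, d3, d4]"]
    by (elim disjE) (simp_all add: P_lasso_def Let_def n a b d edge_id_def small_def)
qed

lemma D_trans:
  assumes "v1 < length w" "v2 < length w" "small n" "small a" "small b"
    and "D (Bal # v1 # v2 # entries n @ entries a)" "D (Bal # v1 # v2 # entries a @ entries b)"
  shows "D (Bal # v1 # v2 # entries n @ entries b)"
proof -
  obtain e m1 m2 c1 c2 where n: "n = (e, m1, m2, c1, c2)" by (cases n) auto
  obtain ae a1 a2 a3 a4 where a: "a = (ae, a1, a2, a3, a4)" by (cases a) auto
  obtain be b1 b2 b3 b4 where b: "b = (be, b1, b2, b3, b4)" by (cases b) auto
  show ?thesis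
    using assms lasso_rule[of 4 "[v1, v2, e, m1, m2, c1, c2, ae, a1, a2, a3, a4, be, b1, b2, b3, b4]"]
    by (simp add: P_lasso_def Let_def n a b small_def)
qed

lemma D_Bal_Flat:
  assumes "v1 < length w" "v2 < length w" "small n" "small a" "D (Flat # v1 # v2 # entries n @ entries a)"
  shows "D (Bal # v1 # v2 # entries n @ entries a)"
proof -
  obtain e m1 m2 c1 c2 where n: "n = (e, m1, m2, c1, c2)" by (cases n) auto
  obtain ae a1 a2 a3 a4 where a: "a = (ae, a1, a2, a3, a4)" by (cases a) auto
  show ?thesis
    using assms lasso_rule[of 1 "[v1, v2, e, m1, m2, c1, c2, ae, a1, a2, a3, a4]"]
    by (simp add: P_lasso_def Let_def n a small_def)
qed

lemma D_Bal_refl: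
  assumes "v1 < length w" "v2 < length w" "small n"
  shows "D (Bal # v1 # v2 # entries n @ entries n)"
proof -
  obtain e m1 m2 c1 c2 where n: "n = (e, m1, m2, c1, c2)" by (cases n) auto
  show ?thesis
    using assms lasso_rule[of 0 "[v1, v2, e, m1, m2, c1, c2]"]
    by (simp add: P_lasso_def Let_def n small_def)
qed

lemma D_Bal:
  assumes v: "code w v1 u1" "code w v2 u2" and "balanced (edge u1 u2) x y" "decodes n x"
  shows "\<exists>n'. decodes n' y \<and> D (Bal # v1 # v2 # entries n @ entries n')"
  using assms(3,4)
proof (induction arbitrary: n rule: balanced.induct)
  case (bal_refl x)
  then show ?case using D_Bal_refl code_less[OF v(1)] code_less[OF v(2)] decodes_small by blast
next
  case (bal_edge x y)
  from D_edge[OF v bal_edge(2,1)] obtain n' where "decodes n' y" "D (edge_id 0 # v1 # v2 # entries n @ entries n')" by blast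
  then show ?case
    using D_Bal_Flat[OF code_less[OF v(1)] code_less[OF v(2)] decodes_small[OF bal_edge(2)], of n'] decodes_small[of n' y]
    by (intro exI[of _ n']) (simp add: edge_id_def)
next
  case (bal_up x a b y)
  obtain na where na: "decodes na a" "D (edge_id 1 # v1 # v2 # entries n @ entries na)"
    using D_edge[OF v bal_up.prems bal_up(1)] by blast
  obtain nb where nb: "decodes nb b" "D (Bal # v1 # v2 # entries na @ entries nb)" using bal_up.IH[OF na(1)] by blast
  obtain n' where n': "decodes n' y" "D (edge_id (- 1) # v1 # v2 # entries nb @ entries n')"
    using D_edge[OF v nb(1) bal_up(3)] by blast
  show ?case
    using D_bracket[OF code_less[OF v(1)] code_less[OF v(2)] decodes_small[OF bal_up.prems] decodes_small[OF n'(1)]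
        decodes_small[OF na(1)] decodes_small[OF nb(1)] na(2) nb(2) n'(2)] n'(1) by blast
next
  case (bal_down x a b y)
  obtain na where na: "decodes na a" "D (edge_id (- 1) # v1 # v2 # entries n @ entries na)"
    using D_edge[OF v bal_down.prems bal_down(1)] by blast
  obtain nb where nb: "decodes nb b" "D (Bal # v1 # v2 # entries na @ entries nb)" using bal_down.IH[OF na(1)] by blast
  obtain n' where n': "decodes n' y" "D (edge_id (- (- 1)) # v1 # v2 # entries nb @ entries n')"
    using D_edge[OF v nb(1) bal_down(3)] by auto
  show ?case
    using D_bracket[OF code_less[OF v(1)] code_less[OF v(2)] decodes_small[OF bal_down.prems] decodes_small[OF n'(1)]
        decodes_small[OF na(1)] decodes_small[OF nb(1)] na(2) nb(2) n'(2)] n'(1) by blast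
next
  case (bal_trans x y z)
  obtain na where na: "decodes na y" "D (Bal # v1 # v2 # entries n @ entries na)" using bal_trans.IH(1)[OF bal_trans.prems] by blast
  obtain nb where nb: "decodes nb z" "D (Bal # v1 # v2 # entries na @ entries nb)" using bal_trans.IH(2)[OF na(1)] by blast
  show ?case
    using D_trans[OF code_less[OF v(1)] code_less[OF v(2)] decodes_small[OF bal_trans.prems] decodes_small[OF na(1)]
        decodes_small[OF nb(1)] na(2) nb(2)] nb(1) by blast
qed

lemma code_in_outs:
  "seg w d (enc_list enc_cell os) f \<Longrightarrow> (\<gamma>, \<rho>) \<in> set os \<Longrightarrow> (\<exists>p. code w p (enc_nat (to_nat \<gamma>))) \<and> (\<exists>p. code w p (enc_nat \<rho>))"
proof (induction os arbitrary: d)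
  case (Cons k os)
  obtain \<gamma>' \<rho>' where k: "k = (\<gamma>', \<rho>')" by (cases k)
  from D_Cell[OF Cons.prems(1)[unfolded k]] obtain r d' where
    "code w (Suc d) (enc_nat (to_nat \<gamma>'))" "code w r (enc_nat \<rho>')" "seg w d' (enc_list enc_cell os) f" by metis
  then show ?case using Cons k by auto
qed simp

text \<open>All these codes occur in w, so each has a position that can be the value of v1 or
  v2.\<close>

definition cell_codes :: "bool list set" where
  "cell_codes = (\<Union>t\<in>transitions T. \<Union>c\<in>set (out t). {enc_nat (to_nat (fst c)), enc_nat (snd c)})"

lemma cell_code: "u \<in> cell_codes \<Longrightarrow> \<exists>p. code w p u"
proof -
  assume "u \<in> cell_codes"
  then obtain t \<gamma> \<rho> where t: "t \<in> transitions T" "(\<gamma>, \<rho>) \<in> set (out t)" "u = enc_nat (to_nat \<gamma>) \<or> u = enc_nat \<rho>"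
    by (force simp: cell_codes_def)
  obtain p a s d where "at_transition p t a s d" using D_Trans[OF t(1)] by metis
  then obtain f where "seg w d (enc_list enc_cell (out t)) f" by (auto simp: at_transition_def dec_def)
  from code_in_outs[OF this t(2)] show ?thesis using t(3) by blast
qed

lemma D_Same:
  assumes "dec a ([], q)" "dec b ([], q)"
  shows "D [Same, a, b]"
proof -
  note a = dec_Nil[OF assms(1)] and b = dec_Nil[OF assms(2)]
  obtain x y where "D [Eq, Suc a, x, Suc b, y]" "x \<le> length w" "y \<le> length w" using D_Eq_code a b by blast
  then show ?thesis
    using lasso_rule[of 5 "[0, 0, 0, 0, 0, 0, 0, 0, a, Suc a, x, 0, 0, b, Suc b, y]"] a b dec_less[OF assms(1)] dec_less[OF assms(2)]
    by (simp add: P_lasso_def Let_def)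
qed

lemma D_Init:
  assumes v: "code w v1 u1" "code w v2 u2" and e: "e = 0 \<or> e = 2 \<and> u1 \<noteq> u2"
  obtains c where "D [Init, v1, v2, e, c]" "dec c ([], initial T)"
proof -
  obtain c f l where h: "D [Header, c, f, l]" "dec c ([], initial T)" "seg w f (enc_set (accepting T)) l" by (rule D_Header)
  obtain x y where xy: "D [Eq, v1, x, v1, y]" "x \<le> length w" using D_Eq_code[OF v(1) v(1)] by blast
  obtain x' y' where xy': "D [Eq, v2, x', v2, y']" "x' \<le> length w" using D_Eq_code[OF v(2) v(2)] by blast
  \<comment> \<open>The rule uses one variable for both ends of a number, while
    \<open>D_Eq_code\<close> yields two; they agree by the soundness of \<open>Eq\<close>.\<close>
  have "y = x" "y' = x'" using derives_meaning[OF xy(1)] derives_meaning[OF xy'(1)] seg_det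
    by (auto simp: meaning_simps[simplified] Eq_sem_def dest: raw_unique)
  then have "D [Init, v1, v2, e, c]"
    using e lasso_rule[of 6 "[v1, v2, 0, 0, 0, c, 0, 0, 0, 0, 0, 0, 0, 0, 0, 0, 0, 0, 0, 0, 0, 0, f, l, x, x']"]
      lasso_rule[of 7 "[v1, v2, 0, 0, 0, c, 0, 0, 0, 0, 0, 0, 0, 0, 0, 0, 0, 0, 0, 0, 0, 0, f, l, x, x']"]
      h(1) xy xy' code_less[OF v(1)] code_less[OF v(2)] dec_less[OF h(2)] enc_set_less[OF h(3)] D_Neq_code[OF v]
    by (auto simp: P_lasso_def Let_def)
  then show ?thesis using that h(2) by blast
qed

lemma has_lasso_derives:
  assumes "has_lasso cell_codes"
  shows "D [Goal]"
proof -
  obtain u1 u2 e0 e q1 q2 p1 p2 a b where l: "u1 \<in> cell_codes" "u2 \<in> cell_codes" "e0 = 0 \<or> e0 = 2 \<and> u1 \<noteq> u2"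
    "balanced (edge u1 u2) (start e0) (final e q1 q2)" "q1 \<in> accepting T"
    "pstep u1 u2 (final e q1 q2) a" "balanced (edge u1 u2) a (final e p1 p2)" "p2 \<in> accepting T"
    "pstep u1 u2 (final e p1 p2) b" "balanced (edge u1 u2) b (final e q1 q2)"
    using assms unfolding has_lasso_def by metis
  obtain v1 v2 where v: "code w v1 u1" "code w v2 u2" using cell_code l(1,2) by metis
  obtain c where c: "D [Init, v1, v2, e0, c]" "dec c ([], initial T)" using D_Init[OF v l(3)] .
  have "decodes (e0, 0, 0, c, c) (start e0)" using c(2) l(3) by (auto simp: start_def)
  from D_Bal[OF v l(4) this] obtain n1 where n1: "decodes n1 (final e q1 q2)"
    "D (Bal # v1 # v2 # entries (e0, 0, 0, c, c) @ entries n1)" by blast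
  from D_Pstep[OF v n1(1) l(6)] obtain n2 where n2: "decodes n2 a" "D (Pstep # v1 # v2 # entries n1 @ entries n2)" by blast
  from D_Bal[OF v l(7) n2(1)] obtain n3 where n3: "decodes n3 (final e p1 p2)" "D (Bal # v1 # v2 # entries n2 @ entries n3)" by blast
  from D_Pstep[OF v n3(1) l(9)] obtain n4 where n4: "decodes n4 b" "D (Pstep # v1 # v2 # entries n3 @ entries n4)" by blast
  from D_Bal[OF v l(10) n4(1)] obtain n5 where n5: "decodes n5 (final e q1 q2)" "D (Bal # v1 # v2 # entries n4 @ entries n5)" by blast
  obtain a1 a2 where f1: "n1 = (e, 1, 1, a1, a2)" "dec a1 ([], q1)" "dec a2 ([], q2)" "e \<le> 2"
    using decodes_obtain[OF n1(1)[unfolded final_def]] by metis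
  obtain b1 b2 where f3: "n3 = (e, 1, 1, b1, b2)" "dec b1 ([], p1)" "dec b2 ([], p2)"
    using decodes_obtain[OF n3(1)[unfolded final_def]] by metis
  obtain d1 d2 where f5: "n5 = (e, 1, 1, d1, d2)" "dec d1 ([], q1)" "dec d2 ([], q2)"
    using decodes_obtain[OF n5(1)[unfolded final_def]] by metis
  obtain ae m1 m2 a3 a4 where f2: "n2 = (ae, m1, m2, a3, a4)" by (cases n2) auto
  obtain be y z b3 b4 where f4: "n4 = (be, y, z, b3, b4)" by (cases n4) auto
  have acc: "D [Acc, a1]" "D [Acc, b2]" using D_Acc f1(2) f3(3) l(5,8) by blast+
  have same: "D [Same, a1, d1]" "D [Same, a2, d2]" using D_Same f1 f5 by blast+
  note sm = decodes_small[OF n2(1), unfolded f2] decodes_small[OF n4(1), unfolded f4]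
  show ?thesis
    using lasso_rule[of 8 "[v1, v2, e0, m1, m2, c, 0, ae, a1, a2, a3, a4, be, b1, b2, b3, b4, 0, d1, d2, 0, 0, e, y, z]"]
      c(1) n1(2) n2(2) n3(2) n4(2) n5(2) acc same sm f1(4) l(3)
      code_less[OF v(1)] code_less[OF v(2)] dec_less[OF c(2)] dec_less[OF f1(2)] dec_less[OF f1(3)]
      dec_less[OF f3(2)] dec_less[OF f3(3)] dec_less[OF f5(2)] dec_less[OF f5(3)]
    unfolding f1(1) f2 f3(1) f4 f5(1)
    by (auto simp: P_lasso_def Let_def small_def)
qed

text \<open>Soundness gives a lasso for arbitrary words as guesses, completeness uses codes of cells
  only. The circle closes since every lasso yields a conflict and every conflict a lasso of the
  restricted kind.\<close>

theorem derives_Goal_iff: "D [Goal] \<longleftrightarrow> conflicting T"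
proof
  assume "D [Goal]"
  then have "has_lasso UNIV" using derives_meaning[of "[Goal]"] by (simp add: meaning_simps[simplified])
  then show "conflicting T" by (rule has_lasso_conflicting)
next
  assume "conflicting T"
  then show "D [Goal]" using conflicting_has_lasso has_lasso_derives unfolding cell_codes_def by blast
qed

end

theorem theorem7:
  fixes d0 :: "'d::countable"
  assumes "infinite (UNIV :: 'd set)"
  shows "\<exists>L \<in> PTIME. \<forall>(T :: ('a::finite, 'b::finite, nat, nat) nrt) w.
           is_nrt T \<and> infinite_outputs d0 T \<and> test_free T \<and> encodes w T \<longrightarrow>
             (w \<in> L \<longleftrightarrow> functional d0 T)"
proof (intro bexI allI impI)
  \<comment> \<open>One program for all transducers, alphabets and data domains; only words that
    encode a transducer as required are subject to the claim.\<close>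
  let ?L = "{w. \<not> derives program w (length w + 23) [Goal]}"
  show "?L \<in> PTIME"
    using datalog_PTIME[OF wf_program, of "[TC Goal]"] by simp
  fix T :: "('a, 'b, nat, nat) nrt" and w
  assume T: "is_nrt T \<and> infinite_outputs d0 T \<and> test_free T \<and> encodes w T"
  then obtain ts where "set ts = transitions T" "w = enc_set (states T) @ enc_set (registers T) @ enc_nat (initial T) @
            enc_set (accepting T) @ enc_list enc_transition ts"
    by (auto simp: encodes_def)
  then interpret encoded_nrt T w ts using T by unfold_locales auto
  show "w \<in> ?L \<longleftrightarrow> functional d0 T"
    using derives_Goal_iff conflicting_not_functional[OF assms, of T d0] not_functional_conflicting[of d0 T] T by auto
qed

end
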